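(* Let $P\Sigma\mathrm{Aut}_3$ be the group of pure symmetric automorphisms of the free group $F_3$. Then $\Sigma^2(P\Sigma\mathrm{Aut}_3)=\emptyset$.
   Context: Groups. Let $F_3$ be the free group with basis $x_1,x_2,x_3$. An automorphism of $F_3$ is pure symmetric if it maps each $x_i$ to a conjugate of $x_i$. The group of all pure symmetric automorphisms is $P\Sigma\mathrm{Aut}_3$. It is of type $\mathrm{F}_\infty$ (i.e. for every $m$ it has a classifying space with compact $m$-skeleton). BNSR-invariants. A character of a group $G$ is a homomorphism $G\to\mathbb{R}$. The character sphere $S(G)$ is the set of classes $[\chi]$ of non-trivial characters of $G$ modulo scaling by positive reals. Let $G$ act properly and cocompactly (cellularly) on an $(N-1)$-connected CW-complex $Y$. For a character $\chi$ of $G$ there is a map $h_\chi\colon Y\to\mathbb{R}$ with $h_\chi(g.y)=\chi(g)+h_\chi(y)$ for all $g\in G$, $y\in Y$. Let $Y_{\chi\ge t}$ be the full subcomplex of $Y$ supported on the $0$-cells $y$ with $h_\chi(y)\ge t$. For $m\le N$, $\Sigma^m(G)$ is the set of $[\chi]\in S(G)$ such that the filtration $(Y_{\chi\ge t})_{t\in\mathbb{R}}$ is essentially $(m-1)$-connected, meaning: for all $t\in\mathbb{R}$ there is $-\infty<s\le t$ such that the inclusion $Y_{\chi\ge t}\to Y_{\chi\ge s}$ induces the trivial map in $\pi_k$ for all $k\le m-1$. This is independent of the choice of $Y$ and $h_\chi$. *)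

theory Defs
  imports
    "HOL-Analysis.Analysis"
    "HOL-Algebra.Bij"
    "HOL-Algebra.Group_Action"
begin

section \<open>Free groups and pure symmetric automorphisms\<close>

text \<open>
  The free group with basis \<open>I\<close> is realised on the reduced words in the letters
  \<open>(i, True)\<close> (standing for \<open>i\<close>) and \<open>(i, False)\<close> (standing for the inverse of \<open>i\<close>);
  the product of two words is the reduced form of their concatenation.
\<close>

definition inv_letter :: "'i \<times> bool \<Rightarrow> 'i \<times> bool" where
  "inv_letter a = (fst a, \<not> snd a)"

fun reduced :: "('i \<times> bool) list \<Rightarrow> bool" where
  "reduced (a # b # w) \<longleftrightarrow> b \<noteq> inv_letter a \<and> reduced (b # w)"
| "reduced w \<longleftrightarrow> True"

fun cons_reduce :: "'i \<times> bool \<Rightarrow> ('i \<times> bool) list \<Rightarrow> ('i \<times> bool) list" where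
  "cons_reduce a [] = [a]"
| "cons_reduce a (b # w) = (if b = inv_letter a then w else a # b # w)"

definition free_group :: "'i set \<Rightarrow> ('i \<times> bool) list monoid" where
  "free_group I =
     \<lparr>carrier = {w. reduced w \<and> fst ` set w \<subseteq> I},
      monoid.mult = (\<lambda>u v. foldr cons_reduce u v),
      one = []\<rparr>"

definition free_gen :: "'i \<Rightarrow> ('i \<times> bool) list" where
  "free_gen i = [(i, True)]"

definition pure_symmetric_auts :: "'i set \<Rightarrow> (('i \<times> bool) list \<Rightarrow> ('i \<times> bool) list) set" where
  "pure_symmetric_auts I =
     {\<phi> \<in> auto (free_group I).
        \<forall>i\<in>I. \<exists>w\<in>carrier (free_group I).
          \<phi> (free_gen i) =
            w \<otimes>\<^bsub>free_group I\<^esub> free_gen i \<otimes>\<^bsub>free_group I\<^esub> inv\<^bsub>free_group I\<^esub> w}"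

definition PSigmaAut :: "'i set \<Rightarrow> (('i \<times> bool) list \<Rightarrow> ('i \<times> bool) list) monoid" where
  "PSigmaAut I = (AutoGroup (free_group I)) \<lparr>carrier := pure_symmetric_auts I\<rparr>"

abbreviation PSigmaAut3 :: "((nat \<times> bool) list \<Rightarrow> (nat \<times> bool) list) monoid" where
  "PSigmaAut3 \<equiv> PSigmaAut {1, 2, 3}"


section \<open>CW-complexes\<close>

definition nball :: "nat \<Rightarrow> (nat \<Rightarrow> real) topology" where
  "nball n = subtopology (Euclidean_space n) {x. (\<Sum>i<n. x i ^ 2) \<le> 1}"

definition nball_interior :: "nat \<Rightarrow> (nat \<Rightarrow> real) set" where
  "nball_interior n = {x \<in> topspace (nball n). (\<Sum>i<n. x i ^ 2) < 1}"

definition nball_boundary :: "nat \<Rightarrow> (nat \<Rightarrow> real) set" where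
  "nball_boundary n = {x \<in> topspace (nball n). (\<Sum>i<n. x i ^ 2) = 1}"

text \<open>
  \<open>E n\<close> is the set of open \<open>n\<close>-cells. The condition on \<open>\<F>\<close> is closure-finiteness, the
  last condition says that \<open>X\<close> carries the weak topology.
\<close>

definition CW_complex :: "'a topology \<Rightarrow> (nat \<Rightarrow> 'a set set) \<Rightarrow> bool" where
  "CW_complex X E \<longleftrightarrow>
     Hausdorff_space X \<and>
     (\<Union>n. \<Union>(E n)) = topspace X \<and>
     (\<forall>m n. \<forall>d\<in>E m. \<forall>e\<in>E n. d \<inter> e \<noteq> {} \<longrightarrow> m = n \<and> d = e) \<and>
     (\<forall>n. \<forall>e\<in>E n. \<exists>\<Phi>.
        continuous_map (nball n) X \<Phi> \<and>
        homeomorphic_map (subtopology (nball n) (nball_interior n)) (subtopology X e) \<Phi> \<and>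
        (\<exists>\<F>. finite \<F> \<and> \<F> \<subseteq> (\<Union>k<n. E k) \<and> \<Phi> ` nball_boundary n \<subseteq> \<Union>\<F>)) \<and>
     (\<forall>A\<subseteq>topspace X. (\<forall>n. \<forall>e\<in>E n. closedin X (A \<inter> X closure_of e)) \<longrightarrow> closedin X A)"

definition subcomplex :: "'a topology \<Rightarrow> (nat \<Rightarrow> 'a set set) \<Rightarrow> 'a set \<Rightarrow> bool" where
  "subcomplex X E Z \<longleftrightarrow>
     Z \<subseteq> topspace X \<and> (\<forall>n. \<forall>e\<in>E n. e \<inter> Z \<noteq> {} \<longrightarrow> X closure_of e \<subseteq> Z)"

text \<open>
  The full subcomplex supported on a set \<open>V\<close> of \<open>0\<close>-cells is the largest subcomplex all of
  whose \<open>0\<close>-cells lie in \<open>V\<close> (a union of subcomplexes is a subcomplex).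
\<close>

definition full_subcomplex :: "'a topology \<Rightarrow> (nat \<Rightarrow> 'a set set) \<Rightarrow> 'a set \<Rightarrow> 'a set" where
  "full_subcomplex X E V = \<Union>{Z. subcomplex X E Z \<and> Z \<inter> \<Union>(E 0) \<subseteq> V}"


section \<open>Homotopy groups\<close>

definition sphere_base :: "nat \<Rightarrow> real" where
  "sphere_base = (\<lambda>i. if i = 0 then 1 else 0)"

text \<open>
  For subspaces \<open>A \<subseteq> B\<close> of \<open>X\<close>, the inclusion induces the trivial map in \<open>\<pi>\<^sub>k\<close>: for every
  base point \<open>a \<in> A\<close>, every element of \<open>\<pi>\<^sub>k(A, a)\<close> is sent to the class of the constant
  map in \<open>\<pi>\<^sub>k(B, a)\<close>. Elements of \<open>\<pi>\<^sub>k\<close> are pointed homotopy classes of pointed maps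
  from the \<open>k\<close>-sphere.
\<close>

definition incl_trivial_on_pi :: "nat \<Rightarrow> 'a topology \<Rightarrow> 'a set \<Rightarrow> 'a set \<Rightarrow> bool" where
  "incl_trivial_on_pi k X A B \<longleftrightarrow>
     (\<forall>a \<in> topspace (subtopology X A). \<forall>f.
        continuous_map (nsphere k) (subtopology X A) f \<and> f sphere_base = a \<longrightarrow>
        homotopic_with (\<lambda>g. g sphere_base = a) (nsphere k) (subtopology X B) f (\<lambda>_. a))"

text \<open>
  \<open>k_connected N X\<close> says that \<open>X\<close> is \<open>(N - 1)\<close>-connected; in particular
  \<open>X\<close> is nonempty, also for \<open>N = 0\<close>.
\<close>

definition k_connected :: "nat \<Rightarrow> 'a topology \<Rightarrow> bool" where
  "k_connected N X \<longleftrightarrow>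
     topspace X \<noteq> {} \<and> (\<forall>k<N. incl_trivial_on_pi k X (topspace X) (topspace X))"


section \<open>Characters\<close>

definition real_add_group :: "real monoid" where
  "real_add_group = \<lparr>carrier = UNIV, monoid.mult = (+), one = 0\<rparr>"

definition nontrivial_characters :: "('g, 'c) monoid_scheme \<Rightarrow> ('g \<Rightarrow> real) set" where
  "nontrivial_characters G =
     {\<psi> \<in> hom G real_add_group. \<exists>g\<in>carrier G. \<psi> g \<noteq> 0}"

text \<open>
  Values outside the carrier are irrelevant, so characters which agree on the carrier
  are identified as well.
\<close>

definition pos_scaling :: "('g, 'c) monoid_scheme \<Rightarrow> (('g \<Rightarrow> real) \<times> ('g \<Rightarrow> real)) set" where
  "pos_scaling G =
     {(\<psi>, \<psi>'). \<psi> \<in> nontrivial_characters G \<and> \<psi>' \<in> nontrivial_characters G \<and>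
        (\<exists>c>0. \<forall>g\<in>carrier G. \<psi>' g = c * \<psi> g)}"

definition character_sphere :: "('g, 'c) monoid_scheme \<Rightarrow> ('g \<Rightarrow> real) set set" where
  "character_sphere G = nontrivial_characters G // pos_scaling G"


section \<open>BNSR-invariants\<close>

text \<open>
  Proper cocompact cellular actions. Properness is stated with compact sets; for a cellular
  action on a CW-complex it amounts to finiteness of all cell stabilisers.
\<close>

definition proper_cocompact_cellular_action ::
    "('g, 'c) monoid_scheme \<Rightarrow> 'a topology \<Rightarrow> (nat \<Rightarrow> 'a set set) \<Rightarrow> ('g \<Rightarrow> 'a \<Rightarrow> 'a) \<Rightarrow> bool"
  where
  "proper_cocompact_cellular_action G Y E act \<longleftrightarrow>
     group_action G (topspace Y) act \<and>
     (\<forall>g\<in>carrier G. homeomorphic_map Y Y (act g)) \<and>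
     (\<forall>g\<in>carrier G. \<forall>n. \<forall>e\<in>E n. act g ` e \<in> E n) \<and>
     (\<forall>K. compactin Y K \<longrightarrow> finite {g \<in> carrier G. act g ` K \<inter> K \<noteq> {}}) \<and>
     (\<exists>K. compactin Y K \<and> (\<Union>g\<in>carrier G. act g ` K) = topspace Y)"

definition height_map ::
    "('g, 'c) monoid_scheme \<Rightarrow> 'a topology \<Rightarrow> ('g \<Rightarrow> 'a \<Rightarrow> 'a) \<Rightarrow> ('g \<Rightarrow> real) \<Rightarrow> ('a \<Rightarrow> real) \<Rightarrow> bool"
  where
  "height_map G Y act \<psi> h \<longleftrightarrow>
     continuous_map Y euclideanreal h \<and>
     (\<forall>g\<in>carrier G. \<forall>y\<in>topspace Y. h (act g y) = \<psi> g + h y)"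

definition superlevel ::
    "'a topology \<Rightarrow> (nat \<Rightarrow> 'a set set) \<Rightarrow> ('a \<Rightarrow> real) \<Rightarrow> real \<Rightarrow> 'a set" where
  "superlevel Y E h t = full_subcomplex Y E {y \<in> \<Union>(E 0). h y \<ge> t}"

text \<open>\<open>essentially_connected m\<close> is essential \<open>(m - 1)\<close>-connectedness.\<close>

definition essentially_connected :: "nat \<Rightarrow> 'a topology \<Rightarrow> (real \<Rightarrow> 'a set) \<Rightarrow> bool" where
  "essentially_connected m Y F \<longleftrightarrow>
     (\<forall>t. \<exists>s\<le>t. \<forall>k<m. incl_trivial_on_pi k Y (F t) (F s))"

text \<open>
  The invariant does not depend on the choice of \<open>Y\<close> and \<open>h\<close>, so it is defined by
  asking for some choice. The carrier type \<open>'g \<times> real\<close> for \<open>Y\<close> is no restriction: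
  a cocompact \<open>G\<close>-CW-complex has only finitely many orbits of cells, hence at most
  as many points as \<open>G \<times> \<real>\<close>. Such \<open>Y\<close> exists for every \<open>N\<close> whenever \<open>G\<close>
  is of type \<open>F\<^sub>\<infinity>\<close>, as pure symmetric automorphism groups are.
\<close>

definition BNSR :: "nat \<Rightarrow> ('g, 'c) monoid_scheme \<Rightarrow> ('g \<Rightarrow> real) set set" where
  "BNSR m G =
     {c \<in> character_sphere G.
        \<exists>\<psi>\<in>c. \<exists>(Y :: ('g \<times> real) topology) E act N h.
          CW_complex Y E \<and> m \<le> N \<and> k_connected N Y \<and>
          proper_cocompact_cellular_action G Y E act \<and>
          height_map G Y act \<psi> h \<and>
          essentially_connected m Y (superlevel Y E h)}"

end

theory Submission
  imports Defs
begin

text \<open>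
  Modulo the inner automorphisms \<open>F\<^sub>3\<close>, the pure symmetric automorphism group is again free of
  rank \<open>3\<close>, so every element is uniquely an inner automorphism \<open>w\<close> times a lift of a reduced
  word \<open>q\<close>. For the commutator \<open>c\<close> of the first two generators, conjugation by \<open>c\<close> and the lift of \<open>c\<close>
  commute and lie in the commutator subgroup. They span a flat plane on which all
  characters vanish. The two predicates ``\<open>w\<close> starts with \<open>x\<^sub>1\<close>'' and ``\<open>q\<close> starts with
  \<open>x\<^sub>1\<close>'' are half spaces cutting the plane along two transverse lines, and only finitely many group elements
  are close to both walls. Their cup product is therefore a compactly supported \<open>2\<close>-cocycle
  that is nonzero on the plane.

  If \<open>[\<psi>]\<close> were in \<open>\<Sigma>\<^sup>2\<close>, the plane could be pushed to a plane of arbitrarily large height.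
  A large rectangle in it winds once around the walls, but has a null-homotopy which is still
  too high to meet the support of the cocycle, a contradiction. Heights are compared in \<open>Y\<close>, and
  the null-homotopy is cut into a fine grid, whose vertices are labelled by nearby group elements.
\<close>

section \<open>Finiteness properties of CW-complexes\<close>

text \<open>One plane serves every character, and every choice of \<open>Y\<close> and
  \<open>h\<close> is refuted.

  Translates of a compact fundamental set that overlap have labels differing by right multiplication
  with one of finitely many elements, whereas the plane acts from the left. So the walls have to be
  thin for right multiplication and unbounded along left translates.

  The obstacle is that the two walls are not symmetric. In a product the inner coordinate is twisted
  by the outer one, as in \<open>w + app (lift_out q) w'\<close>, so the thickness of the wall in
  \<open>w\<close> depends on \<open>q\<close>. Only the joint condition is finite: crossing the
  second wall bounds \<open>q\<close>, and then finitely many \<open>w\<close> remain. For the same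
  reason a left translation in the outer direction may disturb the first half space, so the extent
  of the rectangle in that direction has to be fixed before its extent in the inner one.

  A nontrivial character is bounded on the finite set near both walls and unbounded on the group;
  this leaves room to lift the rectangle and its filling clear of that set.\<close>

lemma compact_space_nball: "compact_space (nball n)"
proof -
  let ?P = "powertop_real (UNIV :: nat set)"
  let ?B = "{x. \<forall>i\<ge>n. x i = 0} \<inter> {x :: nat \<Rightarrow> real. (\<Sum>i<n. x i ^ 2) \<le> 1}"
  \<comment> \<open>\<open>Euclidean_space n\<close> lies in a countable power of the reals, so a
    cube in that power is compact by Tychonoff's theorem; the ball is cut out of it by closed
    conditions.\<close>
  have "compactin ?P (PiE UNIV (\<lambda>_. {-1..1}))"
    by (subst compactin_PiE) auto
  moreover have "closedin ?P ?B"
  proof (rule closedin_Int)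
    show "closedin ?P {x. \<forall>i\<ge>n. x i = 0}"
      using closedin_Euclidean_space[of n] by (simp add: topspace_Euclidean_space)
    have "continuous_map ?P euclideanreal (\<lambda>x. \<Sum>i<n. x i ^ 2)"
      by (intro continuous_intros) auto
    then have "closedin ?P {x \<in> topspace ?P. (\<Sum>i<n. x i ^ 2) \<in> {..1}}"
      by (rule closedin_continuous_map_preimage) simp
    then show "closedin ?P {x :: nat \<Rightarrow> real. (\<Sum>i<n. x i ^ 2) \<le> 1}" by simp
  qed
  moreover have "?B \<subseteq> PiE UNIV (\<lambda>_. {-1..1})"
  proof
    fix x assume x: "x \<in> ?B"
    have "\<bar>x i\<bar> \<le> 1" for i
    proof (cases "i < n")
      case True
      then have "x i ^ 2 \<le> (\<Sum>i<n. x i ^ 2)" by (intro member_le_sum) auto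
      then have "x i ^ 2 \<le> 1" using x by auto
      then show ?thesis by (simp add: abs_square_le_1)
    next
      case False
      then show ?thesis using x by auto
    qed
    then show "x \<in> PiE UNIV (\<lambda>_. {-1..1})" by (auto simp: abs_le_iff minus_le_iff)
  qed
  ultimately have "compactin ?P ?B" using closed_compactin by blast
  then show ?thesis
    by (simp add: nball_def Euclidean_space_def subtopology_subtopology compact_space_subtopology)
qed

section \<open>Cells, their closures and finite subcomplexes\<close>

locale cw_complex =
  fixes X :: "'a topology" and E :: "nat \<Rightarrow> 'a set set"
  assumes cw: "CW_complex X E"
begin

lemma Hausdorff: "Hausdorff_space X"
  using cw by (simp add: CW_complex_def)

lemma cells_cover: "(\<Union>n. \<Union>(E n)) = topspace X"
  using cw by (simp add: CW_complex_def)

lemma cells_disjoint: "d \<in> E m \<Longrightarrow> e \<in> E n \<Longrightarrow> x \<in> d \<Longrightarrow> x \<in> e \<Longrightarrow> m = n \<and> d = e"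
proof -
  have "\<forall>m n. \<forall>d\<in>E m. \<forall>e\<in>E n. d \<inter> e \<noteq> {} \<longrightarrow> m = n \<and> d = e"
    using cw unfolding CW_complex_def by (elim conjE)
  then show "d \<in> E m \<Longrightarrow> e \<in> E n \<Longrightarrow> x \<in> d \<Longrightarrow> x \<in> e \<Longrightarrow> m = n \<and> d = e"
    by blast
qed

lemma cell_subset: "e \<in> E n \<Longrightarrow> e \<subseteq> topspace X"
  using cells_cover by blast

lemma cell_exists: "x \<in> topspace X \<Longrightarrow> \<exists>n. \<exists>e\<in>E n. x \<in> e"
  using cells_cover by blast

lemma characteristic_map:
  assumes "e \<in> E n"
  obtains \<Phi> \<F> where "continuous_map (nball n) X \<Phi>" "\<Phi> ` nball_interior n = e"
    "finite \<F>" "\<F> \<subseteq> (\<Union>k<n. E k)" "\<Phi> ` nball_boundary n \<subseteq> \<Union>\<F>"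
proof -
  obtain \<Phi> \<F> where \<Phi>: "continuous_map (nball n) X \<Phi>"
    "homeomorphic_map (subtopology (nball n) (nball_interior n)) (subtopology X e) \<Phi>"
    "finite \<F>" "\<F> \<subseteq> (\<Union>k<n. E k)" "\<Phi> ` nball_boundary n \<subseteq> \<Union>\<F>"
  proof -
    have "\<forall>n. \<forall>e\<in>E n. \<exists>\<Phi>. continuous_map (nball n) X \<Phi> \<and>
        homeomorphic_map (subtopology (nball n) (nball_interior n)) (subtopology X e) \<Phi> \<and>
        (\<exists>\<F>. finite \<F> \<and> \<F> \<subseteq> (\<Union>k<n. E k) \<and> \<Phi> ` nball_boundary n \<subseteq> \<Union>\<F>)"
      using cw unfolding CW_complex_def by (elim conjE)
    from bspec[OF spec[OF this] assms] show thesis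
      by (elim exE conjE) (rule that)
  qed
  have surj: "\<Phi> ` nball_interior n = e"
    using homeomorphic_imp_surjective_map[OF \<Phi>(2)] cell_subset[OF assms]
    by (simp add: Int_absorb1 nball_interior_def)
  show thesis
    by (rule that[OF \<Phi>(1) surj \<Phi>(3,4,5)])
qed

lemma nball_cases: "x \<in> topspace (nball n) \<Longrightarrow> x \<in> nball_interior n \<or> x \<in> nball_boundary n"
  by (auto simp: nball_interior_def nball_boundary_def nball_def)

text \<open>The characteristic map sends the closed ball to a compact, hence closed, set containing
  \<open>e\<close>, so the closure adds at most images of boundary points.\<close>

lemma cell_closure:
  assumes "e \<in> E n"
  obtains \<F> where "finite \<F>" "\<F> \<subseteq> (\<Union>k<n. E k)" "X closure_of e \<subseteq> e \<union> \<Union>\<F>"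
proof -
  obtain \<Phi> \<F> where \<Phi>: "continuous_map (nball n) X \<Phi>" "\<Phi> ` nball_interior n = e"
    "finite \<F>" "\<F> \<subseteq> (\<Union>k<n. E k)" "\<Phi> ` nball_boundary n \<subseteq> \<Union>\<F>"
    by (rule characteristic_map[OF assms])
  have "compactin X (\<Phi> ` topspace (nball n))"
    using image_compactin[OF compact_space_nball[unfolded compact_space_def] \<Phi>(1)] .
  then have "closedin X (\<Phi> ` topspace (nball n))"
    using Hausdorff compactin_imp_closedin by blast
  moreover have "e \<subseteq> \<Phi> ` topspace (nball n)"
    using \<Phi>(2) by (auto simp: nball_interior_def)
  ultimately have "X closure_of e \<subseteq> \<Phi> ` topspace (nball n)"
    by (simp add: closure_of_minimal)
  also have "\<dots> \<subseteq> e \<union> \<Union>\<F>"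
    using nball_cases \<Phi>(2,5) by blast
  finally show thesis by (rule that[OF \<Phi>(3,4)])
qed

lemma zero_cell: 
  assumes "e \<in> E 0"
  obtains v where "e = {v}"
proof -
  obtain \<Phi> \<F> where "continuous_map (nball 0) X \<Phi>" "\<Phi> ` nball_interior 0 = e"
    "finite \<F>" "\<F> \<subseteq> (\<Union>k<0. E k)" "\<Phi> ` nball_boundary 0 \<subseteq> \<Union>\<F>"
    by (rule characteristic_map[OF assms])
  moreover have "nball_interior 0 = {\<lambda>_. 0}"
    by (auto simp: nball_interior_def nball_def topspace_Euclidean_space)
  ultimately show thesis using that by auto
qed

lemma subcomplex_closure_of: "subcomplex X E Z \<Longrightarrow> e \<in> E n \<Longrightarrow> x \<in> e \<Longrightarrow> x \<in> Z \<Longrightarrow> X closure_of e \<subseteq> Z"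
  unfolding subcomplex_def by blast

text \<open>Induction on the dimension: finite subcomplexes around the lower cells that cover the
  boundary are added to \<open>e\<close>. Only 0-cells are counted, because superlevels are defined
  by heights of 0-cells.\<close>

lemma finite_subcomplex:
  assumes "e \<in> E n"
  shows "\<exists>Z. subcomplex X E Z \<and> e \<subseteq> Z \<and> finite (Z \<inter> \<Union>(E 0))"
  using assms
proof (induction n arbitrary: e rule: less_induct)
  case (less n)
  obtain \<F> where \<F>: "finite \<F>" "\<F> \<subseteq> (\<Union>k<n. E k)" "X closure_of e \<subseteq> e \<union> \<Union>\<F>"
    by (rule cell_closure[OF less.prems])
  have "\<exists>Z. subcomplex X E Z \<and> d \<subseteq> Z \<and> finite (Z \<inter> \<Union>(E 0))" if "d \<in> \<F>" for d
    using that \<F>(2) less.IH by blast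
  then obtain Z where Z: "\<And>d. d \<in> \<F> \<Longrightarrow> subcomplex X E (Z d) \<and> d \<subseteq> Z d \<and> finite (Z d \<inter> \<Union>(E 0))"
    by metis
  define W where "W = e \<union> (\<Union>d\<in>\<F>. Z d)"
  have "X closure_of e \<subseteq> W" using \<F>(3) Z unfolding W_def by blast
  have "subcomplex X E W"
    unfolding subcomplex_def
  proof (intro conjI allI ballI impI)
    show "W \<subseteq> topspace X"
      using cell_subset[OF less.prems] Z unfolding W_def subcomplex_def by blast
    fix m d assume d: "d \<in> E m" "d \<inter> W \<noteq> {}"
    then obtain x where x: "x \<in> d" "x \<in> W" by blast
    show "X closure_of d \<subseteq> W"
    proof (cases "x \<in> e")
      case True
      then show ?thesis
        using cells_disjoint[OF d(1) less.prems x(1)] \<open>X closure_of e \<subseteq> W\<close> by blast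
    next
      case False
      then obtain c where "c \<in> \<F>" "x \<in> Z c" using x unfolding W_def by blast
      then show ?thesis
        using subcomplex_closure_of[of "Z c" d m x] Z d(1) x(1) unfolding W_def by blast
    qed
  qed
  moreover have "finite (W \<inter> \<Union>(E 0))"
  proof -
    have "finite (e \<inter> \<Union>(E 0))"
    proof (cases "e \<inter> \<Union>(E 0) = {}")
      case False
      then have "e \<in> E 0" using cells_disjoint[OF less.prems] by blast
      then obtain v where "e = {v}" by (rule zero_cell)
      then show ?thesis by simp
    qed simp
    moreover have "W \<inter> \<Union>(E 0) = e \<inter> \<Union>(E 0) \<union> (\<Union>d\<in>\<F>. Z d \<inter> \<Union>(E 0))"
      unfolding W_def by blast
    moreover have "finite (\<Union>d\<in>\<F>. Z d \<inter> \<Union>(E 0))"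
      using \<F>(1) Z by blast
    ultimately show ?thesis by simp
  qed
  ultimately show ?case unfolding W_def by blast
qed

text \<open>The base point of the boundary sphere is approached along the radius
  \<open>\<gamma>\<close>. One boundary point in the closure of the open cell is enough for the
  descent in \<open>zero_cell_below\<close>.\<close>

lemma sphere_base_in_closure:
  assumes "n > 0" "continuous_map (nball n) X \<Phi>" 
  shows "\<Phi> sphere_base \<in> X closure_of (\<Phi> ` nball_interior n)" "sphere_base \<in> nball_boundary n"
proof -
  let ?I = "top_of_set {0..1::real}"
  define \<gamma> :: "real \<Rightarrow> nat \<Rightarrow> real" where "\<gamma> r = (\<lambda>i. if i < n then (if i = 0 then r else 0) else 0)" for r
  have sum: "(\<Sum>i<n. (\<gamma> r i)\<^sup>2) = r\<^sup>2" for r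
  proof -
    have "(\<Sum>i<n. (\<gamma> r i)\<^sup>2) = (\<Sum>i<n. if i = 0 then r\<^sup>2 else 0)"
      by (rule sum.cong) (auto simp: \<gamma>_def)
    then show ?thesis using assms(1) by simp
  qed
  have base: "sphere_base = \<gamma> 1"
    using assms(1) by (auto simp: sphere_base_def \<gamma>_def fun_eq_iff)
  have in_ball: "\<gamma> r \<in> topspace (nball n)" if "r \<in> {0..1}" for r
  proof -
    have "r\<^sup>2 \<le> 1" using that by (simp add: power_le_one)
    then show ?thesis
      using sum[of r] by (simp add: nball_def topspace_Euclidean_space) (simp add: \<gamma>_def)
  qed
  show "sphere_base \<in> nball_boundary n"
    using in_ball[of 1] sum[of 1] by (simp add: base nball_boundary_def)
  have "continuous_map ?I (Euclidean_space n) \<gamma>"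
    unfolding \<gamma>_def by (subst continuous_map_componentwise_Euclidean_space) auto
  then have "continuous_map ?I (nball n) \<gamma>"
    using in_ball unfolding nball_def continuous_map_in_subtopology by auto
  then have "continuous_map ?I X (\<Phi> \<circ> \<gamma>)"
    using assms(2) by (rule continuous_map_compose)
  then have image: "(\<Phi> \<circ> \<gamma>) ` (?I closure_of {0..<1}) \<subseteq> X closure_of ((\<Phi> \<circ> \<gamma>) ` {0..<1})"
    by (rule continuous_map_image_closure_subset)
  have "1 \<in> ?I closure_of {0..<1}"
    by (auto simp: closure_of_subtopology euclidean_closure_of closure_atLeastLessThan Int_absorb1 atLeastLessThan_subseteq_atLeastAtMost_iff)
  then have "(\<Phi> \<circ> \<gamma>) 1 \<in> X closure_of ((\<Phi> \<circ> \<gamma>) ` {0..<1})"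
    by (rule subsetD[OF image imageI])
  moreover have "(\<Phi> \<circ> \<gamma>) ` {0..<1} \<subseteq> \<Phi> ` nball_interior n"
    using in_ball sum by (auto simp: nball_interior_def power_less_one_iff abs_square_less_1 intro!: imageI)
  ultimately have "(\<Phi> \<circ> \<gamma>) 1 \<in> X closure_of (\<Phi> ` nball_interior n)"
    by (rule subsetD[OF closure_of_mono, rotated])
  then show "\<Phi> sphere_base \<in> X closure_of (\<Phi> ` nball_interior n)"
    by (simp add: base)
qed

text \<open>A subcomplex meeting \<open>e\<close> contains the closure of \<open>e\<close>, hence
  the image of \<open>sphere_base\<close>, which lies in a cell of smaller dimension. The descent
  ends at a 0-cell that depends on \<open>e\<close> alone and not on \<open>Z\<close>.\<close>

lemma zero_cell_below:
  assumes "e \<in> E n"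
  shows "\<exists>v\<in>\<Union>(E 0). \<forall>Z. subcomplex X E Z \<and> e \<inter> Z \<noteq> {} \<longrightarrow> v \<in> Z"
  using assms
proof (induction n arbitrary: e rule: less_induct)
  case (less n)
  show ?case
  proof (cases "n = 0")
    case True
    then obtain v where "e = {v}" using zero_cell less.prems by metis
    then show ?thesis using True less.prems by (intro bexI[of _ v]) auto
  next
    case False
    obtain \<Phi> \<F> where \<Phi>: "continuous_map (nball n) X \<Phi>" "\<Phi> ` nball_interior n = e"
      "finite \<F>" "\<F> \<subseteq> (\<Union>k<n. E k)" "\<Phi> ` nball_boundary n \<subseteq> \<Union>\<F>"
      by (rule characteristic_map[OF less.prems])
    define x where "x = \<Phi> sphere_base"
    have x: "x \<in> X closure_of e" "x \<in> \<Union>\<F>"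
      using sphere_base_in_closure[OF _ \<Phi>(1)] False \<Phi>(2,5) by (auto simp: x_def)
    then obtain d k where d: "d \<in> E k" "k < n" "x \<in> d" using \<Phi>(4) by blast
    then obtain v where v: "v \<in> \<Union>(E 0)" "\<And>Z. subcomplex X E Z \<and> d \<inter> Z \<noteq> {} \<Longrightarrow> v \<in> Z"
      using less.IH[OF d(2,1)] by blast
    have "v \<in> Z" if "subcomplex X E Z" "e \<inter> Z \<noteq> {}" for Z
    proof -
      have "X closure_of e \<subseteq> Z" using that less.prems unfolding subcomplex_def by blast
      then show ?thesis using v(2) that(1) x(1) d(3) by blast
    qed
    then show ?thesis using v(1) by blast
  qed
qed

text \<open>One point of \<open>K\<close> is selected in each cell that meets \<open>K\<close>. A
  cell closure meets only finitely many cells, so every set of selected points is closed in the weak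
  topology; the selected points form a closed discrete subset of a compact set.\<close>

lemma finite_cells_meeting_compact:
  assumes "compactin X K"
  shows "finite {e. (\<exists>n. e \<in> E n) \<and> e \<inter> K \<noteq> {}}" (is "finite ?C")
proof -
  define p where "p e = (SOME x. x \<in> e \<inter> K)" for e
  have p: "p e \<in> e" "p e \<in> K" if "e \<in> ?C" for e
    using someI_ex[of "\<lambda>x. x \<in> e \<inter> K"] that unfolding p_def by blast+
  have inj: "inj_on p ?C"
  proof (rule inj_onI)
    fix d e assume "d \<in> ?C" "e \<in> ?C" "p d = p e"
    moreover from this obtain m n where "d \<in> E m" "e \<in> E n" by blast
    ultimately show "d = e" using p(1)[of d] p(1)[of e] cells_disjoint[of d m e n "p e"] by simp
  qed
  have pK: "p ` ?C \<subseteq> K" using p(2) by (rule image_subsetI)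
  have closed: "closedin X T" if T: "T \<subseteq> p ` ?C" for T
  proof -
    have "T \<subseteq> topspace X" using T pK compactin_subset_topspace[OF assms] by (meson subset_trans)
    moreover have "closedin X (T \<inter> X closure_of e)" if e: "e \<in> E n" for n e
    proof -
      obtain \<F> where \<F>: "finite \<F>" "\<F> \<subseteq> (\<Union>k<n. E k)" "X closure_of e \<subseteq> e \<union> \<Union>\<F>"
        by (rule cell_closure[OF e])
      have "T \<inter> X closure_of e \<subseteq> p ` (insert e \<F>)"
      proof
        fix x assume x: "x \<in> T \<inter> X closure_of e"
        then obtain d where d: "d \<in> ?C" "x = p d" using T by blast
        obtain c where c: "c \<in> insert e \<F>" "x \<in> c" using x \<F>(3) by blast
        then obtain m where "c \<in> E m" using e \<F>(2) by blast
        moreover obtain k where "d \<in> E k" using d(1) by blast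
        ultimately have "c = d" using cells_disjoint[of c m d k x] d(2) p(1)[OF d(1)] c(2) by simp
        then show "x \<in> p ` (insert e \<F>)" using c d by blast
      qed
      then have "finite (T \<inter> X closure_of e)"
        using \<F>(1) finite_subset by blast
      then show ?thesis
        using Hausdorff \<open>T \<subseteq> topspace X\<close> by (intro closedin_Hausdorff_finite) auto
    qed
    moreover have "\<forall>A\<subseteq>topspace X. (\<forall>n. \<forall>e\<in>E n. closedin X (A \<inter> X closure_of e)) \<longrightarrow> closedin X A"
      using cw unfolding CW_complex_def by (elim conjE)
    ultimately show ?thesis by blast
  qed
  have compact: "compactin X (p ` ?C)"
    by (rule closed_compactin[OF assms pK closed[OF order_refl]])
  moreover have "openin X (topspace X - (p ` ?C - {x}))" for x
    using closed[of "p ` ?C - {x}"] by blast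
  moreover have "p ` ?C \<subseteq> \<Union>((\<lambda>x. topspace X - (p ` ?C - {x})) ` p ` ?C)"
    using compactin_subset_topspace[OF compact] by blast
  ultimately have "\<exists>\<U>. finite \<U> \<and> \<U> \<subseteq> (\<lambda>x. topspace X - (p ` ?C - {x})) ` p ` ?C \<and> p ` ?C \<subseteq> \<Union>\<U>"
    by (intro compactinD) auto
  then obtain \<U> where \<U>: "finite \<U>" "\<U> \<subseteq> (\<lambda>x. topspace X - (p ` ?C - {x})) ` p ` ?C" "p ` ?C \<subseteq> \<Union>\<U>"
    by blast
  obtain F where F: "finite F" "\<U> \<subseteq> (\<lambda>x. topspace X - (p ` ?C - {x})) ` F"
    using finite_subset_image[OF \<U>(1,2)] by blast
  have "p ` ?C \<subseteq> F"
  proof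
    fix x assume "x \<in> p ` ?C"
    moreover from this obtain y where "y \<in> F" "x \<in> topspace X - (p ` ?C - {y})"
      using \<U>(3) F(2) by blast
    ultimately show "x \<in> F" by blast
  qed
  then have "finite (p ` ?C)" using F(1) finite_subset by blast
  then show ?thesis using inj finite_imageD by blast
qed

end

section \<open>Superlevel sets of height maps\<close>

locale height_action = group G + cw_complex Y E
  for G :: "('g, 'c) monoid_scheme" (structure) and Y :: "'a topology" and E +
  fixes act :: "'g \<Rightarrow> 'a \<Rightarrow> 'a" and \<psi> :: "'g \<Rightarrow> real" and h :: "'a \<Rightarrow> real"
  assumes action: "proper_cocompact_cellular_action G Y E act"
    and height: "height_map G Y act \<psi> h"
    and character: "\<psi> \<in> hom G real_add_group"
begin

lemma act_group_action: "group_action G (topspace Y) act"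
  using action by (simp add: proper_cocompact_cellular_action_def)

lemma act_homeomorphic: "g \<in> carrier G \<Longrightarrow> homeomorphic_map Y Y (act g)"
  using action by (simp add: proper_cocompact_cellular_action_def)

lemma act_cell: "g \<in> carrier G \<Longrightarrow> e \<in> E n \<Longrightarrow> act g ` e \<in> E n"
  using action by (simp add: proper_cocompact_cellular_action_def)

lemma act_proper: "compactin Y K \<Longrightarrow> finite {g \<in> carrier G. act g ` K \<inter> K \<noteq> {}}"
  using action by (simp add: proper_cocompact_cellular_action_def)

lemma act_mult:
  "g \<in> carrier G \<Longrightarrow> g' \<in> carrier G \<Longrightarrow> y \<in> topspace Y \<Longrightarrow> act (g \<otimes> g') y = act g (act g' y)"
  using group_action.composition_rule[OF act_group_action] by metis

lemma act_one: "y \<in> topspace Y \<Longrightarrow> act \<one> y = y"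
  using group_action.id_eq_one[OF act_group_action] by (metis restrict_apply')

lemma act_in: "g \<in> carrier G \<Longrightarrow> y \<in> topspace Y \<Longrightarrow> act g y \<in> topspace Y"
  using group_action.element_image[OF act_group_action] by blast

lemma act_inv_act: "g \<in> carrier G \<Longrightarrow> y \<in> topspace Y \<Longrightarrow> act (inv g) (act g y) = y"
  and act_act_inv: "g \<in> carrier G \<Longrightarrow> y \<in> topspace Y \<Longrightarrow> act g (act (inv g) y) = y"
  using act_mult[of "inv g" g y] act_mult[of g "inv g" y] act_one by auto

lemma act_continuous: "g \<in> carrier G \<Longrightarrow> continuous_map Y Y (act g)"
  using act_homeomorphic homeomorphic_imp_continuous_map by blast

lemma h_act: "g \<in> carrier G \<Longrightarrow> y \<in> topspace Y \<Longrightarrow> h (act g y) = \<psi> g + h y"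
  using height by (simp add: height_map_def)

lemma h_continuous: "continuous_map Y euclideanreal h"
  using height by (simp add: height_map_def)

lemma char_mult: "g \<in> carrier G \<Longrightarrow> g' \<in> carrier G \<Longrightarrow> \<psi> (g \<otimes> g') = \<psi> g + \<psi> g'"
  using hom_mult[OF character] by (simp add: real_add_group_def)

lemma char_one: "\<psi> \<one> = 0"
  using char_mult[of \<one> \<one>] by simp

lemma char_inv: "g \<in> carrier G \<Longrightarrow> \<psi> (inv g) = - \<psi> g"
  using char_mult[of g "inv g"] char_one by simp

lemma subcomplex_image:
  assumes g: "g \<in> carrier G" and Z: "subcomplex Y E Z"
  shows "subcomplex Y E (act g ` Z)"
  unfolding subcomplex_def
proof (intro conjI allI ballI impI)
  have ZY: "Z \<subseteq> topspace Y" using Z by (simp add: subcomplex_def)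
  then show "act g ` Z \<subseteq> topspace Y" using act_in[OF g] by blast
  fix n e assume e: "e \<in> E n" "e \<inter> act g ` Z \<noteq> {}"
  let ?d = "act (inv g) ` e"
  have eY: "e \<subseteq> topspace Y" using cell_subset[OF e(1)] .
  have d: "?d \<in> E n" using act_cell e(1) g by simp
  then have dY: "?d \<subseteq> topspace Y" by (rule cell_subset)
  obtain z where z: "z \<in> Z" "act g z \<in> e" using e(2) by blast
  then have "act (inv g) (act g z) \<in> ?d" by blast
  then have "z \<in> ?d" using act_inv_act[OF g] z(1) ZY by auto
  then have "Y closure_of ?d \<subseteq> Z"
    using subcomplex_closure_of[OF Z d] z(1) by blast
  moreover have "act g ` ?d = e"
    using act_act_inv[OF g] eY by (force simp: image_image)
  moreover have "Y closure_of (act g ` ?d) = act g ` (Y closure_of ?d)"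
    by (rule homeomorphic_map_closure_of[OF act_homeomorphic[OF g] dY])
  ultimately show "Y closure_of e \<subseteq> act g ` Z" by auto
qed

lemma zero_cells_image:
  assumes g: "g \<in> carrier G" and v: "v \<in> topspace Y" "act g v \<in> \<Union>(E 0)"
  shows "v \<in> \<Union>(E 0)"
proof -
  obtain e where e: "e \<in> E 0" "act g v \<in> e" using v(2) by blast
  then have "act (inv g) (act g v) \<in> act (inv g) ` e" by blast
  then show ?thesis using act_cell[OF inv_closed[OF g] e(1)] act_inv_act[OF g v(1)] by auto
qed

lemma act_zero_cell: "g \<in> carrier G \<Longrightarrow> v \<in> \<Union>(E 0) \<Longrightarrow> act g v \<in> \<Union>(E 0)"
  using act_cell by blast

lemma mem_superlevel:
  "y \<in> superlevel Y E h t \<longleftrightarrow> (\<exists>Z. subcomplex Y E Z \<and> (\<forall>v\<in>Z \<inter> \<Union>(E 0). t \<le> h v) \<and> y \<in> Z)"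
  unfolding superlevel_def full_subcomplex_def by blast

text \<open>Superlevels only see heights of 0-cells. By cocompactness every point lies in a
  translate of one of finitely many cells, so its height is uniformly close to the heights of the
  0-cells that decide its membership.\<close>

lemma superlevel_bounds:
  obtains C where
    "\<And>y t. y \<in> topspace Y \<Longrightarrow> t \<le> h y - C \<Longrightarrow> y \<in> superlevel Y E h t"
    "\<And>y t. y \<in> superlevel Y E h t \<Longrightarrow> t - C \<le> h y"
proof -
  obtain K where K: "compactin Y K" "(\<Union>g\<in>carrier G. act g ` K) = topspace Y"
  proof -
    have "\<exists>K. compactin Y K \<and> (\<Union>g\<in>carrier G. act g ` K) = topspace Y"
      using action unfolding proper_cocompact_cellular_action_def by (elim conjE)
    then show thesis using that by blast
  qed
  have KY: "K \<subseteq> topspace Y" using K(1) by (rule compactin_subset_topspace)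
  define D where "D = {e. (\<exists>n. e \<in> E n) \<and> e \<inter> K \<noteq> {}}"
  have "finite D" unfolding D_def by (rule finite_cells_meeting_compact[OF K(1)])
  have "\<forall>e\<in>D. \<exists>Z. subcomplex Y E Z \<and> e \<subseteq> Z \<and> finite (Z \<inter> \<Union>(E 0))"
    using finite_subcomplex unfolding D_def by blast
  from bchoice[OF this] obtain Z where Z: "\<And>e. e \<in> D \<Longrightarrow> subcomplex Y E (Z e)"
    "\<And>e. e \<in> D \<Longrightarrow> e \<subseteq> Z e" "\<And>e. e \<in> D \<Longrightarrow> finite (Z e \<inter> \<Union>(E 0))"
    by blast
  have "\<forall>e\<in>D. \<exists>v. v \<in> \<Union>(E 0) \<and> (\<forall>Z. subcomplex Y E Z \<and> e \<inter> Z \<noteq> {} \<longrightarrow> v \<in> Z)"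
    using zero_cell_below unfolding D_def by blast
  from bchoice[OF this] obtain v where v':
    "\<forall>e\<in>D. v e \<in> \<Union>(E 0) \<and> (\<forall>Z. subcomplex Y E Z \<and> e \<inter> Z \<noteq> {} \<longrightarrow> v e \<in> Z)" ..
  have v: "v e \<in> \<Union>(E 0)" "\<And>Z. subcomplex Y E Z \<Longrightarrow> e \<inter> Z \<noteq> {} \<Longrightarrow> v e \<in> Z" if "e \<in> D" for e
    using bspec[OF v' that] by simp_all
  \<comment> \<open>The 0-cells of \<open>Z e\<close> are used to place a high point in a
    superlevel; the forced 0-cell \<open>v e\<close> is used to show that a point of a superlevel is
    high.\<close>
  define V where "V = v ` D \<union> (\<Union>e\<in>D. Z e \<inter> \<Union>(E 0))"
  have "finite V" using \<open>finite D\<close> Z(3) unfolding V_def by blast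
  have "compact (h ` K)"
    using image_compactin[OF K(1) h_continuous] by simp
  then have "bounded (h ` V \<union> h ` K)"
    using \<open>finite V\<close> by (simp add: compact_imp_bounded finite_imp_bounded)
  then obtain c where c: "\<And>x. x \<in> V \<union> K \<Longrightarrow> \<bar>h x\<bar> \<le> c"
    unfolding bounded_iff by auto
  have decomp: "\<exists>g k e. g \<in> carrier G \<and> k \<in> K \<and> y = act g k \<and> e \<in> D \<and> k \<in> e"
    if y: "y \<in> topspace Y" for y
  proof -
    have "y \<in> (\<Union>g\<in>carrier G. act g ` K)" using y by (simp only: K(2))
    then obtain g k where "g \<in> carrier G" "k \<in> K" "y = act g k" by blast
    moreover from this obtain n e where "e \<in> E n" "k \<in> e"
      using cell_exists KY by blast
    ultimately show ?thesis unfolding D_def by blast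
  qed
  show thesis
  \<comment> \<open>A translation shifts the heights of a point of \<open>K\<close> and of a 0-cell
    in \<open>V\<close> equally, and both heights have absolute value at most \<open>c\<close>
    before it.\<close>
  proof (rule that[of "2 * c"])
    fix y t assume y: "y \<in> topspace Y" and t: "t \<le> h y - 2 * c"
    obtain g k e where gk: "g \<in> carrier G" "k \<in> K" "y = act g k" "e \<in> D" "k \<in> e"
      using decomp[OF y] by blast
    have kY: "k \<in> topspace Y" using gk(2) KY by blast
    have "t \<le> h w" if w: "w \<in> act g ` Z e" "w \<in> \<Union>(E 0)" for w
    proof -
      obtain z where z: "z \<in> Z e" "w = act g z" using w(1) by blast
      then have zY: "z \<in> topspace Y" using Z(1)[OF gk(4)] by (auto simp: subcomplex_def)
      have "z \<in> V"
        using zero_cells_image[OF gk(1) zY] w(2) z gk(4) unfolding V_def by blast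
      then have "\<bar>h z\<bar> \<le> c" "\<bar>h k\<bar> \<le> c" using c gk(2) by blast+
      then show ?thesis using t h_act[OF gk(1) zY] h_act[OF gk(1) kY] gk(3) z(2) by simp
    qed
    moreover have "y \<in> act g ` Z e" using Z(2)[OF gk(4)] gk(3,5) by blast
    ultimately show "y \<in> superlevel Y E h t"
      using subcomplex_image[OF gk(1) Z(1)[OF gk(4)]] unfolding mem_superlevel by blast
  next
    fix y t assume "y \<in> superlevel Y E h t"
    then obtain W where W: "subcomplex Y E W" "\<And>v. v \<in> W \<Longrightarrow> v \<in> \<Union>(E 0) \<Longrightarrow> t \<le> h v" "y \<in> W"
      unfolding mem_superlevel by blast
    have yY: "y \<in> topspace Y" using W(1,3) by (auto simp: subcomplex_def)
    obtain g k e where gk: "g \<in> carrier G" "k \<in> K" "y = act g k" "e \<in> D" "k \<in> e"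
      using decomp[OF yY] by blast
    have kY: "k \<in> topspace Y" using gk(2) KY by blast
    have "k = act (inv g) y" using act_inv_act[OF gk(1) kY] gk(3) by simp
    then have "k \<in> act (inv g) ` W" using W(3) by blast
    then have "v e \<in> act (inv g) ` W"
      using v(2)[OF gk(4) subcomplex_image[OF inv_closed[OF gk(1)] W(1)]] gk(5) by blast
    then obtain w where w: "w \<in> W" "v e = act (inv g) w" by blast
    have wY: "w \<in> topspace Y" using W(1) w(1) by (auto simp: subcomplex_def)
    have "w = act g (v e)" using act_act_inv[OF gk(1) wY] w(2) by simp
    moreover have "v e \<in> topspace Y" using w(2) act_in[OF inv_closed[OF gk(1)] wY] by simp
    moreover have "t \<le> h w"
      using W(2)[OF w(1)] act_zero_cell[OF gk(1) v(1)[OF gk(4)]] calculation(1) by simp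
    moreover have "v e \<in> V" using gk(4) by (simp add: V_def)
    then have "\<bar>h (v e)\<bar> \<le> c" "\<bar>h k\<bar> \<le> c" using c gk(2) by blast+
    ultimately show "t - 2 * c \<le> h y"
      using h_act[OF gk(1), of "v e"] h_act[OF gk(1) kY] gk(3) by simp
  qed
qed

end

section \<open>Essential connectivity in terms of paths and loops\<close>

text \<open>The 0-sphere has two points; \<open>sphere_base\<close> is sent to \<open>x\<close> and
  the other one to \<open>y\<close>. The track of the second point under the pointed null-homotopy
  is the path.\<close>

lemma incl_trivial_on_pi_0:
  assumes "incl_trivial_on_pi 0 X A B" "x \<in> topspace X \<inter> A" "y \<in> topspace X \<inter> A"
  shows "path_component_of (subtopology X B) x y"
proof -
  define f where "f z = (if z 0 > 0 then x else y)" for z :: "nat \<Rightarrow> real"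
  define w :: "nat \<Rightarrow> real" where "w = (\<lambda>i. if i = 0 then -1 else 0)"
  have top0: "topspace (nsphere 0) = {sphere_base, w}"
  proof
    show "{sphere_base, w} \<subseteq> topspace (nsphere 0)"
      by (simp add: nsphere sphere_base_def w_def)
    show "topspace (nsphere 0) \<subseteq> {sphere_base, w}"
    proof
      fix z assume "z \<in> topspace (nsphere 0)"
      then have "(z 0)\<^sup>2 = 1" and pos: "\<And>i. i > 0 \<Longrightarrow> z i = 0" by (auto simp: nsphere)
      then consider "z 0 = 1" | "z 0 = -1" by (auto simp: power2_eq_1_iff)
      then have "z = sphere_base \<or> z = w"
        by cases (use pos in \<open>auto simp: sphere_base_def w_def fun_eq_iff\<close>)
      then show "z \<in> {sphere_base, w}" by blast
    qed
  qed
  have proj: "continuous_map (nsphere 0) euclideanreal (\<lambda>z. z 0)"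
    by (rule continuous_map_nsphere_projection)
  have "continuous_map (nsphere 0) (subtopology X A) f"
    unfolding continuous_map_def
  proof (intro conjI allI impI)
    show "f \<in> topspace (nsphere 0) \<rightarrow> topspace (subtopology X A)"
      using assms(2,3) by (auto simp: f_def)
    fix U assume "openin (subtopology X A) U"
    have pos: "openin (nsphere 0) {z \<in> topspace (nsphere 0). z 0 \<in> {0<..}}"
      by (rule openin_continuous_map_preimage[OF proj]) simp
    have neg: "openin (nsphere 0) {z \<in> topspace (nsphere 0). z 0 \<in> {..<0}}"
      by (rule openin_continuous_map_preimage[OF proj]) simp
    have "{z \<in> topspace (nsphere 0). f z \<in> U} =
      (if x \<in> U then {z \<in> topspace (nsphere 0). z 0 \<in> {0<..}} else {}) \<union>
      (if y \<in> U then {z \<in> topspace (nsphere 0). z 0 \<in> {..<0}} else {})"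
      unfolding top0 by (auto simp: f_def sphere_base_def w_def)
    then show "openin (nsphere 0) {z \<in> topspace (nsphere 0). f z \<in> U}"
      using pos neg by (simp add: openin_Un)
  qed
  moreover have "f sphere_base = x" by (simp add: f_def sphere_base_def)
  moreover have "x \<in> topspace (subtopology X A)" using assms(2) by simp
  ultimately have "homotopic_with (\<lambda>g. g sphere_base = x) (nsphere 0) (subtopology X B) f (\<lambda>_. x)"
    using assms(1) unfolding incl_trivial_on_pi_def by simp
  then obtain k where k: "continuous_map (prod_topology (top_of_set {0..1::real}) (nsphere 0)) (subtopology X B) k"
    "\<forall>z. k (0, z) = f z" "\<forall>z. k (1, z) = x"
    unfolding homotopic_with_def by auto
  have "continuous_map (top_of_set {0..1::real}) (prod_topology (top_of_set {0..1}) (nsphere 0)) (\<lambda>t. (t, w))"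
    by (rule continuous_map_pairedI) (auto simp: top0)
  from continuous_map_compose[OF this k(1)]
  have "pathin (subtopology X B) (\<lambda>t. k (t, w))"
    by (simp add: pathin_def o_def)
  then have "path_component_of (subtopology X B) (k (0, w)) (k (1, w))"
    unfolding path_component_of_def by (intro exI[of _ "\<lambda>t. k (t, w)"]) simp
  then have "path_component_of (subtopology X B) y x"
    using k(2,3) by (simp add: f_def w_def)
  then show ?thesis by (rule path_component_of_sym)
qed

text \<open>The circle is the quotient of \<open>{0..1}\<close> by its end points, so the loop
  descends to \<open>nsphere 1\<close>. The null-homotopy is pulled back to a square with two
  matching sides and a constant final edge.\<close>

lemma incl_trivial_on_pi_1:
  assumes triv: "incl_trivial_on_pi 1 X A B"
    and L: "continuous_map (top_of_set {0..1::real}) (subtopology X A) L" "L 0 = L 1"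
  obtains H where "continuous_map (top_of_set ({0..1::real} \<times> {0..1::real})) (subtopology X B) H"
    "\<And>s. s \<in> {0..1} \<Longrightarrow> H (0, s) = L s" "\<And>t. t \<in> {0..1} \<Longrightarrow> H (t, 0) = H (t, 1)"
    "\<And>s. s \<in> {0..1} \<Longrightarrow> H (1, s) = L 0"
proof -
  let ?I = "top_of_set {0..1::real}"
  define c :: "real \<Rightarrow> nat \<Rightarrow> real" where
    "c s = (\<lambda>i. if i < 2 then (if i = 0 then cos (2 * pi * s) else sin (2 * pi * s)) else 0)" for s
  have c_top: "c s \<in> topspace (nsphere 1)" for s
    by (simp add: nsphere topspace_Euclidean_space c_def numeral_2_eq_2)
  have c_cont: "continuous_map ?I (nsphere 1) c"
  proof -
    have "continuous_map ?I (Euclidean_space (Suc 1)) c"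
      unfolding c_def numeral_2_eq_2 One_nat_def
      by (subst continuous_map_componentwise_Euclidean_space) (auto intro!: continuous_intros)
    moreover have "c \<in> topspace ?I \<rightarrow> {x. (\<Sum>i\<le>1. (x i)\<^sup>2) = 1}"
      using c_top by (simp add: nsphere)
    ultimately show ?thesis
      unfolding nsphere_def continuous_map_in_subtopology[of _ "Euclidean_space (Suc 1)"] by (rule conjI)
  qed
  have c_surj: "c ` topspace ?I = topspace (nsphere 1)"
  proof
    show "c ` topspace ?I \<subseteq> topspace (nsphere 1)" using c_top by blast
    show "topspace (nsphere 1) \<subseteq> c ` topspace ?I"
    proof
      fix z assume z: "z \<in> topspace (nsphere 1)"
      then have "(z 0)\<^sup>2 + (z 1)\<^sup>2 = 1" and z0: "\<And>i. i \<ge> 2 \<Longrightarrow> z i = 0"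
        by (auto simp: nsphere topspace_Euclidean_space numeral_2_eq_2)
      then obtain u where u: "0 \<le> u" "u \<le> 2 * pi" "z 0 = cos u" "z 1 = sin u"
        using sincos_total_2pi_le by blast
      have "z = c (u / (2 * pi))"
      proof
        fix i :: nat
        consider "i = 0" | "i = 1" | "i \<ge> 2" by linarith
        then show "z i = c (u / (2 * pi)) i"
          by cases (use u z0 in \<open>auto simp: c_def\<close>)
      qed
      moreover have "u / (2 * pi) \<in> topspace ?I" using u by (simp add: field_simps)
      ultimately show "z \<in> c ` topspace ?I" by blast
    qed
  qed
  have quot: "quotient_map ?I (nsphere 1) c"
    using c_cont c_surj by (intro continuous_imp_quotient_map)
      (auto simp: compact_space_subtopology Hausdorff_space_subtopology Hausdorff_Euclidean_space nsphere_def)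
  have L_eq: "L s = L t" if "s \<in> topspace ?I" "t \<in> topspace ?I" "c s = c t" for s t
  proof -
    have "cos (2 * pi * s) = cos (2 * pi * t)" "sin (2 * pi * s) = sin (2 * pi * t)"
      using fun_cong[OF that(3), of 0] fun_cong[OF that(3), of 1] by (simp_all add: c_def)
    then obtain n :: int where "2 * pi * s = 2 * pi * t + 2 * pi * n"
      using sin_cos_eq_iff[of "2 * pi * s" "2 * pi * t"] by blast
    then have "pi * (s - t - n) = 0" by (simp add: algebra_simps)
    then have n: "s = t + n" by simp
    then have "- 1 \<le> n" "n \<le> 1" using that(1,2) by auto
    then consider "n = -1" | "n = 0" | "n = 1" by linarith
    then show ?thesis
    proof cases
      case 1
      then have "s = 0" "t = 1" using n that(1,2) by auto
      then show ?thesis using L(2) by simp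
    next
      case 2
      then show ?thesis using n by simp
    next
      case 3
      then have "s = 1" "t = 0" using n that(1,2) by auto
      then show ?thesis using L(2) by simp
    qed
  qed
  obtain f where f: "continuous_map (nsphere 1) (subtopology X A) f"
    "f ` topspace (nsphere 1) = L ` topspace ?I" "\<And>s. s \<in> topspace ?I \<Longrightarrow> f (c s) = L s"
    by (rule quotient_map_lift_exists[OF quot L(1) L_eq]) (assumption | rule that)+
  have base: "c 0 = sphere_base" "c 1 = sphere_base"
    by (auto simp: c_def sphere_base_def fun_eq_iff)
  then have fb: "f sphere_base = L 0" using f(3)[of 0] by simp
  have "L 0 \<in> topspace (subtopology X A)"
    using continuous_map_funspace[OF L(1)] by (auto simp: Pi_iff)
  then have "homotopic_with (\<lambda>g. g sphere_base = L 0) (nsphere 1) (subtopology X B) f (\<lambda>_. L 0)"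
    using triv f(1) fb unfolding incl_trivial_on_pi_def by simp
  then obtain k where k: "continuous_map (prod_topology ?I (nsphere 1)) (subtopology X B) k"
    "\<forall>z. k (0, z) = f z" "\<forall>z. k (1, z) = L 0"
    unfolding homotopic_with_def by auto
  have prod: "prod_topology ?I ?I = top_of_set ({0..1} \<times> {0..1})"
    by (simp add: prod_topology_subtopology_eu)
  have "continuous_map (prod_topology ?I ?I) (prod_topology ?I (nsphere 1)) (\<lambda>(t, s). (t, c s))"
    using continuous_map_prod_top[of ?I ?I ?I "nsphere 1" "\<lambda>t. t" c] c_cont by simp
  from continuous_map_compose[OF this k(1)]
  have "continuous_map (top_of_set ({0..1} \<times> {0..1})) (subtopology X B) (k \<circ> (\<lambda>(t, s). (t, c s)))"
    by (simp add: prod)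
  then show thesis
    by (rule that) (use k(2,3) f(3) base in auto)
qed

section \<open>Paths, loops and grids\<close>

lemma continuous_map_join_intervals:
  fixes a b c :: real
  assumes "continuous_map (top_of_set {a..b}) X f" "continuous_map (top_of_set {b..c}) X g"
    and "f b = g b" "a \<le> b" "b \<le> c"
  shows "continuous_map (top_of_set {a..c}) X (\<lambda>s. if s \<le> b then f s else g s)"
proof (rule continuous_map_cases_le)
  have sets: "{a..c} \<inter> {s \<in> topspace (top_of_set {a..c}). s \<le> b} = {a..b}"
    "{a..c} \<inter> {s \<in> topspace (top_of_set {a..c}). b \<le> s} = {b..c}"
    using assms(4,5) by auto
  show "continuous_map (subtopology (top_of_set {a..c}) {s \<in> topspace (top_of_set {a..c}). s \<le> b}) X f"
    "continuous_map (subtopology (top_of_set {a..c}) {s \<in> topspace (top_of_set {a..c}). b \<le> s}) X g"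
    using assms(1,2) by (simp_all only: subtopology_subtopology sets)
qed (use assms(3) in auto)

lemma path_component_of_shifted_path:
  assumes "path_component_of (subtopology X U) x y"
  obtains f where "continuous_map (top_of_set {a..a + 1 :: real}) X f" "f a = x" "f (a + 1) = y"
    "\<And>s. s \<in> {a..a + 1} \<Longrightarrow> f s \<in> U"
proof -
  obtain f where f: "continuous_map (top_of_set {0..1::real}) (subtopology X U) f" "f 0 = x" "f 1 = y"
    using assms unfolding path_component_of_def pathin_def by blast
  have "continuous_map (top_of_set {a..a + 1}) (top_of_set {0..1}) (\<lambda>s. s - a)"
    by (auto simp: continuous_map_in_subtopology intro!: continuous_intros)
  from continuous_map_compose[OF this f(1)]
  have "continuous_map (top_of_set {a..a + 1}) (subtopology X U) (\<lambda>s. f (s - a))"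
    by (simp add: o_def)
  then have "continuous_map (top_of_set {a..a + 1}) X (\<lambda>s. f (s - a))"
    "(\<lambda>s. f (s - a)) \<in> topspace (top_of_set {a..a + 1}) \<rightarrow> U"
    by (simp_all only: continuous_map_in_subtopology)
  then show thesis
    by (intro that[of "\<lambda>s. f (s - a)"]) (use f(2,3) in auto)
qed

text \<open>Each side takes one unit of time. The time intervals are closed, so a corner is known to
  lie in both adjacent sets, as \<open>rectangle_sum\<close> requires.\<close>

lemma four_paths_loop:
  assumes "path_component_of (subtopology X U\<^sub>1) x\<^sub>1 x\<^sub>2" "path_component_of (subtopology X U\<^sub>2) x\<^sub>2 x\<^sub>3"
    and "path_component_of (subtopology X U\<^sub>3) x\<^sub>3 x\<^sub>4" "path_component_of (subtopology X U\<^sub>4) x\<^sub>4 x\<^sub>1"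
  obtains L where "continuous_map (top_of_set {0..4::real}) X L" "L 0 = L 4"
    "\<And>s. s \<in> {0..1} \<Longrightarrow> L s \<in> U\<^sub>1" "\<And>s. s \<in> {1..2} \<Longrightarrow> L s \<in> U\<^sub>2"
    "\<And>s. s \<in> {2..3} \<Longrightarrow> L s \<in> U\<^sub>3" "\<And>s. s \<in> {3..4} \<Longrightarrow> L s \<in> U\<^sub>4"
proof -
  obtain f\<^sub>1 where f1: "continuous_map (top_of_set {0..0 + 1 :: real}) X f\<^sub>1" "f\<^sub>1 0 = x\<^sub>1" "f\<^sub>1 (0 + 1) = x\<^sub>2"
    "\<And>s. s \<in> {0..0 + 1} \<Longrightarrow> f\<^sub>1 s \<in> U\<^sub>1"
    by (rule path_component_of_shifted_path[OF assms(1), of 0]) (assumption | rule that)+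
  obtain f\<^sub>2 where f2: "continuous_map (top_of_set {1..1 + 1 :: real}) X f\<^sub>2" "f\<^sub>2 1 = x\<^sub>2" "f\<^sub>2 (1 + 1) = x\<^sub>3"
    "\<And>s. s \<in> {1..1 + 1} \<Longrightarrow> f\<^sub>2 s \<in> U\<^sub>2"
    by (rule path_component_of_shifted_path[OF assms(2), of 1]) (assumption | rule that)+
  obtain f\<^sub>3 where f3: "continuous_map (top_of_set {2..2 + 1 :: real}) X f\<^sub>3" "f\<^sub>3 2 = x\<^sub>3" "f\<^sub>3 (2 + 1) = x\<^sub>4"
    "\<And>s. s \<in> {2..2 + 1} \<Longrightarrow> f\<^sub>3 s \<in> U\<^sub>3"
    by (rule path_component_of_shifted_path[OF assms(3), of 2]) (assumption | rule that)+
  obtain f\<^sub>4 where f4: "continuous_map (top_of_set {3..3 + 1 :: real}) X f\<^sub>4" "f\<^sub>4 3 = x\<^sub>4" "f\<^sub>4 (3 + 1) = x\<^sub>1"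
    "\<And>s. s \<in> {3..3 + 1} \<Longrightarrow> f\<^sub>4 s \<in> U\<^sub>4"
    by (rule path_component_of_shifted_path[OF assms(4), of 3]) (assumption | rule that)+
  define L where "L = (\<lambda>s. if s \<le> 3 then if s \<le> 2 then if s \<le> 1 then f\<^sub>1 s else f\<^sub>2 s else f\<^sub>3 s else f\<^sub>4 s)"
  have "continuous_map (top_of_set {0..4}) X L"
    unfolding L_def
    using f1(1-3) f2(1-3) f3(1-3) f4(1-3)
    by (intro continuous_map_join_intervals) simp_all
  then show thesis
  proof (rule that)
    show "L 0 = L 4" using f1(2) f4(3) by (simp add: L_def)
    show "L s \<in> U\<^sub>1" if "s \<in> {0..1}" for s using that f1(4)[of s] by (simp add: L_def)
    show "L s \<in> U\<^sub>2" if "s \<in> {1..2}" for s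
      using that f2(4)[of s] f1(3) f2(2) by (cases "s = 1") (auto simp: L_def)
    show "L s \<in> U\<^sub>3" if "s \<in> {2..3}" for s
      using that f3(4)[of s] f2(3) f3(2) by (cases "s = 2") (auto simp: L_def)
    show "L s \<in> U\<^sub>4" if "s \<in> {3..4}" for s
      using that f4(4)[of s] f3(3) f4(2) by (cases "s = 3") (auto simp: L_def)
  qed
qed

lemma path_component_of_chain:
  fixes m n :: int
  assumes "m \<le> n" "z m \<in> topspace X" "\<And>j. m \<le> j \<Longrightarrow> j < n \<Longrightarrow> path_component_of X (z j) (z (j + 1))"
  shows "path_component_of X (z m) (z n)"
  using assms
proof (induction n rule: int_ge_induct)
  case base
  then show ?case by (simp add: path_component_of_refl)
next
  case (step n)
  then show ?case using path_component_of_trans[of X "z m" "z n" "z (n + 1)"] by simp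
qed

lemma path_component_of_continuous_image:
  assumes "path_component_of (subtopology X T) x y" "continuous_map X X' f"
  shows "path_component_of (subtopology X' (f ` T)) (f x) (f y)"
proof -
  obtain g where g: "pathin (subtopology X T) g" "g 0 = x" "g 1 = y"
    using assms(1) unfolding path_component_of_def by blast
  have "continuous_map (subtopology X T) (subtopology X' (f ` T)) f"
    using assms(2) by (auto simp: continuous_map_in_subtopology continuous_map_from_subtopology)
  then have "pathin (subtopology X' (f ` T)) (f \<circ> g)"
    using g(1) continuous_map_compose unfolding pathin_def by blast
  then show ?thesis
    unfolding path_component_of_def using g(2,3) by (intro exI[of _ "f \<circ> g"]) simp
qed

text \<open>A Lebesgue number for closed sets: disjoint members of the family have disjoint compact
  preimages in \<open>Q\<close>, which are a positive distance apart, and there are finitely many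
  pairs.\<close>

lemma finite_closed_family_separated:
  fixes Q :: "'b :: heine_borel set"
  assumes Q: "compact Q" and H: "continuous_map (top_of_set Q) X H"
    and \<Gamma>: "finite \<Gamma>" "\<And>g. g \<in> \<Gamma> \<Longrightarrow> closedin X (C g)"
  obtains \<delta> where "\<delta> > 0" "\<And>p q g g'. p \<in> Q \<Longrightarrow> q \<in> Q \<Longrightarrow> g \<in> \<Gamma> \<Longrightarrow> g' \<in> \<Gamma> \<Longrightarrow> dist p q < \<delta> \<Longrightarrow>
    H p \<in> C g \<Longrightarrow> H q \<in> C g' \<Longrightarrow> C g \<inter> C g' \<noteq> {}"
proof -
  define R where "R x \<delta> \<longleftrightarrow> (\<forall>p\<in>Q. \<forall>q\<in>Q. dist p q < \<delta> \<longrightarrow> H p \<in> C (fst x) \<longrightarrow> H q \<in> C (snd x) \<longrightarrow>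
    C (fst x) \<inter> C (snd x) \<noteq> {})" for x and \<delta> :: real
  have "\<exists>\<delta>>0. R x \<delta>" if x: "x \<in> \<Gamma> \<times> \<Gamma>" for x
  proof (cases "C (fst x) \<inter> C (snd x) = {}")
    case True
    have "compact {p \<in> Q. H p \<in> C g}" if "g \<in> \<Gamma>" for g
    proof -
      have "closedin (top_of_set Q) {p \<in> topspace (top_of_set Q). H p \<in> C g}"
        by (rule closedin_continuous_map_preimage[OF H \<Gamma>(2)[OF that]])
      then show ?thesis using Q by (simp add: closedin_compact)
    qed
    then have cc: "compact {p \<in> Q. H p \<in> C (fst x)}" "closed {p \<in> Q. H p \<in> C (snd x)}"
      using x by (auto simp: compact_imp_closed)
    have "{p \<in> Q. H p \<in> C (fst x)} \<inter> {p \<in> Q. H p \<in> C (snd x)} = {}"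
      using True by blast
    from separate_compact_closed[OF cc this] obtain \<delta> where "\<delta> > 0"
      "\<forall>p\<in>{p \<in> Q. H p \<in> C (fst x)}. \<forall>q\<in>{p \<in> Q. H p \<in> C (snd x)}. \<delta> \<le> dist p q"
      by blast
    then show ?thesis
      by (intro exI[of _ \<delta>]) (auto simp: R_def not_less[symmetric])
  next
    case False
    then show ?thesis by (intro exI[of _ 1]) (simp add: R_def)
  qed
  then have "\<forall>x\<in>\<Gamma> \<times> \<Gamma>. \<exists>\<delta>. \<delta> > 0 \<and> R x \<delta>" by blast
  from bchoice[OF this] obtain d where d: "\<forall>x\<in>\<Gamma> \<times> \<Gamma>. d x > 0 \<and> R x (d x)" ..
  \<comment> \<open>The 1 keeps the minimum defined when \<open>\<Gamma>\<close> is empty.\<close>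
  define \<delta> where "\<delta> = Min (insert 1 (d ` (\<Gamma> \<times> \<Gamma>)))"
  have fin: "finite (insert 1 (d ` (\<Gamma> \<times> \<Gamma>)))" using \<Gamma>(1) by simp
  show thesis
  proof (rule that)
    show "\<delta> > 0" unfolding \<delta>_def using fin d by (subst Min_gr_iff) auto
    fix p q g g'
    assume pq: "p \<in> Q" "q \<in> Q" "g \<in> \<Gamma>" "g' \<in> \<Gamma>" "dist p q < \<delta>" "H p \<in> C g" "H q \<in> C g'"
    have "\<delta> \<le> d (g, g')" unfolding \<delta>_def using fin pq(3,4) by (intro Min_le) auto
    then have "dist p q < d (g, g')" using pq(5) by simp
    moreover have "R (g, g') (d (g, g'))" using d pq(3,4) by blast
    ultimately show "C g \<inter> C g' \<noteq> {}" using pq unfolding R_def by auto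
  qed
qed

section \<open>Half-space cochains and discrete homotopy invariance\<close>

text \<open>
  The 1-cochain \<open>f \<union> df'\<close> for the indicator functions \<open>f\<close>, \<open>f'\<close> of \<open>P\<close>, \<open>P'\<close>; its coboundary
  on a triangle \<open>g\<close>, \<open>h\<close>, \<open>k\<close> is \<open>(f h - f g) * (f' k - f' h)\<close>.
\<close>

definition half_space_cochain :: "('g \<Rightarrow> bool) \<Rightarrow> ('g \<Rightarrow> bool) \<Rightarrow> 'g \<Rightarrow> 'g \<Rightarrow> int" where
  "half_space_cochain P P' g h = of_bool (P g) * (of_bool (P' h) - of_bool (P' g))"

lemma half_space_cochain_closed:
  assumes "P g = P h \<or> P' h = P' k"
  shows "half_space_cochain P P' g h + half_space_cochain P P' h k = half_space_cochain P P' g k"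
  using assms by (auto simp: half_space_cochain_def algebra_simps)

lemma half_space_cochain_refl [simp]: "half_space_cochain P P' g g = 0"
  by (simp add: half_space_cochain_def)

text \<open>Discrete homotopy invariance: by \<open>square\<close>, the sums along consecutive rows
  differ by a telescoping sum over the edges between them, whose two end terms cancel because the
  first and last columns agree.\<close>

lemma grid_sum_eq_zero:
  fixes \<phi> :: "'l \<Rightarrow> 'l \<Rightarrow> int"
  assumes square: "\<And>i j. i < M \<Longrightarrow> j < N \<Longrightarrow>
      \<phi> (V i j) (V i (Suc j)) + \<phi> (V i (Suc j)) (V (Suc i) (Suc j)) =
      \<phi> (V i j) (V (Suc i) j) + \<phi> (V (Suc i) j) (V (Suc i) (Suc j))"
    and sides: "\<And>i. i \<le> M \<Longrightarrow> V i 0 = V i N"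
    and const: "\<And>j. j \<le> N \<Longrightarrow> V M j = c" and "\<phi> c c = 0"
  shows "(\<Sum>j<N. \<phi> (V 0 j) (V 0 (Suc j))) = 0"
proof -
  define S where "S i = (\<Sum>j<N. \<phi> (V i j) (V i (Suc j)))" for i
  have "S i = S (Suc i)" if i: "i < M" for i
  proof -
    have "S i - S (Suc i) = (\<Sum>j<N. \<phi> (V i j) (V (Suc i) j) - \<phi> (V i (Suc j)) (V (Suc i) (Suc j)))"
      unfolding S_def sum_subtractf[symmetric]
      using square[OF i] by (intro sum.cong) (auto simp: algebra_simps)
    also have "\<dots> = \<phi> (V i 0) (V (Suc i) 0) - \<phi> (V i N) (V (Suc i) N)"
      by (rule sum_lessThan_telescope')
    also have "\<dots> = 0" using sides[of i] sides[of "Suc i"] i by simp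
    finally show ?thesis by simp
  qed
  then have "S 0 = S i" if "i \<le> M" for i
    using that by (induction i) auto
  then have "S 0 = S M" by blast
  also have "S M = 0" unfolding S_def using const assms(4) by (intro sum.neutral) auto
  finally show ?thesis by (simp add: S_def)
qed

text \<open>The winding number around the crossing of the two walls. Only the second side
  contributes: \<open>P'\<close> is constant on the first and third, \<open>P\<close> is false on
  the fourth, and on the second the sum telescopes from \<open>P'\<close> false to \<open>P'\<close>
  true.\<close>

lemma rectangle_sum:
  fixes v :: "nat \<Rightarrow> 'g"
  assumes "\<And>j. j \<le> m \<Longrightarrow> \<not> P' (v j)" "\<And>j. m \<le> j \<Longrightarrow> j \<le> 2 * m \<Longrightarrow> P (v j)"
    "\<And>j. 2 * m \<le> j \<Longrightarrow> j \<le> 3 * m \<Longrightarrow> P' (v j)" "\<And>j. 3 * m \<le> j \<Longrightarrow> j \<le> 4 * m \<Longrightarrow> \<not> P (v j)"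
  shows "(\<Sum>j<4 * m. half_space_cochain P P' (v j) (v (Suc j))) = 1"
proof -
  let ?\<phi> = "\<lambda>j. half_space_cochain P P' (v j) (v (Suc j))"
  have "(\<Sum>j<4 * m. ?\<phi> j) = (\<Sum>j\<in>{0..<m}. ?\<phi> j) + (\<Sum>j\<in>{m..<2 * m}. ?\<phi> j) +
      (\<Sum>j\<in>{2 * m..<3 * m}. ?\<phi> j) + (\<Sum>j\<in>{3 * m..<4 * m}. ?\<phi> j)"
    by (simp add: sum.atLeastLessThan_concat lessThan_atLeast0)
  also have "(\<Sum>j\<in>{0..<m}. ?\<phi> j) = 0"
    using assms(1) by (intro sum.neutral) (simp add: half_space_cochain_def)
  also have "(\<Sum>j\<in>{2 * m..<3 * m}. ?\<phi> j) = 0"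
    using assms(3) by (intro sum.neutral) (simp add: half_space_cochain_def)
  also have "(\<Sum>j\<in>{3 * m..<4 * m}. ?\<phi> j) = 0"
    using assms(4) by (intro sum.neutral) (simp add: half_space_cochain_def)
  also have "(\<Sum>j\<in>{m..<2 * m}. ?\<phi> j) = (\<Sum>j\<in>{m..<2 * m}. of_bool (P' (v (Suc j))) - of_bool (P' (v j)))"
    using assms(2) by (intro sum.cong) (simp_all add: half_space_cochain_def)
  also have "\<dots> = of_bool (P' (v (2 * m))) - of_bool (P' (v m))"
    by (rule sum_Suc_diff') simp
  finally show ?thesis using assms(1)[of m] assms(3)[of "2 * m"] by simp
qed

section \<open>Obstruction to essential simple connectivity\<close>

context height_action
begin

text \<open>Actual heights of points replace superlevels because translation by \<open>g\<close>
  moves the level by exactly \<open>\<psi> g\<close>; \<open>superlevel_bounds\<close> converts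
  between the two.\<close>

definition high :: "real \<Rightarrow> 'a set" where
  "high r = {y \<in> topspace Y. r \<le> h y}"

lemma act_high: "g \<in> carrier G \<Longrightarrow> y \<in> high r \<Longrightarrow> act g y \<in> high (r + \<psi> g)"
  by (simp add: high_def act_in h_act)

lemma high_mono: "r \<le> r' \<Longrightarrow> high r' \<subseteq> high r"
  by (auto simp: high_def)

text \<open>In essential connectivity the loss of height may vary with the level. It is therefore
  invoked at a single level and transported by the group, which gives the same loss \<open>C\<close>
  at every level \<open>\<psi> g\<close>.\<close>

lemma high_paths_and_loops:
  assumes ess: "essentially_connected 2 Y (superlevel Y E h)"
  obtains C where
    "\<forall>g\<in>carrier G. \<forall>x\<in>high (\<psi> g). \<forall>y\<in>high (\<psi> g).
       path_component_of (subtopology Y (high (\<psi> g - C))) x y"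
    "\<forall>g\<in>carrier G. \<forall>L. continuous_map (top_of_set {0..1::real}) Y L \<longrightarrow> L 0 = L 1 \<longrightarrow>
       L ` {0..1} \<subseteq> high (\<psi> g) \<longrightarrow>
       (\<exists>H. continuous_map (top_of_set ({0..1::real} \<times> {0..1::real})) Y H \<and>
         (\<forall>s\<in>{0..1}. H (0, s) = L s \<and> H (s, 0) = H (s, 1) \<and> H (1, s) = L 0) \<and>
         H ` ({0..1} \<times> {0..1}) \<subseteq> high (\<psi> g - C))"
proof -
  obtain c where c: "\<And>y t. y \<in> topspace Y \<Longrightarrow> t \<le> h y - c \<Longrightarrow> y \<in> superlevel Y E h t"
    "\<And>y t. y \<in> superlevel Y E h t \<Longrightarrow> t - c \<le> h y"
    by (rule superlevel_bounds) (assumption | rule that)+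
  \<comment> \<open>The superlevel at \<open>- c\<close> contains all points of nonnegative height.
    Returning from the superlevel at \<open>r\<close> to actual heights costs another
    \<open>c\<close>, whence \<open>C = c - r\<close> below.\<close>
  obtain r where r: "r \<le> - c"
    "\<And>k. k < 2 \<Longrightarrow> incl_trivial_on_pi k Y (superlevel Y E h (- c)) (superlevel Y E h r)"
    using ess unfolding essentially_connected_def by blast
  have sub: "topspace Y \<inter> superlevel Y E h r \<subseteq> high (r - c)"
    using c(2) by (auto simp: high_def)
  have sup: "high 0 \<subseteq> topspace Y \<inter> superlevel Y E h (- c)"
    using c(1) by (auto simp: high_def)
  define C where "C = c - r"
  show thesis
  proof (rule that[of C]; intro ballI allI impI)
    fix g x y assume g: "g \<in> carrier G" and xy: "x \<in> high (\<psi> g)" "y \<in> high (\<psi> g)"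
    have xyY: "x \<in> topspace Y" "y \<in> topspace Y" using xy by (auto simp: high_def)
    have "act (inv g) x \<in> high 0" "act (inv g) y \<in> high 0"
      using act_high[OF inv_closed[OF g] xy(1)] act_high[OF inv_closed[OF g] xy(2)] char_inv[OF g]
      by simp_all
    then have "path_component_of (subtopology Y (superlevel Y E h r)) (act (inv g) x) (act (inv g) y)"
      using sup by (intro incl_trivial_on_pi_0[OF r(2)[of 0]]) auto
    then have "path_component_of (subtopology Y (high (r - c))) (act (inv g) x) (act (inv g) y)"
      using sub by (metis path_component_of_mono subtopology_restrict)
    from path_component_of_continuous_image[OF this act_continuous[OF g]]
    have "path_component_of (subtopology Y (act g ` high (r - c))) x y"
      using act_act_inv[OF g] xyY by simp
    moreover have "act g ` high (r - c) \<subseteq> high (\<psi> g - C)"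
      using act_high[OF g, of _ "r - c"] by (auto simp: C_def algebra_simps)
    ultimately show "path_component_of (subtopology Y (high (\<psi> g - C))) x y"
      by (rule path_component_of_mono)
  next
    fix g and L :: "real \<Rightarrow> 'a"
    assume g: "g \<in> carrier G" and L: "continuous_map (top_of_set {0..1}) Y L" "L 0 = L 1"
      and L_image: "L ` {0..1} \<subseteq> high (\<psi> g)"
    have L_high: "L s \<in> high (\<psi> g)" if "s \<in> {0..1}" for s
      using L_image that by blast
    have LY: "L s \<in> topspace Y" if "s \<in> {0..1}" for s
      using L_high[OF that] by (simp add: high_def)
    have "act (inv g) (L s) \<in> superlevel Y E h (- c)" if "s \<in> {0..1}" for s
      using act_high[OF inv_closed[OF g] L_high[OF that]] char_inv[OF g] sup by auto
    then have cont: "continuous_map (top_of_set {0..1}) (subtopology Y (superlevel Y E h (- c))) (act (inv g) \<circ> L)"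
      using continuous_map_compose[OF L(1) act_continuous[OF inv_closed[OF g]]]
      by (simp add: continuous_map_in_subtopology Pi_iff)
    obtain H where H:
      "continuous_map (top_of_set ({0..1::real} \<times> {0..1::real})) (subtopology Y (superlevel Y E h r)) H"
      "\<And>s. s \<in> {0..1} \<Longrightarrow> H (0, s) = (act (inv g) \<circ> L) s" "\<And>t. t \<in> {0..1} \<Longrightarrow> H (t, 0) = H (t, 1)"
      "\<And>s. s \<in> {0..1} \<Longrightarrow> H (1, s) = (act (inv g) \<circ> L) 0"
      by (rule incl_trivial_on_pi_1[OF r(2)[of 1] cont]) (simp_all add: L(2) that)
    have HY: "continuous_map (top_of_set ({0..1} \<times> {0..1})) Y H"
      "\<And>p. p \<in> {0..1} \<times> {0..1} \<Longrightarrow> H p \<in> topspace Y \<inter> superlevel Y E h r"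
      using H(1) continuous_map_funspace[OF H(1)] by (auto simp: continuous_map_in_subtopology Pi_iff)
    show "\<exists>H. continuous_map (top_of_set ({0..1::real} \<times> {0..1::real})) Y H \<and>
         (\<forall>s\<in>{0..1}. H (0, s) = L s \<and> H (s, 0) = H (s, 1) \<and> H (1, s) = L 0) \<and>
         H ` ({0..1} \<times> {0..1}) \<subseteq> high (\<psi> g - C)"
    proof (intro exI[of _ "act g \<circ> H"] conjI ballI image_subsetI)
      show "continuous_map (top_of_set ({0..1} \<times> {0..1})) Y (act g \<circ> H)"
        by (rule continuous_map_compose[OF HY(1) act_continuous[OF g]])
      fix s :: real assume s: "s \<in> {0..1}"
      show "(act g \<circ> H) (0, s) = L s" using H(2)[OF s] act_act_inv[OF g LY[OF s]] by simp
      show "(act g \<circ> H) (s, 0) = (act g \<circ> H) (s, 1)" using H(3)[OF s] by simp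
      show "(act g \<circ> H) (1, s) = L 0" using H(4)[OF s] act_act_inv[OF g LY[of 0]] by simp
    next
      fix p :: "real \<times> real" assume "p \<in> {0..1} \<times> {0..1}"
      then have "H p \<in> high (r - c)" using HY(2) sub by blast
      then show "(act g \<circ> H) p \<in> high (\<psi> g - C)"
        using act_high[OF g, of "H p" "r - c"] by (simp add: C_def algebra_simps)
    qed
  qed
qed

lemma char_unbounded:
  assumes "\<exists>g\<in>carrier G. \<psi> g \<noteq> 0"
  obtains g where "g \<in> carrier G" "r \<le> \<psi> g"
proof -
  obtain g where g: "g \<in> carrier G" "\<psi> g > 0"
  proof -
    obtain g where "g \<in> carrier G" "\<psi> g \<noteq> 0" using assms by blast
    then show thesis
      using that[of g] that[of "inv g"] char_inv[of g] by (cases "\<psi> g > 0") auto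
  qed
  have pow: "\<psi> (g [^] n) = real n * \<psi> g" for n :: nat
    by (induction n) (simp_all add: char_one char_mult g(1) algebra_simps)
  obtain n :: nat where "r \<le> real n * \<psi> g"
    using reals_Archimedean3[OF g(2)] less_imp_le by blast
  then show thesis using that[of "g [^] n"] g(1) pow by simp
qed

text \<open>\<open>A\<close> and \<open>B\<close> span the plane; \<open>P\<close> and
  \<open>P'\<close> are the half spaces. The hypotheses are asymmetric because in the application
  left multiplication by \<open>B\<close> twists the inner coordinate and may change
  \<open>P\<close>. In \<open>fin\<close> there are two multipliers because a triangle has two steps
  from its middle vertex, each crossing its own wall.\<close>

lemma not_essentially_simply_connected:
  fixes A B :: "int \<Rightarrow> 'g" and P P' :: "'g \<Rightarrow> bool"
  assumes nontrivial: "\<exists>g\<in>carrier G. \<psi> g \<noteq> 0" and nonempty: "topspace Y \<noteq> {}"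
    and A: "\<And>i. A i \<in> carrier G" "\<And>i j. A (i + j) = A i \<otimes> A j" "\<And>i. \<psi> (A i) = 0"
    and B: "\<And>i. B i \<in> carrier G" "\<And>i j. B (i + j) = B i \<otimes> B j" "\<And>i. \<psi> (B i) = 0"
    and comm: "\<And>i j. A i \<otimes> B j = B j \<otimes> A i"
    and fin: "\<And>s s'. s \<in> carrier G \<Longrightarrow> s' \<in> carrier G \<Longrightarrow>
      finite {g \<in> carrier G. P (g \<otimes> s) \<noteq> P g \<and> P' (g \<otimes> s') \<noteq> P' g}"
    and P_A: "\<And>g. g \<in> carrier G \<Longrightarrow> \<exists>n0. \<forall>n\<ge>n0. P (A n \<otimes> g) \<and> \<not> P (A (- n) \<otimes> g)"
    and P'_A: "\<And>g i. g \<in> carrier G \<Longrightarrow> P' (A i \<otimes> g) = P' g"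
    and P'_B: "\<And>g. g \<in> carrier G \<Longrightarrow> \<exists>n0. \<forall>n\<ge>n0. P' (B n \<otimes> g) \<and> \<not> P' (B (- n) \<otimes> g)"
  shows "\<not> essentially_connected 2 Y (superlevel Y E h)"
proof
  assume ess: "essentially_connected 2 Y (superlevel Y E h)"
  obtain C where C: "\<forall>g\<in>carrier G. \<forall>x\<in>high (\<psi> g). \<forall>y\<in>high (\<psi> g).
       path_component_of (subtopology Y (high (\<psi> g - C))) x y"
    "\<forall>g\<in>carrier G. \<forall>L. continuous_map (top_of_set {0..1::real}) Y L \<longrightarrow> L 0 = L 1 \<longrightarrow>
       L ` {0..1} \<subseteq> high (\<psi> g) \<longrightarrow>
       (\<exists>H. continuous_map (top_of_set ({0..1::real} \<times> {0..1::real})) Y H \<and>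
         (\<forall>s\<in>{0..1}. H (0, s) = L s \<and> H (s, 0) = H (s, 1) \<and> H (1, s) = L 0) \<and>
         H ` ({0..1} \<times> {0..1}) \<subseteq> high (\<psi> g - C))"
    by (rule high_paths_and_loops[OF ess])
  obtain K where K: "compactin Y K" "(\<Union>g\<in>carrier G. act g ` K) = topspace Y"
  proof -
    have "\<exists>K. compactin Y K \<and> (\<Union>g\<in>carrier G. act g ` K) = topspace Y"
      using action unfolding proper_cocompact_cellular_action_def by (elim conjE)
    then show thesis using that by blast
  qed
  have KY: "K \<subseteq> topspace Y" using K(1) by (rule compactin_subset_topspace)
  have "\<forall>y\<in>topspace Y. \<exists>g. g \<in> carrier G \<and> y \<in> act g ` K"
    using K(2) by blast
  \<comment> \<open>\<open>\<kappa> y\<close> is the label of \<open>y\<close>, chosen without any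
    continuity; labels of nearby points are compared through overlapping translates of
    \<open>K\<close>.\<close>
  from bchoice[OF this] obtain \<kappa> where \<kappa>': "\<forall>y\<in>topspace Y. \<kappa> y \<in> carrier G \<and> y \<in> act (\<kappa> y) ` K" ..
  have \<kappa>: "\<kappa> y \<in> carrier G" "y \<in> act (\<kappa> y) ` K" if "y \<in> topspace Y" for y
    using bspec[OF \<kappa>' that] by simp_all
  define S where "S = {g \<in> carrier G. act g ` K \<inter> K \<noteq> {}}"
  have "finite S" unfolding S_def by (rule act_proper[OF K(1)])
  have translate: "inv g \<otimes> g' \<in> {s \<in> carrier G. act s ` K \<inter> T \<noteq> {}}"
    if gg: "g \<in> carrier G" "g' \<in> carrier G" "act g ` T \<inter> act g' ` K \<noteq> {}" "T \<subseteq> topspace Y" for g g' T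
  proof -
    obtain k k' where k: "k \<in> T" "k' \<in> K" "act g k = act g' k'" using gg(3) by blast
    have "act (inv g \<otimes> g') k' = act (inv g) (act g' k')"
      using k(2) KY gg(1,2) by (intro act_mult) auto
    also have "\<dots> = k"
      unfolding k(3)[symmetric] using k(1) gg(4) by (intro act_inv_act[OF gg(1)]) blast
    finally have "k \<in> act (inv g \<otimes> g') ` K" using k(2) by blast
    then show ?thesis using k(1) gg(1,2) by blast
  qed
  have adjacent: "\<exists>s\<in>S. g' = g \<otimes> s"
    if "g \<in> carrier G" "g' \<in> carrier G" "act g ` K \<inter> act g' ` K \<noteq> {}" for g g'
    using translate[OF that KY] that(1,2) unfolding S_def
    by (intro bexI[of _ "inv g \<otimes> g'"]) (simp_all add: m_assoc[symmetric])
  \<comment> \<open>The set to be avoided: elements from which one step in \<open>S\<close> crosses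
    the first wall and another step crosses the second.\<close>
  define F where "F = (\<Union>s\<in>S. \<Union>s'\<in>S. {g \<in> carrier G. P (g \<otimes> s) \<noteq> P g \<and> P' (g \<otimes> s') \<noteq> P' g})"
  have "finite F"
    unfolding F_def using \<open>finite S\<close> fin by (intro finite_UN_I) (auto simp: S_def)
  \<comment> \<open>Both outer vertices are right multiples of the middle vertex \<open>x\<close> by
    elements of \<open>S\<close>, so a nonzero coboundary would put \<open>x\<close> into
    \<open>F\<close>.\<close>
  have closed_off_F: "half_space_cochain P P' g x + half_space_cochain P P' x k = half_space_cochain P P' g k"
    if gxk: "g \<in> carrier G" "x \<in> carrier G" "k \<in> carrier G" "x \<notin> F"
      "act x ` K \<inter> act g ` K \<noteq> {}" "act x ` K \<inter> act k ` K \<noteq> {}" for g x k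
  proof (rule half_space_cochain_closed)
    obtain s s' where s: "s \<in> S" "g = x \<otimes> s" "s' \<in> S" "k = x \<otimes> s'"
      using adjacent[OF gxk(2,1,5)] adjacent[OF gxk(2,3,6)] by blast
    then show "P g = P x \<or> P' x = P' k"
      using gxk(2,4) unfolding F_def by blast
  qed
  have "compact (h ` K)" using image_compactin[OF K(1) h_continuous] by simp
  then have "bounded (\<psi> ` F \<union> h ` K)"
    using \<open>finite F\<close> by (simp add: compact_imp_bounded finite_imp_bounded)
  then obtain c where c: "\<And>x. x \<in> F \<Longrightarrow> \<bar>\<psi> x\<bar> \<le> c" "\<And>y. y \<in> K \<Longrightarrow> \<bar>h y\<bar> \<le> c"
    unfolding bounded_iff by auto
  \<comment> \<open>A point labelled in \<open>F\<close> has height at most \<open>2 * c\<close>: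
    one \<open>c\<close> for the character on \<open>F\<close>, one for \<open>h\<close> on
    \<open>K\<close>. The extra 1 makes the comparison strict.\<close>
  have \<kappa>_notin_F: "\<kappa> y \<notin> F" if y: "y \<in> high (2 * c + 1)" for y
  proof
    assume F: "\<kappa> y \<in> F"
    have yY: "y \<in> topspace Y" using y by (simp add: high_def)
    obtain k where k: "k \<in> K" "y = act (\<kappa> y) k" using \<kappa>(2)[OF yY] by blast
    then have "h y = \<psi> (\<kappa> y) + h k" using h_act[OF \<kappa>(1)[OF yY], of k] KY by auto
    moreover have "2 * c + 1 \<le> h y" using y by (simp add: high_def)
    ultimately show False using c(1)[OF F] c(2)[OF k(1)] by linarith
  qed
  \<comment> \<open>The loss \<open>C\<close> is paid twice: \<open>\<gamma>\<close> leaves room for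
    filling the loop, and \<open>\<gamma>'\<close> for joining translates of the base point by
    paths.\<close>
  obtain \<gamma> where \<gamma>: "\<gamma> \<in> carrier G" "2 * c + 1 + C \<le> \<psi> \<gamma>"
    by (rule char_unbounded[OF nontrivial])
  obtain \<gamma>' where \<gamma>': "\<gamma>' \<in> carrier G" "\<psi> \<gamma> + C \<le> \<psi> \<gamma>'"
    by (rule char_unbounded[OF nontrivial])
  obtain y0 where y0: "y0 \<in> high (\<psi> \<gamma>')"
  proof -
    obtain y where y: "y \<in> topspace Y" using nonempty by blast
    obtain g where g: "g \<in> carrier G" "\<psi> \<gamma>' - h y \<le> \<psi> g"
      by (rule char_unbounded[OF nontrivial])
    then show thesis
      using that[of "act g y"] act_in[OF g(1) y] h_act[OF g(1) y] by (simp add: high_def)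
  qed
  have y0Y: "y0 \<in> topspace Y" using y0 by (simp add: high_def)
  \<comment> \<open>One compact path for each direction of the plane suffices, since translates by
    elements of character 0 keep its height.\<close>
  have high_path: "\<exists>T. compactin Y T \<and> T \<subseteq> high (\<psi> \<gamma>) \<and> path_component_of (subtopology Y T) y0 (act x y0)"
    if x: "x \<in> carrier G" "\<psi> x = 0" for x
  proof -
    have "act x y0 \<in> high (\<psi> \<gamma>')" using act_high[OF x(1) y0] x(2) by simp
    then have "path_component_of (subtopology Y (high (\<psi> \<gamma>' - C))) y0 (act x y0)"
      using C(1) \<gamma>'(1) y0 by blast
    then obtain f where f: "continuous_map (top_of_set {0..1::real}) (subtopology Y (high (\<psi> \<gamma>' - C))) f"
      "f 0 = y0" "f 1 = act x y0"
      unfolding path_component_of_def pathin_def by blast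
    have fY: "continuous_map (top_of_set {0..1}) Y f" "f ` {0..1} \<subseteq> high (\<psi> \<gamma>' - C)"
      using f(1) by (auto simp: continuous_map_in_subtopology)
    have "compactin Y (f ` {0..1})"
      by (rule image_compactin[OF _ fY(1)]) (simp add: compactin_subtopology)
    moreover have "f ` {0..1} \<subseteq> high (\<psi> \<gamma>)"
      using fY(2) high_mono[of "\<psi> \<gamma>" "\<psi> \<gamma>' - C"] \<gamma>'(2) by auto
    moreover have "pathin (subtopology Y (f ` {0..1})) f"
      unfolding pathin_def using fY(1) by (auto simp: continuous_map_in_subtopology)
    then have "path_component_of (subtopology Y (f ` {0..1})) y0 (act x y0)"
      unfolding path_component_of_def using f(2,3) by blast
    ultimately show ?thesis by blast
  qed
  obtain TA where TA: "compactin Y TA" "TA \<subseteq> high (\<psi> \<gamma>)"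
    "path_component_of (subtopology Y TA) y0 (act (A 1) y0)"
    using high_path[OF A(1,3)] by blast
  obtain TB where TB: "compactin Y TB" "TB \<subseteq> high (\<psi> \<gamma>)"
    "path_component_of (subtopology Y TB) y0 (act (B 1) y0)"
    using high_path[OF B(1,3)] by blast
  define T where "T = TA \<union> TB"
  have T: "compactin Y T" "T \<subseteq> high (\<psi> \<gamma>)" "T \<subseteq> topspace Y"
    using TA(1,2) TB(1,2) by (auto simp: T_def compactin_Un high_def)
  \<comment> \<open>By \<open>label\<close> below, labels on \<open>act x\<close> applied to
    \<open>T\<close> are products of \<open>x\<close> with elements of this finite set, so finitely
    many elements govern the signs on sides of any length.\<close>
  define \<Gamma> where "\<Gamma> = {g \<in> carrier G. act g ` K \<inter> T \<noteq> {}}"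
  have "finite \<Gamma>"
  proof (rule finite_subset)
    show "\<Gamma> \<subseteq> {g \<in> carrier G. act g ` (K \<union> T) \<inter> (K \<union> T) \<noteq> {}}" unfolding \<Gamma>_def by blast
    show "finite \<dots>" by (rule act_proper[OF compactin_Un[OF K(1) T(1)]])
  qed
  have label: "\<exists>s\<in>\<Gamma>. \<kappa> y = x \<otimes> s" if "x \<in> carrier G" "y \<in> act x ` T" for x y
  proof -
    have yY: "y \<in> topspace Y" using that T(3) act_in[OF that(1)] by blast
    have "inv x \<otimes> \<kappa> y \<in> \<Gamma>"
      unfolding \<Gamma>_def using that(2) \<kappa>(2)[OF yY] by (intro translate[OF that(1) \<kappa>(1)[OF yY] _ T(3)]) blast
    then show ?thesis
      using that(1) \<kappa>(1)[OF yY] by (intro bexI[of _ "inv x \<otimes> \<kappa> y"]) (simp_all add: m_assoc[symmetric])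
  qed
  have uniform: "\<exists>n\<ge>1. \<forall>g\<in>D. R n g" if "finite D" "\<forall>g\<in>D. \<exists>n0. \<forall>n\<ge>n0. R n g"
    for D :: "'g set" and R :: "int \<Rightarrow> 'g \<Rightarrow> bool"
  proof -
    from bchoice[OF that(2)] obtain n0 where n0: "\<forall>g\<in>D. \<forall>n\<ge>n0 g. R n g" ..
    have "\<forall>g\<in>D. n0 g \<le> Max (insert 1 (n0 ` D))" using that(1) by simp
    then show ?thesis
      using n0 that(1) by (intro exI[of _ "Max (insert 1 (n0 ` D))"]) simp
  qed
  have "\<forall>g\<in>\<Gamma>. \<exists>n0. \<forall>n\<ge>n0. P' (B n \<otimes> g) \<and> \<not> P' (B (- n) \<otimes> g)"
    using P'_B by (simp add: \<Gamma>_def)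
  from uniform[OF \<open>finite \<Gamma>\<close> this]
  obtain J where J: "J \<ge> 1" "\<And>g. g \<in> \<Gamma> \<Longrightarrow> P' (B J \<otimes> g) \<and> \<not> P' (B (- J) \<otimes> g)" by blast
  \<comment> \<open>\<open>J\<close> is fixed before \<open>n\<close>: on the sides in direction
    \<open>B\<close> every label is some \<open>A i\<close> times an element of \<open>D\<close>,
    and \<open>D\<close> is finite because \<open>J\<close> is already chosen. This takes the place
    of an invariance of \<open>P\<close> under \<open>B\<close>.\<close>
  define D where "D = (\<Union>j\<in>{- J..<J}. (\<lambda>g. B j \<otimes> g) ` \<Gamma>)"
  have D: "finite D" "D \<subseteq> carrier G"
    using \<open>finite \<Gamma>\<close> B(1) unfolding D_def \<Gamma>_def by auto
  have "\<forall>g\<in>D. \<exists>n0. \<forall>n\<ge>n0. P (A n \<otimes> g) \<and> \<not> P (A (- n) \<otimes> g)"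
    using P_A D(2) by (intro ballI) (rule P_A, rule subsetD)
  from uniform[OF D(1) this]
  obtain n where n: "n \<ge> 1" "\<And>g. g \<in> D \<Longrightarrow> P (A n \<otimes> g) \<and> \<not> P (A (- n) \<otimes> g)" by blast
  define side_A where "side_A j = (\<Union>i\<in>{- n..<n}. act (B j \<otimes> A i) ` TA)" for j
  define side_B where "side_B i = (\<Union>j\<in>{- J..<J}. act (A i \<otimes> B j) ` TB)" for i
  define corner where "corner i j = act (A i \<otimes> B j) y0" for i j
  have AB: "A i \<otimes> B j \<in> carrier G" "\<psi> (A i \<otimes> B j) = 0" for i j
    using A(1,3) B(1,3) by (simp_all add: char_mult)
  have y0_T: "y0 \<in> TA" "y0 \<in> TB"
    using path_component_in_topspace[OF TA(3)] path_component_in_topspace[OF TB(3)] by auto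
  have path_A: "path_component_of (subtopology Y (side_A j)) (corner (- n) j) (corner n j)" for j
    unfolding corner_def
  proof (rule path_component_of_chain)
    show "- n \<le> n" using n(1) by simp
    have "act (A (- n) \<otimes> B j) y0 \<in> side_A j"
      using n(1) y0_T unfolding side_A_def comm by (intro UN_I[of "- n"] imageI) auto
    then show "act (A (- n) \<otimes> B j) y0 \<in> topspace (subtopology Y (side_A j))"
      using act_in[OF AB(1) y0Y] by simp
    fix i assume i: "- n \<le> i" "i < n"
    have "act (A i \<otimes> B j) (act (A 1) y0) = act (A i \<otimes> B j \<otimes> A 1) y0"
      using act_mult[OF AB(1)[of i j] A(1) y0Y] by simp
    also have "A i \<otimes> B j \<otimes> A 1 = A (i + 1) \<otimes> B j"
      using A(1) B(1) by (simp add: A(2) m_assoc comm[symmetric])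
    finally have "path_component_of (subtopology Y (act (A i \<otimes> B j) ` TA))
        (act (A i \<otimes> B j) y0) (act (A (i + 1) \<otimes> B j) y0)"
      using path_component_of_continuous_image[OF TA(3) act_continuous[OF AB(1)[of i j]]] by simp
    moreover have "act (A i \<otimes> B j) ` TA \<subseteq> side_A j"
      using i unfolding side_A_def comm by (intro UN_upper) simp
    ultimately show "path_component_of (subtopology Y (side_A j))
        (act (A i \<otimes> B j) y0) (act (A (i + 1) \<otimes> B j) y0)"
      by (rule path_component_of_mono)
  qed
  have path_B: "path_component_of (subtopology Y (side_B i)) (corner i (- J)) (corner i J)" for i
    unfolding corner_def
  proof (rule path_component_of_chain)
    show "- J \<le> J" using J(1) by simp
    have "act (A i \<otimes> B (- J)) y0 \<in> side_B i"
      using J(1) y0_T unfolding side_B_def by (intro UN_I[of "- J"] imageI) auto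
    then show "act (A i \<otimes> B (- J)) y0 \<in> topspace (subtopology Y (side_B i))"
      using act_in[OF AB(1) y0Y] by simp
    fix j assume j: "- J \<le> j" "j < J"
    have "act (A i \<otimes> B j) (act (B 1) y0) = act (A i \<otimes> B j \<otimes> B 1) y0"
      using act_mult[OF AB(1)[of i j] B(1) y0Y] by simp
    also have "A i \<otimes> B j \<otimes> B 1 = A i \<otimes> B (j + 1)"
      using A(1) B(1) by (simp add: B(2) m_assoc)
    finally have "path_component_of (subtopology Y (act (A i \<otimes> B j) ` TB))
        (act (A i \<otimes> B j) y0) (act (A i \<otimes> B (j + 1)) y0)"
      using path_component_of_continuous_image[OF TB(3) act_continuous[OF AB(1)[of i j]]] by simp
    moreover have "act (A i \<otimes> B j) ` TB \<subseteq> side_B i"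
      using j unfolding side_B_def by (intro UN_upper) simp
    ultimately show "path_component_of (subtopology Y (side_B i))
        (act (A i \<otimes> B j) y0) (act (A i \<otimes> B (j + 1)) y0)"
      by (rule path_component_of_mono)
  qed
  have act_T_high: "act (A i \<otimes> B j) ` T \<subseteq> high (\<psi> \<gamma>)" for i j
    using act_high[OF AB(1)] T(2) AB(2) by fastforce
  have side_A_T: "\<exists>i. y \<in> act (A i \<otimes> B j) ` T" if "y \<in> side_A j" for y j
    using that unfolding side_A_def T_def comm by blast
  have side_B_T: "\<exists>j\<in>{- J..<J}. y \<in> act (A i \<otimes> B j) ` T" if "y \<in> side_B i" for y i
    using that unfolding side_B_def T_def by blast
  have high_sides: "side_A j \<subseteq> high (\<psi> \<gamma>)" "side_B j \<subseteq> high (\<psi> \<gamma>)" for j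
    using side_A_T side_B_T act_T_high by blast+
  \<comment> \<open>Invariance of \<open>P'\<close> under \<open>A\<close> strips the factor
    \<open>A i\<close>, so the sign on this side does not depend on \<open>n\<close>.\<close>
  have label_A: "\<exists>s\<in>\<Gamma>. P' (\<kappa> y) = P' (B j \<otimes> s)" if y: "y \<in> side_A j" for y j
  proof -
    obtain i where "y \<in> act (A i \<otimes> B j) ` T" using side_A_T[OF y] by blast
    then obtain s where s: "s \<in> \<Gamma>" "\<kappa> y = A i \<otimes> B j \<otimes> s" using label[OF AB(1)] by blast
    have sG: "s \<in> carrier G" using s(1) by (simp add: \<Gamma>_def)
    have "\<kappa> y = A i \<otimes> (B j \<otimes> s)" using s(2) A(1) B(1) sG by (simp add: m_assoc)
    then show ?thesis using s(1) P'_A[of "B j \<otimes> s" i] B(1) sG by auto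
  qed
  have label_B: "\<exists>g\<in>D. \<kappa> y = A i \<otimes> g" if y: "y \<in> side_B i" for y i
  proof -
    obtain j where j: "j \<in> {- J..<J}" "y \<in> act (A i \<otimes> B j) ` T" using side_B_T[OF y] by blast
    then obtain s where s: "s \<in> \<Gamma>" "\<kappa> y = A i \<otimes> B j \<otimes> s" using label[OF AB(1)] by blast
    have "\<kappa> y = A i \<otimes> (B j \<otimes> s)" using s A(1) B(1) by (simp add: m_assoc \<Gamma>_def)
    moreover have "B j \<otimes> s \<in> D" using j(1) s(1) unfolding D_def by blast
    ultimately show ?thesis by blast
  qed
  have signs: "y \<in> side_A (- J) \<Longrightarrow> \<not> P' (\<kappa> y)" "y \<in> side_A J \<Longrightarrow> P' (\<kappa> y)"
    "y \<in> side_B n \<Longrightarrow> P (\<kappa> y)" "y \<in> side_B (- n) \<Longrightarrow> \<not> P (\<kappa> y)" for y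
    using label_A J(2) label_B n(2) by metis+
  \<comment> \<open>The boundary of the rectangle starting at \<open>corner (- n) (- J)\<close>,
    with the sides in the order expected by \<open>rectangle_sum\<close>; the last two paths are
    reversed.\<close>
  obtain L where L: "continuous_map (top_of_set {0..4::real}) Y L" "L 0 = L 4"
    "\<And>s. s \<in> {0..1} \<Longrightarrow> L s \<in> side_A (- J)" "\<And>s. s \<in> {1..2} \<Longrightarrow> L s \<in> side_B n"
    "\<And>s. s \<in> {2..3} \<Longrightarrow> L s \<in> side_A J" "\<And>s. s \<in> {3..4} \<Longrightarrow> L s \<in> side_B (- n)"
    by (rule four_paths_loop[OF path_A[of "- J"] path_B[of n]
          path_component_of_sym[OF path_A[of J]] path_component_of_sym[OF path_B[of "- n"]]])
      (assumption | rule that)+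
  have scale: "continuous_map (top_of_set {0..1}) (top_of_set {0..4}) (\<lambda>s :: real. 4 * s)"
    by (auto simp: continuous_map_in_subtopology intro!: continuous_intros)
  have L': "continuous_map (top_of_set {0..1}) Y (\<lambda>s. L (4 * s))"
    using continuous_map_compose[OF scale L(1)] by (simp add: o_def)
  have "L s \<in> high (\<psi> \<gamma>)" if "s \<in> {0..4}" for s
  proof -
    have "0 \<le> s" "s \<le> 4" using that by auto
    then consider "s \<in> {0..1}" | "s \<in> {1..2}" | "s \<in> {2..3}" | "s \<in> {3..4}"
      by (cases "s \<le> 1"; cases "s \<le> 2"; cases "s \<le> 3") auto
    then show ?thesis
    proof cases
      case 1
      show ?thesis by (rule subsetD[OF high_sides(1) L(3)[OF 1]])
    next
      case 2
      show ?thesis by (rule subsetD[OF high_sides(2) L(4)[OF 2]])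
    next
      case 3
      show ?thesis by (rule subsetD[OF high_sides(1) L(5)[OF 3]])
    next
      case 4
      show ?thesis by (rule subsetD[OF high_sides(2) L(6)[OF 4]])
    qed
  qed
  then have L_high: "(\<lambda>s. L (4 * s)) ` {0..1} \<subseteq> high (\<psi> \<gamma>)" by auto
  have L_closed: "L (4 * 0) = L (4 * 1)" using L(2) by simp
  from bspec[OF C(2) \<gamma>(1), THEN spec, THEN mp, THEN mp, THEN mp, OF L' L_closed L_high]
  obtain H where H: "continuous_map (top_of_set ({0..1::real} \<times> {0..1::real})) Y H"
    "\<forall>s\<in>{0..1}. H (0, s) = L (4 * s) \<and> H (s, 0) = H (s, 1) \<and> H (1, s) = L (4 * 0)"
    "H ` ({0..1} \<times> {0..1}) \<subseteq> high (\<psi> \<gamma> - C)"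
    by blast
  let ?Q = "{0..1::real} \<times> {0..1::real}"
  have "compact ?Q" by (intro compact_Times compact_Icc)
  have HY: "H p \<in> topspace Y" if "p \<in> ?Q" for p
    using H(3) that by (auto simp: high_def)
  have "compactin Y (H ` ?Q)"
    by (rule image_compactin[OF _ H(1)]) (simp add: compactin_subtopology \<open>compact ?Q\<close>)
  \<comment> \<open>Properness leaves finitely many translates of \<open>K\<close> that meet the
    filling; they are closed, so a mesh \<open>\<delta>\<close> exists below which labels of nearby
    points have overlapping translates.\<close>
  define \<Delta> where "\<Delta> = {g \<in> carrier G. act g ` K \<inter> H ` ?Q \<noteq> {}}"
  have fin_\<Delta>: "finite \<Delta>"
  proof (rule finite_subset)
    show "\<Delta> \<subseteq> {g \<in> carrier G. act g ` (K \<union> H ` ?Q) \<inter> (K \<union> H ` ?Q) \<noteq> {}}"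
      unfolding \<Delta>_def by blast
    show "finite \<dots>"
      by (rule act_proper[OF compactin_Un[OF K(1) \<open>compactin Y (H ` ?Q)\<close>]])
  qed
  have closed_\<Delta>: "closedin Y (act g ` K)" if "g \<in> \<Delta>" for g
  proof -
    have "g \<in> carrier G" using that by (simp add: \<Delta>_def)
    then show ?thesis
      by (intro compactin_imp_closedin[OF Hausdorff] image_compactin[OF K(1)] act_continuous)
  qed
  obtain \<delta> where \<delta>: "\<delta> > 0" "\<And>p q g g'. p \<in> ?Q \<Longrightarrow> q \<in> ?Q \<Longrightarrow> g \<in> \<Delta> \<Longrightarrow> g' \<in> \<Delta> \<Longrightarrow>
      dist p q < \<delta> \<Longrightarrow> H p \<in> act g ` K \<Longrightarrow> H q \<in> act g' ` K \<Longrightarrow> act g ` K \<inter> act g' ` K \<noteq> {}"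
    by (rule finite_closed_family_separated[OF \<open>compact ?Q\<close> H(1) fin_\<Delta> closed_\<Delta>]) (assumption | rule that)+
  obtain l where l: "inverse (real (Suc l)) < \<delta>" using reals_Archimedean[OF \<delta>(1)] by blast
  \<comment> \<open>Using \<open>4 * m\<close> subdivisions makes the corners grid points and gives
    every side \<open>m\<close> steps. Neighbouring grid points, diagonals included, are at distance
    at most \<open>2 / real (4 * m)\<close>.\<close>
  define m where "m = Suc l"
  have m: "m > 0" "2 / real (4 * m) < \<delta>"
    using l \<delta>(1) by (simp_all add: m_def field_simps)
  define p where "p i j = (real i / real (4 * m), real j / real (4 * m))" for i j
  have pQ: "p i j \<in> ?Q" if "i \<le> 4 * m" "j \<le> 4 * m" for i j
    using that m(1) by (simp add: p_def field_simps)
  define V where "V i j = \<kappa> (H (p i j))" for i j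
  have V: "V i j \<in> carrier G" "H (p i j) \<in> act (V i j) ` K" "V i j \<notin> F" "V i j \<in> \<Delta>"
    if "i \<le> 4 * m" "j \<le> 4 * m" for i j
  proof -
    note Q = pQ[OF that]
    show VG: "V i j \<in> carrier G" and VK: "H (p i j) \<in> act (V i j) ` K"
      unfolding V_def by (rule \<kappa>[OF HY[OF Q]])+
    show "V i j \<in> \<Delta>"
      unfolding \<Delta>_def using VG VK imageI[OF Q, of H] by blast
    have "H (p i j) \<in> high (2 * c + 1)"
    proof (rule subsetD[OF high_mono])
      show "2 * c + 1 \<le> \<psi> \<gamma> - C" using \<gamma>(2) by simp
      show "H (p i j) \<in> high (\<psi> \<gamma> - C)" by (rule subsetD[OF H(3) imageI[OF Q]])
    qed
    then show "V i j \<notin> F" unfolding V_def by (rule \<kappa>_notin_F)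
  qed
  have adj: "act (V i j) ` K \<inter> act (V i' j') ` K \<noteq> {}"
    if ij: "i \<le> 4 * m" "j \<le> 4 * m" "i' \<le> 4 * m" "j' \<le> 4 * m"
      "\<bar>real i - real i'\<bar> \<le> 1" "\<bar>real j - real j'\<bar> \<le> 1" for i j i' j'
  proof (rule \<delta>(2)[OF pQ[OF ij(1,2)] pQ[OF ij(3,4)]])
    show "V i j \<in> \<Delta>" by (rule V(4)[OF ij(1,2)])
    show "V i' j' \<in> \<Delta>" by (rule V(4)[OF ij(3,4)])
    show "H (p i j) \<in> act (V i j) ` K" by (rule V(2)[OF ij(1,2)])
    show "H (p i' j') \<in> act (V i' j') ` K" by (rule V(2)[OF ij(3,4)])
    have "dist (p i j) (p i' j') \<le> \<bar>real i / real (4 * m) - real i' / real (4 * m)\<bar> +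
        \<bar>real j / real (4 * m) - real j' / real (4 * m)\<bar>"
      unfolding p_def dist_Pair_Pair dist_real_def by (rule sqrt_sum_squares_le_sum_abs[THEN order_trans]) simp
    also have "\<dots> = (\<bar>real i - real i'\<bar> + \<bar>real j - real j'\<bar>) / real (4 * m)"
      by (simp add: diff_divide_distrib[symmetric] add_divide_distrib)
    also have "\<dots> \<le> 2 / real (4 * m)"
      using ij(5,6) by (intro divide_right_mono) auto
    finally show "dist (p i j) (p i' j') < \<delta>" using m(2) by simp
  qed
  let ?\<phi> = "half_space_cochain P P'"
  have "(\<Sum>j<4 * m. ?\<phi> (V 0 j) (V 0 (Suc j))) = 0"
  proof (rule grid_sum_eq_zero[where M = "4 * m" and c = "\<kappa> (L 0)"])
    fix i j assume ij: "i < 4 * m" "j < 4 * m"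
    \<comment> \<open>The square is cut along the diagonal from \<open>(i, j)\<close> to
      \<open>(Suc i, Suc j)\<close>; both triangles give the value on that diagonal.\<close>
    have "?\<phi> (V i j) (V i (Suc j)) + ?\<phi> (V i (Suc j)) (V (Suc i) (Suc j)) = ?\<phi> (V i j) (V (Suc i) (Suc j))"
      using ij by (intro closed_off_F V adj) auto
    moreover have "?\<phi> (V i j) (V (Suc i) j) + ?\<phi> (V (Suc i) j) (V (Suc i) (Suc j)) = ?\<phi> (V i j) (V (Suc i) (Suc j))"
      using ij by (intro closed_off_F V adj) auto
    ultimately show "?\<phi> (V i j) (V i (Suc j)) + ?\<phi> (V i (Suc j)) (V (Suc i) (Suc j)) =
        ?\<phi> (V i j) (V (Suc i) j) + ?\<phi> (V (Suc i) j) (V (Suc i) (Suc j))" by simp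
  next
    fix i assume "i \<le> 4 * m"
    then have "real i / real (4 * m) \<in> {0..1}" using m(1) by (simp add: field_simps)
    then show "V i 0 = V i (4 * m)"
      using H(2) m(1) unfolding V_def p_def by simp
  next
    fix j assume "j \<le> 4 * m"
    then have "real j / real (4 * m) \<in> {0..1}" using m(1) by (simp add: field_simps)
    then show "V (4 * m) j = \<kappa> (L 0)"
      using H(2) m(1) unfolding V_def p_def by simp
  qed simp
  moreover have V0: "V 0 j = \<kappa> (L (real j / real m))" if "j \<le> 4 * m" for j
  proof -
    have "real j / real (4 * m) \<in> {0..1}" using m(1) that by (simp add: field_simps)
    then show ?thesis using H(2) m(1) unfolding V_def p_def by simp
  qed
  moreover have "(\<Sum>j<4 * m. ?\<phi> (\<kappa> (L (real j / real m))) (\<kappa> (L (real (Suc j) / real m)))) = 1"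
  proof (rule rectangle_sum)
    fix j :: nat
    show "\<not> P' (\<kappa> (L (real j / real m)))" if "j \<le> m"
      using that m(1) by (intro signs(1) L(3)) simp
    show "P (\<kappa> (L (real j / real m)))" if "m \<le> j" "j \<le> 2 * m"
      using that m(1) by (intro signs(3) L(4)) (simp add: field_simps)
    show "P' (\<kappa> (L (real j / real m)))" if "2 * m \<le> j" "j \<le> 3 * m"
      using that m(1) by (intro signs(2) L(5)) (simp add: field_simps)
    show "\<not> P (\<kappa> (L (real j / real m)))" if "3 * m \<le> j" "j \<le> 4 * m"
      using that m(1) by (intro signs(4) L(6)) (simp add: field_simps)
  qed
  moreover have "(\<Sum>j<4 * m. ?\<phi> (V 0 j) (V 0 (Suc j))) =
      (\<Sum>j<4 * m. ?\<phi> (\<kappa> (L (real j / real m))) (\<kappa> (L (real (Suc j) / real m))))"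
    using V0 by (intro sum.cong) auto
  ultimately show False by simp
qed

end

section \<open>Reduced words\<close>

lemma fst_inv_letter [simp]: "fst (inv_letter a) = fst a"
  and inv_letter_inv_letter [simp]: "inv_letter (inv_letter a) = a"
  and inv_letter_neq [simp]: "inv_letter a \<noteq> a" "a \<noteq> inv_letter a"
  and inv_letter_Pair [simp]: "inv_letter (i, e) = (i, \<not> e)"
  by (cases a; auto simp: inv_letter_def)+

lemma inv_letter_eq_iff [simp]: "inv_letter a = inv_letter b \<longleftrightarrow> a = b"
  by (metis inv_letter_inv_letter)

lemma eq_or_inv_letter: "fst a = fst b \<Longrightarrow> a = b \<or> a = inv_letter b"
  by (cases a; cases b) auto

lemma reduced_Cons: "reduced (a # w) \<longleftrightarrow> reduced w \<and> (w = [] \<or> hd w \<noteq> inv_letter a)"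
  by (cases w) auto

lemma reduced_append:
  "reduced (u @ v) \<longleftrightarrow>
     reduced u \<and> reduced v \<and> (u = [] \<or> v = [] \<or> hd v \<noteq> inv_letter (last u))"
  by (induction u) (auto simp: reduced_Cons)

abbreviation word_mult :: "('i \<times> bool) list \<Rightarrow> ('i \<times> bool) list \<Rightarrow> ('i \<times> bool) list" where
  "word_mult u v \<equiv> foldr cons_reduce u v"

definition word_inv :: "('i \<times> bool) list \<Rightarrow> ('i \<times> bool) list" where
  "word_inv w = rev (map inv_letter w)"

lemma word_inv_simps [simp]:
  "word_inv [] = []" "word_inv (u @ v) = word_inv v @ word_inv u"
  "word_inv (a # u) = word_inv u @ [inv_letter a]"
  "word_inv (word_inv w) = w" "word_inv w = [] \<longleftrightarrow> w = []"
  "fst ` set (word_inv w) = fst ` set w" "length (word_inv w) = length w"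
  by (auto simp: word_inv_def rev_map o_def image_image)

lemma hd_word_inv: "w \<noteq> [] \<Longrightarrow> hd (word_inv w) = inv_letter (last w)"
  and last_word_inv: "w \<noteq> [] \<Longrightarrow> last (word_inv w) = inv_letter (hd w)"
  by (auto simp: word_inv_def hd_rev last_rev last_map hd_map)

lemma reduced_word_inv [simp]: "reduced (word_inv w) \<longleftrightarrow> reduced w"
proof -
  have "reduced (word_inv w)" if "reduced w" for w :: "('i \<times> bool) list"
    using that by (induction w) (auto simp: reduced_Cons reduced_append last_word_inv)
  then show ?thesis
    by (metis word_inv_simps(4))
qed

lemma reduced_cons_reduce: "reduced w \<Longrightarrow> reduced (cons_reduce a w)"
  by (cases w) (auto simp: reduced_Cons)

lemma cons_reduce_inv_letter: "reduced w \<Longrightarrow> cons_reduce (inv_letter a) (cons_reduce a w) = w"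
  by (cases w rule: remdups_adj.cases) auto

lemma reduced_word_mult: "reduced v \<Longrightarrow> reduced (word_mult u v)"
  by (induction u) (auto intro: reduced_cons_reduce)

lemma cons_reduce_reduced: "reduced (a # w) \<Longrightarrow> cons_reduce a w = a # w"
  by (cases w) auto

lemma word_mult_reduced: "reduced (u @ v) \<Longrightarrow> word_mult u v = u @ v"
  by (induction u) (simp_all add: cons_reduce_reduced reduced_Cons)

text \<open>Van der Waerden's argument: letters act on reduced words by permutations, with
  \<open>cons_reduce (inv_letter a)\<close> inverse to \<open>cons_reduce a\<close>. This settles
  the case in which \<open>a\<close> cancels against \<open>u\<close>, and associativity
  follows.\<close>

lemma word_mult_cons_reduce:
  "reduced v \<Longrightarrow> word_mult (cons_reduce a u) v = cons_reduce a (word_mult u v)"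
  using cons_reduce_inv_letter[of _ "inv_letter a"] reduced_word_mult[of v]
  by (cases u) auto

lemma word_mult_assoc: "reduced w \<Longrightarrow> word_mult (word_mult u v) w = word_mult u (word_mult v w)"
  by (induction u) (auto simp: word_mult_cons_reduce)

lemma word_mult_word_inv: "reduced v \<Longrightarrow> word_mult (word_inv w) (word_mult w v) = v"
  by (induction w) (auto simp: cons_reduce_inv_letter reduced_word_mult)

lemma set_cons_reduce: "set (cons_reduce a w) \<subseteq> insert a (set w)"
  by (cases w) auto

lemma set_word_mult: "set (word_mult u v) \<subseteq> set u \<union> set v"
proof (induction u)
  case (Cons a u)
  then show ?case
    using set_cons_reduce[of a "word_mult u v"] by auto
qed simp

text \<open>\<open>c\<close> is the piece cancelled at the junction. The induction removes letters
  from the right end of \<open>u\<close>, where the cancellation takes place.\<close>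

lemma word_mult_cancellation:
  assumes "reduced u" "reduced v"
  obtains p c q where "u = p @ c" "v = word_inv c @ q" "word_mult u v = p @ q" "reduced (p @ q)"
proof -
  have "\<exists>p c q. u = p @ c \<and> v = word_inv c @ q \<and> word_mult u v = p @ q \<and> reduced (p @ q)"
    using assms
  proof (induction u arbitrary: v rule: rev_induct)
    case Nil
    then show ?case by force
  next
    case (snoc x u)
    show ?case
    proof (cases "\<exists>v'. v = inv_letter x # v'")
      case True
      then obtain v' where v: "v = inv_letter x # v'" by blast
      have "reduced u" "reduced v'"
        using snoc.prems v by (auto simp: reduced_append reduced_Cons)
      from snoc.IH[OF this] obtain p c q where
        "u = p @ c" "v' = word_inv c @ q" "word_mult u v' = p @ q" "reduced (p @ q)"
        by blast
      then show ?thesis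
        using v by (intro exI[of _ p] exI[of _ "c @ [x]"] exI[of _ q]) auto
    next
      case False
      then have "reduced ((u @ [x]) @ v)"
        using snoc.prems by (subst reduced_append) (auto simp: neq_Nil_conv)
      then show ?thesis
        using word_mult_reduced[of "u @ [x]" v] by (intro exI[of _ "u @ [x]"] exI[of _ "[]"] exI[of _ v]) simp
    qed
  qed
  then show thesis
    using that by blast
qed

text \<open>The cancelled piece is no longer than \<open>v\<close>, so a nonempty prefix of
  \<open>u\<close> survives.\<close>

lemma hd_word_mult:
  assumes "reduced u" "reduced v" "length v < length u"
  shows "word_mult u v \<noteq> []" "hd (word_mult u v) = hd u"
proof -
  obtain p c q where "u = p @ c" "v = word_inv c @ q" "word_mult u v = p @ q"
    using word_mult_cancellation[OF assms(1,2)] by metis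
  moreover from this have "p \<noteq> []"
    using assms(3) by auto
  ultimately show "word_mult u v \<noteq> []" "hd (word_mult u v) = hd u"
    by (metis append_is_Nil_conv, metis hd_append2)
qed

section \<open>The free group of rank three\<close>

text \<open>
  The nonabelian groups \<open>f3\<close> and \<open>f3_aut\<close> are written additively, since
  \<open>group_add\<close> is the type class of not necessarily commutative groups.
\<close>

typedef f3 = "{w :: (nat \<times> bool) list. reduced w \<and> fst ` set w \<subseteq> {1, 2, 3}}"
  morphisms word_of f3_of
  by (rule exI[of _ "[]"]) auto

setup_lifting type_definition_f3

lemma reduced_word_of [simp]: "reduced (word_of x)"
  and word_of_letters: "fst ` set (word_of x) \<subseteq> {1, 2, 3}"
  using word_of[of x] by auto

instantiation f3 :: group_add
begin

lift_definition zero_f3 :: f3 is "[]" by simp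
lift_definition plus_f3 :: "f3 \<Rightarrow> f3 \<Rightarrow> f3" is "word_mult"
proof -
  fix u v :: "(nat \<times> bool) list"
  assume u: "reduced u \<and> fst ` set u \<subseteq> {1, 2, 3}" and v: "reduced v \<and> fst ` set v \<subseteq> {1, 2, 3}"
  have "fst ` set (word_mult u v) \<subseteq> fst ` set u \<union> fst ` set v"
    using set_word_mult[of u v] by blast
  then show "reduced (word_mult u v) \<and> fst ` set (word_mult u v) \<subseteq> {1, 2, 3}"
    using u v reduced_word_mult[of v u] by blast
qed
lift_definition uminus_f3 :: "f3 \<Rightarrow> f3" is word_inv
  by simp
definition minus_f3 :: "f3 \<Rightarrow> f3 \<Rightarrow> f3" where "minus_f3 x y = x + - y"

instance
proof
  fix a b c :: f3
  show "a + b + c = a + (b + c)"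
    by transfer (simp add: word_mult_assoc)
  show "0 + a = a" by transfer simp
  show "a + 0 = a" by transfer (simp add: word_mult_reduced)
  show "- a + a = 0" 
  proof transfer
    fix a :: "(nat \<times> bool) list"
    assume "reduced a \<and> fst ` set a \<subseteq> {1, 2, 3}"
    then show "word_mult (word_inv a) a = []"
      using word_mult_word_inv[of "[]" a] word_mult_reduced[of a "[]"] by simp
  qed
  show "a + - b = a - b" by (simp add: minus_f3_def)
qed

end

lemmas group_normalize = diff_conv_add_uminus add.assoc minus_add minus_minus minus_add_cancel
  add_minus_cancel left_minus right_minus add_0_left add_0_right minus_zero

lemma length_word_mult_le:
  assumes "reduced u" "reduced v"
  shows "length (word_mult u v) \<le> length u + length v"
proof -
  obtain p c q where "u = p @ c" "v = word_inv c @ q" "word_mult u v = p @ q"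
    using word_mult_cancellation[OF assms] by metis
  then show ?thesis by simp
qed

lemmas word_of_simps = zero_f3.rep_eq plus_f3.rep_eq uminus_f3.rep_eq

lemma word_of_eq_Nil_iff [simp]: "word_of x = [] \<longleftrightarrow> x = 0"
  by (metis word_of_inject zero_f3.rep_eq)

lemma word_of_zero [simp]: "word_of 0 = []"
  by (simp add: zero_f3.rep_eq)

lemma word_of_plus:
  "reduced (word_of x @ word_of y) \<Longrightarrow> word_of (x + y) = word_of x @ word_of y"
  by (simp add: plus_f3.rep_eq word_mult_reduced)

lemma length_word_of_plus: "length (word_of (x + y)) \<le> length (word_of x) + length (word_of y)"
  by (simp add: plus_f3.rep_eq length_word_mult_le)

lemma letter_in: "a \<in> set (word_of x) \<Longrightarrow> fst a \<in> {1, 2, 3}"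
  using word_of_letters[of x] by blast

lemma word_of_f3_of: "reduced w \<Longrightarrow> fst ` set w \<subseteq> {1, 2, 3} \<Longrightarrow> word_of (f3_of w) = w"
  by (simp add: f3_of_inverse)

definition letter :: "nat \<times> bool \<Rightarrow> f3" where
  "letter a = f3_of [a]"

abbreviation gen :: "nat \<Rightarrow> f3" where
  "gen i \<equiv> letter (i, True)"

lemma word_of_letter: "fst a \<in> {1, 2, 3} \<Longrightarrow> word_of (letter a) = [a]"
  unfolding letter_def by (rule word_of_f3_of) auto

lemma letter_inv_letter: "fst a \<in> {1, 2, 3} \<Longrightarrow> letter (inv_letter a) = - letter a"
  by (simp add: word_of_inject[symmetric] word_of_simps word_of_letter del: word_of_inject)

lemma letter_cases:
  assumes "fst a \<in> {1, 2, 3}"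
  shows "letter a = (if snd a then gen (fst a) else - gen (fst a))"
  using letter_inv_letter[of "(fst a, True)"] assms by (cases a) auto

lemma split_word_of:
  assumes "word_of x = u @ v"
  shows "x = f3_of u + f3_of v" "word_of (f3_of u) = u" "word_of (f3_of v) = v"
proof -
  have "reduced (u @ v)" "fst ` set (u @ v) \<subseteq> {1, 2, 3}"
    using word_of[of x] assms by auto
  then show uv: "word_of (f3_of u) = u" "word_of (f3_of v) = v"
    by (auto simp: reduced_append intro!: word_of_f3_of)
  then have "word_of (f3_of u + f3_of v) = word_of x"
    using \<open>reduced (u @ v)\<close> assms by (simp add: word_of_plus)
  then show "x = f3_of u + f3_of v"
    by (simp add: word_of_inject)
qed

lemma f3_induct [case_names zero letter]:
  assumes "P 0" and "\<And>a x. fst a \<in> {1, 2, 3} \<Longrightarrow> P x \<Longrightarrow> P (letter a + x)"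
  shows "P x"
proof (induction "word_of x" arbitrary: x)
  case Nil
  then have "x = 0" using word_of_eq_Nil_iff[of x] by simp
  with assms(1) show ?case by simp
next
  case (Cons a w)
  then have w: "word_of x = [a] @ w" by simp
  have a: "fst a \<in> {1, 2, 3}" using letter_in[of a x] w by auto
  have "P (f3_of w)" using Cons.hyps(1)[of "f3_of w"] split_word_of(3)[OF w] by simp
  then have "P (letter a + f3_of w)" using assms(2) a by blast
  then show ?case using split_word_of(1)[OF w] by (simp add: letter_def)
qed

section \<open>Conjugates of generators and their canonical conjugators\<close>

lemma word_of_conj_gen: 
  assumes "l \<in> {1, 2, 3}" and "x = 0 \<or> fst (last (word_of x)) \<noteq> l"
  shows "word_of (x + gen l - x) = word_of x @ (l, True) # word_inv (word_of x)"
proof -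
  have l: "word_of (gen l) = [(l, True)]" using assms(1) by (simp add: word_of_letter)
  have 1: "word_of (x + gen l) = word_of x @ [(l, True)]"
    using assms(2) l by (subst word_of_plus) (auto simp: reduced_append inv_letter_def)
  have "word_of (x + gen l + - x) = (word_of x @ [(l, True)]) @ word_inv (word_of x)"
    using assms(2) by (subst word_of_plus)
      (auto simp: 1 uminus_f3.rep_eq reduced_append reduced_Cons hd_word_inv inv_letter_def)
  then show ?thesis by simp
qed

text \<open>Without cancellation the conjugator is the first half of the reduced word, so it can be
  read off once the lengths are known to agree.\<close>

lemma conj_gen_inject:
  assumes "l \<in> {1, 2, 3}" "x + gen l - x = y + gen l - y"
    and "x = 0 \<or> fst (last (word_of x)) \<noteq> l" "y = 0 \<or> fst (last (word_of y)) \<noteq> l"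
  shows "x = y"
proof -
  have eq: "word_of x @ (l, True) # word_inv (word_of x) = word_of y @ (l, True) # word_inv (word_of y)"
    using word_of_conj_gen assms by metis
  then have "length (word_of x) = length (word_of y)"
    by (drule_tac arg_cong[of _ _ length]) simp
  with eq have "word_of x = word_of y" by simp
  then show ?thesis by (simp add: word_of_inject)
qed

lemma strip_gen:
  assumes "l \<in> {1, 2, 3}"
  obtains y c where "word_of x = word_of y @ c" "\<forall>a\<in>set c. fst a = l"
    "y = 0 \<or> fst (last (word_of y)) \<noteq> l" "x + gen l - x = y + gen l - y"
proof -
  have "\<exists>y c. word_of x = word_of y @ c \<and> (\<forall>a\<in>set c. fst a = l) \<and>
    (y = 0 \<or> fst (last (word_of y)) \<noteq> l) \<and> x + gen l - x = y + gen l - y"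
  proof (induction "length (word_of x)" arbitrary: x)
    case 0
    then show ?case by (intro exI[of _ x] exI[of _ "[]"]) auto
  next
    case (Suc n)
    show ?case
    proof (cases "fst (last (word_of x)) = l")
      case True
      define a where "a = last (word_of x)"
      define z where "z = f3_of (butlast (word_of x))"
      have w: "word_of x = butlast (word_of x) @ [a]"
        using Suc.hyps(2) unfolding a_def by (metis append_butlast_last_id length_0_conv nat.distinct(1))
      have x: "x = z + letter a" "word_of x = word_of z @ [a]"
        using split_word_of[OF w] w by (auto simp: z_def letter_def)
      have fa: "fst a = l" using True by (simp add: a_def)
      have "x + gen l - x = z + (letter a + gen l - letter a) - z"
        by (simp add: x(1) algebra_simps minus_add)
      also have "letter a + gen l - letter a = gen l"
        using letter_cases[of a] fa assms by (auto simp: algebra_simps)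
      finally have "x + gen l - x = z + gen l - z" .
      moreover obtain y c where "word_of z = word_of y @ c" "\<forall>a\<in>set c. fst a = l"
        "y = 0 \<or> fst (last (word_of y)) \<noteq> l" "z + gen l - z = y + gen l - y"
        using Suc.hyps(1)[of z] Suc.hyps(2) x(2) by auto
      ultimately show ?thesis
        using x(2) fa by (intro exI[of _ y] exI[of _ "c @ [a]"]) auto
    next
      case False
      then show ?thesis by (intro exI[of _ x] exI[of _ "[]"]) auto
    qed
  qed
  then show thesis using that by blast
qed

text \<open>A word commuting with \<open>gen l\<close> has the same canonical conjugator as 0, so it
  consists of letters over \<open>l\<close>; two different generators leave only the empty word.
  This yields injectivity of \<open>inner\<close>.\<close>

lemma centralizes_gens_imp_zero:
  assumes "\<And>l. l \<in> {1, 2, 3} \<Longrightarrow> x + gen l - x = gen l"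
  shows "x = 0"
proof -
  have "\<forall>a\<in>set (word_of x). fst a = l" if l: "l \<in> {1, 2, 3}" for l
  proof -
    obtain y c where y: "word_of x = word_of y @ c" "\<forall>a\<in>set c. fst a = l"
      "y = 0 \<or> fst (last (word_of y)) \<noteq> l" "x + gen l - x = y + gen l - y"
      by (rule strip_gen[OF l])
    then have "y + gen l - y = 0 + gen l - 0" using assms[OF l] by simp
    then have "y = 0" using conj_gen_inject[OF l _ y(3), of 0] by simp
    then show ?thesis using y by simp
  qed
  from this[of 1] this[of 2] have "word_of x = []"
    by (cases "word_of x") auto
  then show ?thesis by simp
qed

subsection \<open>Homomorphisms and automorphisms\<close>

text \<open>The map given by the universal property of the free group. Any \<open>group_add\<close>
  is allowed as target, so it produces both endomorphisms of \<open>f3\<close> and the homomorphism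
  \<open>lift_out\<close> into \<open>f3_aut\<close>.\<close>

definition extend :: "(nat \<Rightarrow> 'a::group_add) \<Rightarrow> f3 \<Rightarrow> 'a" where
  "extend U x = sum_list (map (\<lambda>a. if snd a then U (fst a) else - U (fst a)) (word_of x))"

lemma extend_zero [simp]: "extend U 0 = 0"
  by (simp add: extend_def)

lemma extend_add: "extend U (x + y) = extend U x + extend U y"
proof -
  let ?v = "\<lambda>a. if snd a then U (fst a) else - U (fst a)"
  have c: "sum_list (map ?v (cons_reduce a w)) = ?v a + sum_list (map ?v w)" for a w
    by (cases w) (auto simp: inv_letter_def add.assoc[symmetric])
  have "sum_list (map ?v (word_mult u w)) = sum_list (map ?v u) + sum_list (map ?v w)" for u w
    by (induction u) (simp_all add: c add.assoc)
  then show ?thesis by (simp add: extend_def plus_f3.rep_eq)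
qed

lemma extend_letter:
  "fst a \<in> {1, 2, 3} \<Longrightarrow> extend U (letter a) = (if snd a then U (fst a) else - U (fst a))"
  by (simp add: extend_def word_of_letter)

lemma additive_zero:
  fixes f :: "'a::group_add \<Rightarrow> 'b::group_add"
  assumes "\<And>x y. f (x + y) = f x + f y"
  shows "f 0 = 0"
proof -
  have "f 0 + 0 = f 0 + f 0"
    using assms[of 0 0] by simp
  then show ?thesis
    by (simp only: add_left_cancel)
qed

lemma additive_minus:
  fixes f :: "'a::group_add \<Rightarrow> 'b::group_add"
  assumes "\<And>x y. f (x + y) = f x + f y"
  shows "f (- x) = - f x"
  using assms[of x "- x"] additive_zero[OF assms] by (metis minus_unique right_minus)

lemma additive_ext:
  fixes f g :: "f3 \<Rightarrow> 'b::group_add"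
  assumes f: "\<And>x y. f (x + y) = f x + f y" and g: "\<And>x y. g (x + y) = g x + g y"
    and eq: "\<And>i. i \<in> {1, 2, 3} \<Longrightarrow> f (gen i) = g (gen i)"
  shows "f x = g x"
proof (induction x rule: f3_induct)
  case zero
  then show ?case by (simp add: additive_zero[OF f] additive_zero[OF g])
next
  case (letter a x)
  then show ?case
    using letter_cases[of a] eq by (auto simp: f g additive_minus[OF f] additive_minus[OF g])
qed

lemma extend_minus: "extend U (- x) = - extend U x"
  by (rule additive_minus) (rule extend_add)

lemma extend_diff: "extend U (x - y) = extend U x - extend U y"
  using extend_add[of U x "- y"] by (simp add: extend_minus)

typedef f3_aut = "{\<phi> :: f3 \<Rightarrow> f3. bij \<phi> \<and> (\<forall>x y. \<phi> (x + y) = \<phi> x + \<phi> y)}"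
  morphisms app aut_of
  by (rule exI[of _ id]) auto

setup_lifting type_definition_f3_aut

instantiation f3_aut :: group_add
begin

lift_definition zero_f3_aut :: f3_aut is id by simp
lift_definition plus_f3_aut :: "f3_aut \<Rightarrow> f3_aut \<Rightarrow> f3_aut" is "(\<circ>)"
  by (simp add: bij_comp)
lift_definition uminus_f3_aut :: "f3_aut \<Rightarrow> f3_aut" is "inv_into UNIV"
proof
  fix \<phi> :: "f3 \<Rightarrow> f3"
  assume \<phi>: "bij \<phi> \<and> (\<forall>x y. \<phi> (x + y) = \<phi> x + \<phi> y)"
  then show "bij (inv_into UNIV \<phi>)" by (simp add: bij_imp_bij_inv)
  show "\<forall>x y. inv_into UNIV \<phi> (x + y) = inv_into UNIV \<phi> x + inv_into UNIV \<phi> y"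
    using \<phi> by (metis bij_inv_eq_iff)
qed
definition minus_f3_aut :: "f3_aut \<Rightarrow> f3_aut \<Rightarrow> f3_aut" where "minus_f3_aut x y = x + - y"

instance
proof
  fix a b c :: f3_aut
  show "a + b + c = a + (b + c)" by transfer (simp add: o_assoc)
  show "0 + a = a" "a + 0 = a" by (transfer; simp)+
  show "- a + a = 0" by transfer (simp add: bij_is_inj)
  show "a + - b = a - b" by (simp add: minus_f3_aut_def)
qed

end

lemma app_plus_aut [simp]: "app (\<phi> + \<psi>) x = app \<phi> (app \<psi> x)"
  and app_zero_aut [simp]: "app 0 x = x"
  by (transfer, simp)+

lemma app_plus: "app \<phi> (x + y) = app \<phi> x + app \<phi> y"
  by transfer simp

lemma app_zero [simp]: "app \<phi> 0 = 0"
  by (rule additive_zero) (rule app_plus)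

lemma app_minus: "app \<phi> (- x) = - app \<phi> x"
  by (rule additive_minus) (rule app_plus)

lemma app_diff: "app \<phi> (x - y) = app \<phi> x - app \<phi> y"
  using app_plus[of \<phi> x "- y"] by (simp add: app_minus)

lemma f3_aut_eqI: "(\<And>i. i \<in> {1, 2, 3} \<Longrightarrow> app \<phi> (gen i) = app \<psi> (gen i)) \<Longrightarrow> \<phi> = \<psi>"
  by (metis app_inject app_plus additive_ext[of "app \<phi>" "app \<psi>"] ext)

definition inner :: "f3 \<Rightarrow> f3_aut" where
  "inner w = aut_of (\<lambda>x. w + x - w)"

lemma app_inner: "app (inner w) x = w + x - w"
proof -
  have "bij (\<lambda>x. w + x - w)"
    by (rule o_bij[of "\<lambda>x. - w + x + w"]) (auto simp: fun_eq_iff algebra_simps)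
  moreover have "w + (x + y) - w = w + x - w + (w + y - w)" for x y
    by (simp only: group_normalize)
  ultimately show ?thesis
    unfolding inner_def by (subst aut_of_inverse) auto
qed

lemma inner_plus: "inner (x + y) = inner x + inner y"
  by (rule f3_aut_eqI) (simp add: app_inner algebra_simps minus_add)

lemma inner_minus: "inner (- x) = - inner x"
  by (rule additive_minus) (rule inner_plus)

lemma inner_zero [simp]: "inner 0 = 0"
  by (rule additive_zero) (rule inner_plus)

lemma plus_inner: "\<phi> + inner w = inner (app \<phi> w) + \<phi>"
  by (rule f3_aut_eqI) (simp add: app_inner app_plus app_diff)

subsection \<open>Partial conjugations generate\<close>

definition twist :: "nat \<times> bool \<Rightarrow> nat \<Rightarrow> f3_aut" where
  "twist a k = aut_of (extend (\<lambda>l. if l = k then letter a + gen l - letter a else gen l))"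

lemma app_twist_gen:
  assumes "fst a \<in> {1, 2, 3}" "fst a \<noteq> k" "l \<in> {1, 2, 3}"
  shows "app (twist a k) (gen l) = (if l = k then letter a + gen l - letter a else gen l)"
proof -
  define T where "T b = extend (\<lambda>l. if l = k then letter b + gen l - letter b else gen l)" for b
  have T_gen: "T b (gen l) = (if l = k then letter b + gen l - letter b else gen l)"
    if "l \<in> {1, 2, 3}" for b l
    using that by (simp add: T_def extend_letter)
  have T_letter: "T b (letter c) = letter c" if "fst b = fst a" "fst c = fst a" for b c
    using that assms letter_cases[of c] T_gen by (auto simp: T_def extend_minus)
  have T_T: "T b (T (inv_letter b) x) = x" if b: "fst b = fst a" for b x
  proof (rule additive_ext[where g = "\<lambda>x. x"])
    fix l :: nat assume l: "l \<in> {1, 2, 3}"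
    have "T b (letter (inv_letter b) + gen l - letter (inv_letter b)) =
      letter (inv_letter b) + T b (gen l) - letter (inv_letter b)"
      using T_letter[of b "inv_letter b"] b by (simp add: T_def extend_add extend_diff)
    then show "T b (T (inv_letter b) (gen l)) = gen l"
      using l b assms by (auto simp: T_gen letter_inv_letter) (simp_all only: group_normalize)
  qed (auto simp: T_def extend_add)
  have "bij (T a)"
    using T_T[of a] T_T[of "inv_letter a"]
    by (intro o_bij[of "T (inv_letter a)"]) (auto simp: fun_eq_iff)
  then have "app (twist a k) = T a"
    unfolding twist_def T_def by (subst aut_of_inverse) (auto simp: extend_add)
  with T_gen assms show ?thesis by simp
qed

lemma twist_inv_letter:
  assumes "fst a \<in> {1, 2, 3}" "fst a \<noteq> k"
  shows "twist (inv_letter a) k = - twist a k"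
proof -
  have fix_letter: "app (twist a k) (letter a) = letter a"
    using letter_cases[of a] assms by (auto simp: app_twist_gen app_minus)
  have "twist a k + twist (inv_letter a) k = 0"
    using assms
    by (intro f3_aut_eqI)
      (auto simp: app_twist_gen letter_inv_letter app_plus app_diff app_minus fix_letter,
        simp_all only: group_normalize)
  then show ?thesis by (metis minus_unique)
qed

text \<open>With three generators, conjugating the two others by \<open>a\<close> conjugates
  everything by \<open>a\<close>. So the two partial conjugations by \<open>a\<close> are mutually
  inverse modulo inner automorphisms.\<close>

lemma twist_plus_twist:
  assumes "fst a \<in> {1, 2, 3}" "k \<in> {1, 2, 3}" "l \<in> {1, 2, 3}" "fst a \<noteq> k" "fst a \<noteq> l" "k \<noteq> l"
  shows "twist a k + twist a l = inner (letter a)"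
proof (intro f3_aut_eqI)
  fix i :: nat assume i: "i \<in> {1, 2, 3}"
  have "app (twist a k) (letter a) = letter a" "letter a + gen (fst a) - letter a = gen (fst a)"
    using assms letter_cases[of a] by (auto simp: app_twist_gen app_minus algebra_simps)
  moreover have "i = fst a \<or> i = k \<or> i = l"
    using i assms by auto
  ultimately show "app (twist a k + twist a l) (gen i) = app (inner (letter a)) (gen i)"
    using i assms by (auto simp: app_twist_gen app_inner app_plus app_diff)
qed

text \<open>
  The outer classes of the partial conjugations of \<open>x\<^sub>3\<close> by \<open>x\<^sub>1\<close>, of \<open>x\<^sub>3\<close> by \<open>x\<^sub>2\<close> and of \<open>x\<^sub>1\<close>
  by \<open>x\<^sub>3\<close> form a basis of the group of outer pure symmetric automorphisms, which is free.
  The remaining three are their inverses modulo inner automorphisms.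
\<close>

definition target :: "nat \<Rightarrow> nat" where
  "target j = (if j = 3 then 1 else 3)"

text \<open>\<open>f3\<close> has a second role here, as the abstract free group on the three outer
  classes; freeness turns the choice of lifts into a homomorphism.\<close>

definition lift_out :: "f3 \<Rightarrow> f3_aut" where
  "lift_out = extend (\<lambda>j. twist (j, True) (target j))"

lemma lift_out_plus: "lift_out (x + y) = lift_out x + lift_out y"
  by (simp add: lift_out_def extend_add)

lemma lift_out_minus: "lift_out (- x) = - lift_out x"
  by (simp add: lift_out_def extend_minus)

lemma lift_out_zero [simp]: "lift_out 0 = 0"
  by (simp add: lift_out_def)

lemma target_neq: "j \<in> {1, 2, 3} \<Longrightarrow> target j \<noteq> j" "target j \<in> {1, 2, 3}"
  by (auto simp: target_def)

lemma lift_out_letter: "fst a \<in> {1, 2, 3} \<Longrightarrow> lift_out (letter a) = twist a (target (fst a))"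
  using twist_inv_letter[of "(fst a, True)" "target (fst a)"] target_neq[of "fst a"]
  by (cases a) (auto simp: lift_out_def extend_letter)

definition pure_symmetric :: "f3_aut \<Rightarrow> bool" where
  "pure_symmetric \<phi> \<longleftrightarrow> (\<forall>i\<in>{1, 2, 3}. \<exists>w. app \<phi> (gen i) = w + gen i - w)"

definition factors :: "f3_aut \<Rightarrow> bool" where
  "factors \<phi> \<longleftrightarrow> (\<exists>w q. \<phi> = inner w + lift_out q)"

lemma factors_mult:
  "(inner w + lift_out q) + (inner w' + lift_out q') =
     inner (w + app (lift_out q) w') + lift_out (q + q')"
  by (simp add: inner_plus lift_out_plus add.assoc) (metis add.assoc plus_inner)

lemma factors_plus: "factors \<phi> \<Longrightarrow> factors \<psi> \<Longrightarrow> factors (\<phi> + \<psi>)"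
  unfolding factors_def by (metis factors_mult)

lemma factors_minus: "factors \<phi> \<Longrightarrow> factors (- \<phi>)"
  unfolding factors_def by (metis minus_add plus_inner inner_minus lift_out_minus)

lemma factors_inner: "factors (inner w)"
  unfolding factors_def by (metis add.right_neutral lift_out_zero)

lemma factors_lift_out: "factors (lift_out q)"
  unfolding factors_def by (metis add.left_neutral inner_zero)

lemma factors_twist:
  assumes "fst a \<in> {1, 2, 3}" "k \<in> {1, 2, 3}" "fst a \<noteq> k"
  shows "factors (twist a k)"
proof (cases "k = target (fst a)")
  case True
  then show ?thesis using factors_lift_out lift_out_letter assms(1) by metis
next
  case False
  then have "twist a k + lift_out (letter a) = inner (letter a)"
    using twist_plus_twist[of a k "target (fst a)"] assms lift_out_letter target_neq by metis
  then have "twist a k = inner (letter a) + - lift_out (letter a)"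
    by (metis add_diff_cancel diff_conv_add_uminus)
  then show ?thesis
    by (simp add: factors_plus factors_minus factors_inner factors_lift_out del: add_uminus_conv_diff)
qed

text \<open>
  The heart of Nielsen's method: if no twist shortens the conjugators \<open>W i\<close>, then the central
  letter of a conjugate is never cancelled in a product.
\<close>

lemma nielsen_step:
  assumes last: "W (fst a) = 0 \<or> fst (last (word_of (W (fst a)))) \<noteq> fst a"
    and red: "\<And>i b r. i \<in> {1, 2, 3} \<Longrightarrow> fst b \<in> {1, 2, 3} \<Longrightarrow> fst b \<noteq> i \<Longrightarrow>
      word_of (W i) \<noteq> word_of (W (fst b)) @ b # r"
    and a: "fst a \<in> {1, 2, 3}"
    and y: "y = 0 \<or> (\<exists>b t. word_of y = word_of (W (fst b)) @ b # t \<and> b \<noteq> inv_letter a \<and> fst b \<in> {1, 2, 3})"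
  shows "\<exists>t. word_of (W (fst a) + letter a - W (fst a) + y) = word_of (W (fst a)) @ a # t"
proof -
  define i where "i = fst a"
  obtain p c q where pcq: "word_inv (word_of (W i)) = p @ c" "word_of y = word_inv c @ q"
    "word_mult (word_inv (word_of (W i))) (word_of y) = p @ q" "reduced (p @ q)"
    by (rule word_mult_cancellation[of "word_inv (word_of (W i))" "word_of y"]) auto
  \<comment> \<open>What survives of the inverse conjugator and \<open>y\<close> must not begin with
    the inverse of \<open>a\<close>; otherwise the central letter would be cancelled.\<close>
  have hd: "p @ q = [] \<or> hd (p @ q) \<noteq> inv_letter a"
  proof (cases "p = []")
    case False
    then have "W i \<noteq> 0" using pcq(1) by auto
    then have "hd (p @ q) = inv_letter (last (word_of (W i)))"
      using False pcq(1) hd_word_inv[of "word_of (W i)"] by simp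
    then show ?thesis
      using last \<open>W i \<noteq> 0\<close> by (auto simp: i_def)
  next
    case True
    then have yq: "word_of y = word_of (W i) @ q"
      using pcq(1,2) by (metis append_Nil word_inv_simps(4))
    show ?thesis
    proof (cases "y = 0")
      case True
      then show ?thesis using yq \<open>p = []\<close> by simp
    next
      case False
      then obtain b t where b: "word_of y = word_of (W (fst b)) @ b # t" "b \<noteq> inv_letter a"
        "fst b \<in> {1, 2, 3}" using y by blast
      from yq b(1) have "word_of (W i) @ q = word_of (W (fst b)) @ b # t" by simp
      \<comment> \<open>Prefixes of one word are comparable. In the first case \<open>red\<close>
        keeps an extending letter from being the inverse of \<open>a\<close>; the second contradicts
        \<open>red\<close>, or the lengths if \<open>fst b = i\<close>.\<close>
      then consider s where "word_of (W (fst b)) = word_of (W i) @ s" "q = s @ b # t"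
        | r where "word_of (W i) = word_of (W (fst b)) @ b # r"
        by (fastforce simp: append_eq_append_conv2 append_eq_Cons_conv)
      then show ?thesis
      proof cases
        case (1 s)
        show ?thesis
        proof (cases s)
          case Nil
          then show ?thesis using 1 b(2) \<open>p = []\<close> by simp
        next
          case (Cons d r)
          then have "fst b \<noteq> i" using 1 by auto
          then have "d \<noteq> inv_letter a"
            using red[OF b(3), of d r] a 1 Cons by (auto simp: i_def)
          then show ?thesis using 1 Cons \<open>p = []\<close> by simp
        qed
      next
        case (2 r)
        then show ?thesis
          using red[of i b r] a b(3) by (cases "fst b = i") (auto simp: i_def)
      qed
    qed
  qed
  have wy: "word_of (- W i + y) = p @ q"
    using pcq(3) by (simp add: word_of_simps)
  have "word_of (letter a + (- W i + y)) = a # p @ q"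
    using hd pcq(4) a by (subst word_of_plus) (auto simp: word_of_letter wy reduced_Cons)
  moreover have "a \<noteq> inv_letter (last (word_of (W i)))" if "W i \<noteq> 0"
    using last that by (metis fst_inv_letter i_def word_of_eq_Nil_iff)
  ultimately have "word_of (W i + (letter a + (- W i + y))) = word_of (W i) @ a # p @ q"
    using hd pcq(4) by (subst word_of_plus) (auto simp del: append_assoc simp: reduced_append[of "word_of (W i)"] reduced_Cons)
  then show ?thesis
    by (simp add: i_def add.assoc diff_conv_add_uminus del: add_uminus_conv_diff)
qed

text \<open>Applied from the right end of the word, \<open>nielsen_step\<close> keeps the first
  central letter together with its conjugator. So an image of length one forces the conjugator
  belonging to the first letter to vanish.\<close>

lemma nielsen_reduced_prefix:
  assumes conj: "\<And>i. i \<in> {1, 2, 3} \<Longrightarrow> app \<phi> (gen i) = W i + gen i - W i"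
    and last: "\<And>i. i \<in> {1, 2, 3} \<Longrightarrow> W i = 0 \<or> fst (last (word_of (W i))) \<noteq> i"
    and red: "\<And>i b r. i \<in> {1, 2, 3} \<Longrightarrow> fst b \<in> {1, 2, 3} \<Longrightarrow> fst b \<noteq> i \<Longrightarrow>
      word_of (W i) \<noteq> word_of (W (fst b)) @ b # r"
    and "word_of x = a # v"
  shows "\<exists>t. word_of (app \<phi> x) = word_of (W (fst a)) @ a # t"
  using assms(4)
proof (induction v arbitrary: a x)
  case Nil
  have a: "fst a \<in> {1, 2, 3}" using letter_in[of a x] Nil by auto
  have "x = letter a" using Nil a by (metis word_of_inject word_of_letter)
  then have "app \<phi> x = W (fst a) + letter a - W (fst a) + 0"
    using letter_cases[of a] a conj[of "fst a"]
    by (auto simp: app_minus) (simp_all only: group_normalize)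
  then show ?case
    using nielsen_step[OF last[OF a] red a, of 0] by simp
next
  case (Cons b v)
  have a: "fst a \<in> {1, 2, 3}" "fst b \<in> {1, 2, 3}"
    using letter_in[of _ x] Cons.prems by auto
  have w: "word_of x = [a] @ (b # v)" using Cons.prems by simp
  define x' where "x' = f3_of (b # v)"
  have x': "word_of x' = b # v" "x = letter a + x'"
    using split_word_of[OF w] by (auto simp: x'_def letter_def)
  have "b \<noteq> inv_letter a"
    using reduced_word_of[of x] Cons.prems by (simp del: reduced_word_of)
  moreover obtain t where "word_of (app \<phi> x') = word_of (W (fst b)) @ b # t"
    using Cons.IH[OF x'(1)] by blast
  moreover have "app \<phi> x = W (fst a) + letter a - W (fst a) + app \<phi> x'"
    using letter_cases[of a] a conj[of "fst a"]
    by (auto simp: app_minus app_plus x'(2)) (simp_all only: group_normalize)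
  ultimately show ?case
    using nielsen_step[where W = W and y = "app \<phi> x'", OF last[OF a(1)] red a(1)] a(2) by metis
qed

text \<open>Descent on the total length of the conjugators: trailing letters are dropped and twists
  applied as long as this shortens them. In the Nielsen reduced case \<open>\<phi>\<close> is the
  identity, because each generator has a preimage, to which \<open>nielsen_reduced_prefix\<close>
  applies.\<close>

lemma factors_of_conjugators:
  assumes "\<And>i. i \<in> {1, 2, 3} \<Longrightarrow> app \<phi> (gen i) = W i + gen i - W i"
  shows "factors \<phi>"
  using assms
proof (induction "\<Sum>i\<in>{1, 2, 3}. length (word_of (W i))" arbitrary: \<phi> W rule: less_induct)
  case less
  have measure: "(\<Sum>j\<in>{1, 2, 3}. length (word_of ((W(i := x)) j))) < (\<Sum>j\<in>{1, 2, 3}. length (word_of (W j)))"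
    if "i \<in> {1, 2, 3}" "length (word_of x) < length (word_of (W i))" for i x
    using that by (intro sum_strict_mono_ex1) (auto intro!: bexI[of _ i])
  consider (last) i where "i \<in> {1, 2, 3}" "W i \<noteq> 0" "fst (last (word_of (W i))) = i"
    | (twist) i a r where "i \<in> {1, 2, 3}" "fst a \<in> {1, 2, 3}" "fst a \<noteq> i"
        "word_of (W i) = word_of (W (fst a)) @ a # r"
    | (reduced) "\<And>i. i \<in> {1, 2, 3} \<Longrightarrow> W i = 0 \<or> fst (last (word_of (W i))) \<noteq> i"
        "\<And>i a r. i \<in> {1, 2, 3} \<Longrightarrow> fst a \<in> {1, 2, 3} \<Longrightarrow> fst a \<noteq> i \<Longrightarrow>
          word_of (W i) \<noteq> word_of (W (fst a)) @ a # r"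
    by metis
  then show ?case
  proof cases
    case last
    obtain y c where y: "word_of (W i) = word_of y @ c" "y = 0 \<or> fst (last (word_of y)) \<noteq> i"
      "W i + gen i - W i = y + gen i - y"
      by (rule strip_gen[OF last(1)])
    have "c \<noteq> []" using y last by (cases "c = []") auto
    then have "length (word_of y) < length (word_of (W i))" using y(1) by simp
    then show ?thesis
      using less.prems y(3) by (intro less.hyps[OF measure[OF last(1)], of y]) auto
  next
    case twist
    \<comment> \<open>Composing with the inverse twist multiplies \<open>W i\<close> on the left by
      the inverse of \<open>app \<phi> (letter a)\<close>, which deletes exactly the letter
      \<open>a\<close> after the prefix \<open>W (fst a)\<close>.\<close>
    let ?y = "W (fst a) + f3_of r"
    have w: "word_of (W i) = (word_of (W (fst a)) @ [a]) @ r" using twist(4) by simp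
    have w': "word_of (f3_of (word_of (W (fst a)) @ [a])) = word_of (W (fst a)) @ [a]"
      using split_word_of(2)[OF w] .
    have Wi: "W i = W (fst a) + letter a + f3_of r"
      using split_word_of(1)[OF w] split_word_of(1)[OF w'] by (simp add: letter_def word_of_inverse)
    have "length (word_of ?y) < length (word_of (W i))"
      using length_word_of_plus[of "W (fst a)" "f3_of r"] split_word_of(3)[OF w] w by simp
    moreover have "app (\<phi> + twist (inv_letter a) i) (gen j) =
        (W(i := ?y)) j + gen j - (W(i := ?y)) j" if j: "j \<in> {1, 2, 3}" for j
    proof (cases "j = i")
      case True
      have "app \<phi> (letter a) = W (fst a) + letter a - W (fst a)"
        using letter_cases[of a] twist less.prems[of "fst a"]
        by (auto simp: app_minus) (simp_all only: group_normalize)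
      then show ?thesis
        using True j twist less.prems[OF j] Wi
        by (simp add: app_twist_gen letter_inv_letter app_plus app_diff app_minus)
          (simp only: group_normalize)
    next
      case False
      then show ?thesis
        using j twist less.prems[OF j] by (simp add: app_twist_gen)
    qed
    ultimately have "factors (\<phi> + twist (inv_letter a) i)"
      using less.hyps[OF measure[OF twist(1)], of ?y] by blast
    moreover have "factors (- twist (inv_letter a) i)"
      using twist by (intro factors_minus factors_twist) auto
    ultimately have "factors (\<phi> + twist (inv_letter a) i + - twist (inv_letter a) i)"
      by (rule factors_plus)
    then show ?thesis by (simp only: group_normalize)
  next
    case reduced
    have W0: "W i = 0" if i: "i \<in> {1, 2, 3}" for i
    proof -
      obtain x where x: "app \<phi> x = gen i"
        using app[of \<phi>] by (auto dest!: bij_is_surj surjD[where y = "gen i"] intro: sym)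
      have "x \<noteq> 0" using x i word_of_letter[of "(i, True)"] by auto
      then obtain a v where v: "word_of x = a # v"
        by (metis neq_Nil_conv word_of_eq_Nil_iff)
      have "\<exists>t. word_of (app \<phi> x) = word_of (W (fst a)) @ a # t"
        using less.prems reduced v by (rule nielsen_reduced_prefix)
      then obtain t where "word_of (app \<phi> x) = word_of (W (fst a)) @ a # t" ..
      then have "word_of (W (fst a)) @ a # t = [(i, True)]"
        using x i by (simp add: word_of_letter)
      then show ?thesis by (cases "word_of (W (fst a))") auto
    qed
    have "\<phi> = inner 0"
      using less.prems W0 by (intro f3_aut_eqI) (auto simp: app_inner)
    then show ?thesis by (simp only: factors_inner)
  qed
qed

lemma pure_symmetric_factors: "pure_symmetric \<phi> \<Longrightarrow> factors \<phi>"
  unfolding pure_symmetric_def by (metis factors_of_conjugators)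


subsection \<open>Uniqueness of the factorisation\<close>

text \<open>
  A ping-pong argument on outer classes. In \<open>lift_out q\<close> with last letter \<open>a = (j, e)\<close>,
  conjugate such that \<open>j\<close> is fixed: then the conjugator of \<open>target j\<close> starts with \<open>a\<close>, and the
  other one does not start with a letter \<open>(j, _)\<close>. The next letter of \<open>q\<close> sees the
  configuration \<open>neutral\<close>, unless it is \<open>a\<close> again.
\<close>

definition conjugators :: "f3_aut \<Rightarrow> f3 \<Rightarrow> (nat \<Rightarrow> f3) \<Rightarrow> nat \<Rightarrow> bool" where
  "conjugators \<phi> g W j \<longleftrightarrow> W j = 0 \<and>
     (\<forall>l\<in>{1, 2, 3}. g + app \<phi> (gen l) - g = W l + gen l - W l \<and>
        (W l = 0 \<or> fst (last (word_of (W l))) \<noteq> l))"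

lemma conjugatorsD:
  assumes "conjugators \<phi> g W j"
  shows "W j = 0" "l \<in> {1, 2, 3} \<Longrightarrow> g + app \<phi> (gen l) - g = W l + gen l - W l"
    "l \<in> {1, 2, 3} \<Longrightarrow> W l = 0 \<or> fst (last (word_of (W l))) \<noteq> l"
  using assms unfolding conjugators_def by blast+

abbreviation avoids :: "nat \<Rightarrow> f3 \<Rightarrow> bool" where
  "avoids j x \<equiv> x = 0 \<or> fst (hd (word_of x)) \<noteq> j"

definition neutral :: "f3_aut \<Rightarrow> nat \<Rightarrow> bool" where
  "neutral \<phi> j \<longleftrightarrow> (\<exists>g W. conjugators \<phi> g W j \<and> (\<forall>l\<in>{1, 2, 3}. avoids j (W l)))"

definition separating :: "f3_aut \<Rightarrow> nat \<times> bool \<Rightarrow> bool" where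
  "separating \<phi> a \<longleftrightarrow> (\<exists>g W. conjugators \<phi> g W (fst a) \<and>
     (\<forall>l\<in>{1, 2, 3}. l \<noteq> target (fst a) \<longrightarrow> avoids (fst a) (W l)) \<and>
     W (target (fst a)) \<noteq> 0 \<and> hd (word_of (W (target (fst a)))) = a)"

text \<open>After conjugation by \<open>g\<close> the generator \<open>fst a\<close> is fixed, so
  the twist prepends \<open>a\<close> to the conjugator of the target and leaves the others alone.
  The hypothesis \<open>hd\<close> prevents cancellation.\<close>

lemma separating_step:
  assumes a: "fst a \<in> {1, 2, 3}" and W: "conjugators \<phi> g W (fst a)"
    and av: "\<And>l. l \<in> {1, 2, 3} \<Longrightarrow> l \<noteq> target (fst a) \<Longrightarrow> avoids (fst a) (W l)"
    and hd: "W (target (fst a)) = 0 \<or> hd (word_of (W (target (fst a)))) \<noteq> inv_letter a"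
  shows "separating (\<phi> + lift_out (letter a)) a"
proof -
  define k where "k = target (fst a)"
  have k: "k \<in> {1, 2, 3}" "k \<noteq> fst a" using target_neq a by (auto simp: k_def)
  define W' where "W' = W(k := letter a + W k)"
  have w: "word_of (letter a + W k) = a # word_of (W k)"
    using hd a by (subst word_of_plus) (auto simp: word_of_letter reduced_Cons k_def)
  have g_letter: "g + app \<phi> (letter a) - g = letter a"
  proof -
    have "g + app \<phi> (gen (fst a)) - g = gen (fst a)"
      using conjugatorsD(2)[OF W a] conjugatorsD(1)[OF W] by simp
    moreover from this have "g - app \<phi> (gen (fst a)) - g = - gen (fst a)"
      by (metis group_normalize(1,2,3,4))
    ultimately show ?thesis
      using letter_cases[OF a] by (simp add: app_minus)
  qed
  have "conjugators (\<phi> + lift_out (letter a)) g W' (fst a)"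
    unfolding conjugators_def
  proof (intro conjI ballI)
    show "W' (fst a) = 0" using W k by (simp add: W'_def conjugators_def)
    fix l :: nat assume l: "l \<in> {1, 2, 3}"
    show "W' l = 0 \<or> fst (last (word_of (W' l))) \<noteq> l"
      using conjugatorsD(3)[OF W l] k by (auto simp: W'_def w)
    show "g + app (\<phi> + lift_out (letter a)) (gen l) - g = W' l + gen l - W' l"
    proof (cases "l = k")
      case True
      have "g + app (\<phi> + lift_out (letter a)) (gen l) - g =
        (g + app \<phi> (letter a) - g) + (g + app \<phi> (gen k) - g) - (g + app \<phi> (letter a) - g)"
        using True a k by (simp add: lift_out_letter app_twist_gen app_plus app_diff k_def[symmetric])
          (simp only: group_normalize)
      also have "\<dots> = letter a + (W k + gen k - W k) - letter a"
        using conjugatorsD(2)[OF W k(1)] g_letter by simp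
      finally show ?thesis
        using True by (simp add: W'_def) (simp only: group_normalize)
    next
      case False
      then show ?thesis
        using conjugatorsD(2)[OF W l] a k l
        by (simp add: lift_out_letter app_twist_gen k_def[symmetric] W'_def)
    qed
  qed
  moreover have "\<forall>l\<in>{1, 2, 3}. l \<noteq> k \<longrightarrow> avoids (fst a) (W' l)"
    using av by (simp add: W'_def k_def)
  moreover have "W' k \<noteq> 0" "hd (word_of (W' k)) = a"
    using w by (auto simp: W'_def)
  ultimately show ?thesis
    unfolding separating_def k_def by blast
qed

lemma neutral_imp_separating:
  assumes "fst a \<in> {1, 2, 3}" "neutral \<phi> (fst a)"
  shows "separating (\<phi> + lift_out (letter a)) a"
proof -
  obtain g W where "conjugators \<phi> g W (fst a)" "\<forall>l\<in>{1, 2, 3}. avoids (fst a) (W l)"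
    using assms(2) unfolding neutral_def by blast
  with assms(1) target_neq[of "fst a"] show ?thesis
    by (intro separating_step[where W = W and g = g]) auto
qed

lemma separating_same:
  assumes "fst a \<in> {1, 2, 3}" "separating \<phi> a"
  shows "separating (\<phi> + lift_out (letter a)) a"
proof -
  obtain g W where W: "conjugators \<phi> g W (fst a)"
    "\<forall>l\<in>{1, 2, 3}. l \<noteq> target (fst a) \<longrightarrow> avoids (fst a) (W l)" "hd (word_of (W (target (fst a)))) = a"
    using assms(2) unfolding separating_def by blast
  show ?thesis
  proof (rule separating_step[OF assms(1) W(1)])
    show "avoids (fst a) (W l)" if "l \<in> {1, 2, 3}" "l \<noteq> target (fst a)" for l
      using bspec[OF W(2) that(1)] that(2) by (rule mp)
    have "hd (word_of (W (target (fst a)))) \<noteq> inv_letter a"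
      unfolding W(3) by simp
    then show "W (target (fst a)) = 0 \<or> hd (word_of (W (target (fst a)))) \<noteq> inv_letter a"
      by (rule disjI2)
  qed
qed

text \<open>Renormalising so that \<open>m\<close> is fixed turns \<open>W l\<close> into
  \<open>- W m + W l\<close>. If \<open>W m\<close> is nonzero, the new conjugator begins with the
  inverse of the last letter of \<open>W m\<close>, which is not over \<open>m\<close>; if it is
  zero, the only nonzero \<open>W l\<close> begins with \<open>a\<close>.\<close>

lemma separating_imp_neutral:
  assumes a: "fst a \<in> {1, 2, 3}" and m: "m \<in> {1, 2, 3}" "m \<noteq> fst a" and sep: "separating \<phi> a"
  shows "neutral \<phi> m"
proof -
  obtain g W where W: "conjugators \<phi> g W (fst a)"
    "\<And>l. l \<in> {1, 2, 3} \<Longrightarrow> l \<noteq> target (fst a) \<Longrightarrow> avoids (fst a) (W l)"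
    "W (target (fst a)) \<noteq> 0" "hd (word_of (W (target (fst a)))) = a"
    using sep unfolding separating_def by blast
  note conj = conjugatorsD[OF W(1)]
  have W0: "W (fst a) = 0" by (rule conj(1))
  have "\<exists>y. g' + app \<phi> (gen l) - g' = y + gen l - y \<and> (y = 0 \<or> fst (last (word_of y)) \<noteq> l) \<and>
    avoids m y \<and> (l = m \<longrightarrow> y = 0)" if g': "g' = - W m + g" and l: "l \<in> {1, 2, 3}" for l g'
  proof -
    have eq: "g' + app \<phi> (gen l) - g' = (- W m + W l) + gen l - (- W m + W l)"
    proof -
      have "g' + app \<phi> (gen l) - g' = - W m + (g + app \<phi> (gen l) - g) - (- W m)"
        unfolding g' by (simp only: group_normalize)
      also have "\<dots> = - W m + (W l + gen l - W l) - (- W m)"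
        using conj(2)[OF l] by simp
      finally show ?thesis by (simp only: group_normalize)
    qed
    show ?thesis
    proof (cases "l = m")
      case True
      then show ?thesis using eq by (intro exI[of _ 0]) simp
    next
      case False
      \<comment> \<open>If both conjugators are nonzero, exactly one of \<open>l\<close> and
        \<open>m\<close> is the target; its conjugator begins with \<open>a\<close>, while the other
        avoids \<open>fst a\<close>. Hence nothing cancels.\<close>
      have hds: "W m = 0 \<or> W l = 0 \<or> fst (hd (word_of (W m))) \<noteq> fst (hd (word_of (W l)))"
      proof (rule ccontr)
        assume c: "\<not> ?thesis"
        then have "m \<noteq> fst a" "l \<noteq> fst a" using W0 by auto
        then have "m = target (fst a) \<or> l = target (fst a)"
          using a m l False target_neq[of "fst a"] by auto
        then show False
          using c W(2)[OF m(1)] W(2)[OF l] W(4) False by auto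
      qed
      have "word_of (- W m + W l) = word_inv (word_of (W m)) @ word_of (W l)"
        using hds by (subst word_of_plus) (auto simp: uminus_f3.rep_eq reduced_append last_word_inv)
      moreover obtain y c where y: "word_of (- W m + W l) = word_of y @ c"
        "y = 0 \<or> fst (last (word_of y)) \<noteq> l"
        "(- W m + W l) + gen l - (- W m + W l) = y + gen l - y"
        by (rule strip_gen[OF l])
      moreover have "avoids m y"
      proof (cases "W m = 0")
        case True
        then have "word_of (W l) = word_of y @ c" using y(1) by simp
        moreover have "avoids m (W l)"
        proof (cases "l = target (fst a)")
          case True
          then show ?thesis using W(4) m(2) by auto
        next
          case l': False
          have "m \<noteq> target (fst a)" using True W(3) by metis
          then have "l = fst a" using a m l l' False target_neq[of "fst a"] by auto
          then show ?thesis using W0 by simp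
        qed
        ultimately show ?thesis by (cases "y = 0") (auto simp: hd_append)
      next
        case False
        then have "word_of y @ c = word_inv (word_of (W m)) @ word_of (W l)"
          using calculation by simp
        moreover have "hd (word_inv (word_of (W m)) @ word_of (W l)) = inv_letter (last (word_of (W m)))"
          using False by (simp add: hd_word_inv)
        moreover have "fst (last (word_of (W m))) \<noteq> m"
          using conj(3)[OF m(1)] False by blast
        moreover have "hd (word_of y @ c) = hd (word_of y)" if "y \<noteq> 0"
          using that by simp
        ultimately have "fst (hd (word_of y)) = fst (inv_letter (last (word_of (W m))))" if "y \<noteq> 0"
          using that by simp
        then have "fst (hd (word_of y)) \<noteq> m" if "y \<noteq> 0"
          using that \<open>fst (last (word_of (W m))) \<noteq> m\<close> by simp
        then show ?thesis by blast
      qed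
      ultimately show ?thesis
        using eq False by (intro exI[of _ y]) simp
    qed
  qed
  then have "\<forall>l\<in>{1, 2, 3}. \<exists>y. (- W m + g) + app \<phi> (gen l) - (- W m + g) = y + gen l - y \<and>
     (y = 0 \<or> fst (last (word_of y)) \<noteq> l) \<and> avoids m y \<and> (l = m \<longrightarrow> y = 0)"
    by blast
  from bchoice[OF this] obtain W' where W': "\<forall>l\<in>{1, 2, 3}.
     (- W m + g) + app \<phi> (gen l) - (- W m + g) = W' l + gen l - W' l \<and>
     (W' l = 0 \<or> fst (last (word_of (W' l))) \<noteq> l) \<and> avoids m (W' l) \<and> (l = m \<longrightarrow> W' l = 0)"
    by blast
  show ?thesis
    unfolding neutral_def conjugators_def
  proof (rule exI[of _ "- W m + g"], rule exI[of _ W'], intro conjI ballI)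
    show "W' m = 0" using bspec[OF W' m(1)] by simp
    fix l :: nat assume "l \<in> {1, 2, 3}"
    note W'_l = bspec[OF W' this]
    show "(- W m + g) + app \<phi> (gen l) - (- W m + g) = W' l + gen l - W' l"
      by (rule conjunct1[OF W'_l])
    show "W' l = 0 \<or> fst (last (word_of (W' l))) \<noteq> l"
      by (rule conjunct1[OF conjunct2[OF W'_l]])
    show "avoids m (W' l)"
      by (rule conjunct1[OF conjunct2[OF conjunct2[OF W'_l]]])
  qed
qed

lemma neutral_zero: "neutral 0 j"
  unfolding neutral_def conjugators_def by (intro exI[of _ 0] exI[of _ "\<lambda>_. 0"]) simp

text \<open>Reading the word from the left, the next letter either repeats the last one or has a
  different generator, for which the configuration is neutral; reducedness excludes the inverse
  letter.\<close>

lemma separating_lift_out: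
  assumes "word_of q = v @ [a]"
  shows "separating (lift_out q) a"
  using assms
proof (induction v arbitrary: q a rule: rev_induct)
  case Nil
  have a: "fst a \<in> {1, 2, 3}" using letter_in[of a q] Nil by auto
  then have "q = letter a" using Nil by (simp add: word_of_inject[symmetric] word_of_letter)
  then show ?case using neutral_imp_separating[OF a neutral_zero] by simp
next
  case (snoc b v)
  have a: "fst a \<in> {1, 2, 3}" "fst b \<in> {1, 2, 3}"
    using letter_in[of _ q] snoc.prems by auto
  have "a \<noteq> inv_letter b"
    using reduced_word_of[of q] snoc.prems by (simp add: reduced_append del: reduced_word_of)
  obtain q' where q': "word_of q' = v @ [b]" "q = q' + letter a"
    using split_word_of[OF snoc.prems] by (auto simp: letter_def)
  then have sep: "separating (lift_out q') b"
    using snoc.IH by blast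
  have "separating (lift_out q' + lift_out (letter a)) a"
  proof (cases "fst a = fst b")
    case True
    then have "a = b" using eq_or_inv_letter \<open>a \<noteq> inv_letter b\<close> by metis
    then show ?thesis using separating_same a sep by blast
  next
    case False
    then show ?thesis
      using neutral_imp_separating separating_imp_neutral a sep by blast
  qed
  then show ?case by (simp add: q'(2) lift_out_plus)
qed

text \<open>For an inner automorphism every \<open>W l\<close> is one element \<open>y\<close> with
  trailing letters over \<open>l\<close> removed. The target forces \<open>y\<close> to begin with
  \<open>a\<close>. The third index \<open>i\<close> contradicts this, since \<open>W i\<close>
  avoids \<open>fst a\<close> and the removed letters are over \<open>i\<close>.\<close>

lemma separating_not_inner:
  assumes a: "fst a \<in> {1, 2, 3}" and sep: "separating \<phi> a"
  shows "\<phi> \<noteq> inner w"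
proof
  assume "\<phi> = inner w"
  obtain g W where W: "conjugators \<phi> g W (fst a)"
    "\<And>l. l \<in> {1, 2, 3} \<Longrightarrow> l \<noteq> target (fst a) \<Longrightarrow> avoids (fst a) (W l)"
    "W (target (fst a)) \<noteq> 0" "hd (word_of (W (target (fst a)))) = a"
    using sep unfolding separating_def by blast
  define y where "y = g + w"
  have split: "\<exists>c. word_of y = word_of (W l) @ c \<and> (\<forall>b\<in>set c. fst b = l)" if l: "l \<in> {1, 2, 3}" for l
  proof -
    obtain x c where x: "word_of y = word_of x @ c" "\<forall>b\<in>set c. fst b = l"
      "x = 0 \<or> fst (last (word_of x)) \<noteq> l" "y + gen l - y = x + gen l - x"
      by (rule strip_gen[OF l])
    have "y + gen l - y = g + app \<phi> (gen l) - g"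
      unfolding y_def \<open>\<phi> = inner w\<close> app_inner by (simp only: group_normalize)
    also have "\<dots> = W l + gen l - W l" by (rule conjugatorsD(2)[OF W(1) l])
    finally have "W l = x"
      using x(3,4) conjugatorsD(3)[OF W(1) l] conj_gen_inject[OF l, of "W l" x] by simp
    then show ?thesis using x by blast
  qed
  define k where "k = target (fst a)"
  have k: "k \<in> {1, 2, 3}" "k \<noteq> fst a" using target_neq a by (auto simp: k_def)
  obtain c where "word_of y = word_of (W k) @ c" using split k by blast
  then have y: "word_of y \<noteq> []" "hd (word_of y) = a"
    using W(3,4) by (auto simp: k_def)
  obtain i :: nat where i: "i \<in> {1, 2, 3}" "i \<noteq> fst a" "i \<noteq> k"
  proof -
    have "card {fst a, k} < card {1, 2, 3 :: nat}"
      by (simp add: card_insert_if)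
    then have "\<not> {1, 2, 3} \<subseteq> {fst a, k}"
      by (meson card_mono finite.emptyI finite.insertI leD)
    then show thesis using that by blast
  qed
  obtain c where c: "word_of y = word_of (W i) @ c" "\<forall>b\<in>set c. fst b = i"
    using split[OF i(1)] by blast
  show False
  proof (cases "W i = 0")
    case True
    then have "a \<in> set c" using c(1) y by (metis append_Nil hd_in_set word_of_zero)
    then show False using c(2) i(2) by auto
  next
    case False
    then have "hd (word_of (W i)) = a" using c(1) y by simp
    then show False using W(2)[OF i(1)] i(3) False by (auto simp: k_def)
  qed
qed

lemma lift_out_eq_inner_imp_zero:
  assumes "lift_out q = inner w"
  shows "q = 0"
proof (rule ccontr)
  assume "q \<noteq> 0"
  then obtain v a where v: "word_of q = v @ [a]"
    by (metis rev_exhaust word_of_eq_Nil_iff)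
  then have "fst a \<in> {1, 2, 3}" using letter_in[of a q] by simp
  then show False
    using separating_not_inner[of a "lift_out q" w] separating_lift_out[OF v] assms by simp
qed

text \<open>The quotient of the two outer parts has an inner lift and is therefore trivial; what
  remains is that only 0 acts trivially by conjugation.\<close>

lemma factors_unique:
  assumes eq: "inner w + lift_out q = inner w' + lift_out q'"
  shows "w = w'" "q = q'"
proof -
  have "lift_out (q + - q') = lift_out q + - lift_out q'"
    by (simp only: lift_out_plus lift_out_minus)
  also have "\<dots> = - inner w + (inner w + lift_out q) + - lift_out q'"
    by (simp only: minus_add_cancel)
  also have "\<dots> = inner (- w + w')"
    unfolding eq by (simp only: group_normalize inner_plus inner_minus)
  finally have "q + - q' = 0" by (rule lift_out_eq_inner_imp_zero)
  then show q: "q = q'" by simp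
  with eq have "inner w = inner w'" by simp
  then have "inner (- w' + w) = 0" by (simp only: inner_plus inner_minus left_minus)
  then have "- w' + w = 0"
    using app_inner[of "- w' + w"] by (intro centralizes_gens_imp_zero[of "- w' + w"]) simp
  then show "w = w'" by (simp only: neg_eq_iff_add_eq_0[symmetric] minus_minus)
qed

subsection \<open>The group of pure symmetric automorphisms\<close>

lemma pure_symmetric_zero: "pure_symmetric 0"
  unfolding pure_symmetric_def by (auto intro: exI[of _ 0])

lemma pure_symmetric_plus:
  assumes "pure_symmetric \<phi>" "pure_symmetric \<psi>"
  shows "pure_symmetric (\<phi> + \<psi>)"
  unfolding pure_symmetric_def
proof
  fix i :: nat assume i: "i \<in> {1, 2, 3}"
  obtain v where v: "app \<psi> (gen i) = v + gen i - v" using assms(2) i unfolding pure_symmetric_def by blast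
  obtain w where w: "app \<phi> (gen i) = w + gen i - w" using assms(1) i unfolding pure_symmetric_def by blast
  have "app (\<phi> + \<psi>) (gen i) = (app \<phi> v + w) + gen i - (app \<phi> v + w)"
    unfolding app_plus_aut v app_plus app_diff w by (simp only: group_normalize)
  then show "\<exists>w. app (\<phi> + \<psi>) (gen i) = w + gen i - w" ..
qed

lemma pure_symmetric_inner: "pure_symmetric (inner w)"
  unfolding pure_symmetric_def by (auto simp: app_inner)

lemma pure_symmetric_lift_out: "pure_symmetric (lift_out q)"
proof (induction q rule: f3_induct)
  case zero
  then show ?case by (simp add: pure_symmetric_zero)
next
  case (letter a x)
  have "\<exists>w. app (twist a (target (fst a))) (gen i) = w + gen i - w" if "i \<in> {1, 2, 3}" for i
    using app_twist_gen[OF letter(1) target_neq(1)[OF letter(1), symmetric] that]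
    by (cases "i = target (fst a)") (auto intro: exI[of _ 0])
  then have "pure_symmetric (twist a (target (fst a)))"
    unfolding pure_symmetric_def by blast
  then show ?case
    using letter by (simp add: lift_out_plus lift_out_letter pure_symmetric_plus)
qed

lemma pure_symmetric_iff_factors: "pure_symmetric \<phi> \<longleftrightarrow> factors \<phi>"
  by (metis factors_def pure_symmetric_factors pure_symmetric_inner pure_symmetric_lift_out
      pure_symmetric_plus)

declare One_nat_def [simp del] \<comment> \<open>it would turn the index set into \<open>{Suc 0, 2, 3}\<close>\<close>

section \<open>Comparison of the word model with \<open>f3\<close> and \<open>f3_aut\<close>\<close>

abbreviation "F3 \<equiv> free_group {1, 2, 3 :: nat}"

lemma carrier_F3: "carrier F3 = range word_of"
  using type_definition.Rep_range[OF type_definition_f3] by (simp add: free_group_def)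

lemma mult_F3: "word_of x \<otimes>\<^bsub>F3\<^esub> word_of y = word_of (x + y)"
  by (simp add: free_group_def plus_f3.rep_eq)

lemma one_F3: "\<one>\<^bsub>F3\<^esub> = word_of 0"
  by (simp add: free_group_def)

lemma group_F3: "group F3"
proof (rule groupI)
  fix x assume "x \<in> carrier F3"
  then obtain y where "x = word_of y" by (auto simp: carrier_F3)
  then show "\<exists>z\<in>carrier F3. z \<otimes>\<^bsub>F3\<^esub> x = \<one>\<^bsub>F3\<^esub>"
    by (intro bexI[of _ "word_of (- y)"]) (simp_all only: mult_F3 one_F3 left_minus carrier_F3 rangeI)
qed (auto simp: carrier_F3 mult_F3 one_F3 add.assoc simp del: word_of_zero)

lemma inv_F3: "inv\<^bsub>F3\<^esub> (word_of x) = word_of (- x)"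
  by (rule group.inv_equality[OF group_F3])
    (simp_all only: mult_F3 one_F3 left_minus carrier_F3 rangeI)

text \<open>Members of \<open>auto\<close> are extensional functions on the carrier, hence the
  restriction.\<close>

definition word_map :: "f3_aut \<Rightarrow> (nat \<times> bool) list \<Rightarrow> (nat \<times> bool) list" where
  "word_map \<phi> = restrict (\<lambda>w. word_of (app \<phi> (f3_of w))) (carrier F3)"

lemma word_map_word_of: "word_map \<phi> (word_of x) = word_of (app \<phi> x)"
  by (simp add: word_map_def carrier_F3 word_of_inverse)

lemma word_map_inject: "word_map \<phi> = word_map \<psi> \<longleftrightarrow> \<phi> = \<psi>"
  by (metis app_inject ext word_map_word_of word_of_inject)

lemma word_map_in_auto: "word_map \<phi> \<in> auto F3"
proof -
  have "bij (app \<phi>)" using app[of \<phi>] by blast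
  then have "bij_betw (word_map \<phi>) (range word_of) (range word_of)"
    by (intro bij_betwI[where g = "word_map (- \<phi>)"])
      (auto simp: word_map_word_of simp flip: app_plus_aut)
  then show ?thesis
    unfolding auto_def hom_def Bij_def
    by (auto simp: carrier_F3 mult_F3 word_map_word_of app_plus) (simp add: word_map_def carrier_F3)
qed

lemma auto_F3_E:
  assumes "f \<in> auto F3"
  obtains \<phi> where "f = word_map \<phi>"
proof -
  define \<phi> where "\<phi> x = f3_of (f (word_of x))" for x
  have f: "f \<in> extensional (range word_of)" "bij_betw f (range word_of) (range word_of)"
    "f (word_of x \<otimes>\<^bsub>F3\<^esub> word_of y) = f (word_of x) \<otimes>\<^bsub>F3\<^esub> f (word_of y)" for x y
    using assms unfolding auto_def Bij_def hom_def carrier_F3 by auto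
  have w\<phi>: "word_of (\<phi> x) = f (word_of x)" for x
  proof -
    have "f (word_of x) \<in> range word_of"
      using bij_betwE[OF f(2)] by blast
    then show ?thesis
      by (auto simp: \<phi>_def word_of_inverse)
  qed
  have "\<phi> (x + y) = \<phi> x + \<phi> y" for x y
  proof -
    have "word_of (\<phi> (x + y)) = word_of (\<phi> x + \<phi> y)"
      using f(3)[of x y] by (simp only: mult_F3 w\<phi>[symmetric])
    then show ?thesis by (simp only: word_of_inject)
  qed
  moreover have "bij \<phi>"
  proof (rule bijI)
    show "inj \<phi>"
    proof (rule injI)
      fix x y assume "\<phi> x = \<phi> y"
      then have "f (word_of x) = f (word_of y)" by (simp only: w\<phi>[symmetric])
      then have "word_of x = word_of y"
        using inj_onD[OF bij_betw_imp_inj_on[OF f(2)]] by blast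
      then show "x = y" by (simp only: word_of_inject)
    qed
    have "\<exists>x. y = \<phi> x" for y
    proof -
      have "word_of y \<in> f ` range word_of"
        using bij_betw_imp_surj_on[OF f(2)] by simp
      then obtain x where "word_of y = f (word_of x)" by blast
      then have "y = \<phi> x" by (simp only: w\<phi>[symmetric] word_of_inject)
      then show ?thesis ..
    qed
    then show "surj \<phi>" unfolding surj_def by blast
  qed
  ultimately have app: "app (aut_of \<phi>) = \<phi>" by (simp add: aut_of_inverse)
  have "f w = word_map (aut_of \<phi>) w" for w
  proof (cases "w \<in> range word_of")
    case True
    then obtain x where "w = word_of x" by blast
    then show ?thesis by (simp only: word_map_word_of app w\<phi>)
  next
    case False
    then show ?thesis
      using extensional_arb[OF f(1)] unfolding word_map_def carrier_F3 by (simp only: restrict_apply if_False)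
  qed
  then show thesis using that by blast
qed

lemma free_gen_eq: "i \<in> {1, 2, 3} \<Longrightarrow> free_gen i = word_of (gen i)"
  by (simp add: free_gen_def word_of_letter)

lemma carrier_PSigmaAut3: "carrier PSigmaAut3 = word_map ` Collect pure_symmetric"
proof -
  have "(\<exists>w\<in>carrier F3. word_map \<phi> (free_gen i) = w \<otimes>\<^bsub>F3\<^esub> free_gen i \<otimes>\<^bsub>F3\<^esub> inv\<^bsub>F3\<^esub> w) \<longleftrightarrow>
      (\<exists>w. app \<phi> (gen i) = w + gen i - w)" if i: "i \<in> {1, 2, 3}" for \<phi> i
    by (simp add: carrier_F3 free_gen_eq[OF i] word_map_word_of inv_F3 mult_F3 word_of_inject del: insert_iff)
  then have "word_map \<phi> \<in> pure_symmetric_auts {1, 2, 3} \<longleftrightarrow> pure_symmetric \<phi>" for \<phi>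
    unfolding pure_symmetric_auts_def pure_symmetric_def using word_map_in_auto by blast
  moreover have "pure_symmetric_auts {1, 2, 3} \<subseteq> range word_map"
    unfolding pure_symmetric_auts_def by (auto elim: auto_F3_E)
  ultimately show ?thesis
    unfolding PSigmaAut_def by auto
qed

lemma mult_PSigmaAut3: "word_map \<phi> \<otimes>\<^bsub>PSigmaAut3\<^esub> word_map \<psi> = word_map (\<phi> + \<psi>)"
proof -
  have "word_map \<phi> \<in> Bij (carrier F3)" for \<phi>
    using word_map_in_auto by (simp add: auto_def)
  then show ?thesis
    by (auto simp: PSigmaAut_def AutoGroup_def BijGroup_def compose_def word_map_def carrier_F3
        word_of_inverse restrict_def fun_eq_iff)
qed

lemma one_PSigmaAut3: "\<one>\<^bsub>PSigmaAut3\<^esub> = word_map 0"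
  by (auto simp: PSigmaAut_def AutoGroup_def BijGroup_def word_map_def carrier_F3 word_of_inverse
      restrict_def fun_eq_iff)

section \<open>Coordinates from the unique factorisation\<close>

definition aut_pair :: "f3 \<Rightarrow> f3 \<Rightarrow> (nat \<times> bool) list \<Rightarrow> (nat \<times> bool) list" where
  "aut_pair w q = word_map (inner w + lift_out q)"

lemma carrier_aut_pair: "carrier PSigmaAut3 = {aut_pair w q | w q. True}"
  unfolding carrier_PSigmaAut3 pure_symmetric_iff_factors factors_def aut_pair_def by blast

lemma aut_pair_carrier: "aut_pair w q \<in> carrier PSigmaAut3"
  unfolding carrier_aut_pair by blast

lemma carrier_aut_pairE:
  assumes "g \<in> carrier PSigmaAut3"
  obtains w q where "g = aut_pair w q"
  using assms unfolding carrier_aut_pair by blast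

lemma aut_pair_inject: "aut_pair w q = aut_pair w' q' \<longleftrightarrow> w = w' \<and> q = q'"
  unfolding aut_pair_def word_map_inject using factors_unique by blast

text \<open>The semidirect product law. A left factor with trivial outer part only prepends to the
  inner word; any other left factor also applies its lift to that word.\<close>

lemma mult_aut_pair:
  "aut_pair w q \<otimes>\<^bsub>PSigmaAut3\<^esub> aut_pair w' q' = aut_pair (w + app (lift_out q) w') (q + q')"
  by (simp add: aut_pair_def mult_PSigmaAut3 factors_mult)

lemma one_aut_pair: "\<one>\<^bsub>PSigmaAut3\<^esub> = aut_pair 0 0"
  by (simp add: aut_pair_def one_PSigmaAut3)

lemma group_PSigmaAut3: "group PSigmaAut3"
proof (rule groupI)
  fix x assume "x \<in> carrier PSigmaAut3"
  then obtain w q where x: "x = aut_pair w q" by (auto simp: carrier_aut_pair)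
  let ?y = "aut_pair (app (lift_out (- q)) (- w)) (- q)"
  have "?y \<otimes>\<^bsub>PSigmaAut3\<^esub> x = \<one>\<^bsub>PSigmaAut3\<^esub>"
    unfolding x mult_aut_pair one_aut_pair by (simp flip: app_plus)
  then show "\<exists>y\<in>carrier PSigmaAut3. y \<otimes>\<^bsub>PSigmaAut3\<^esub> x = \<one>\<^bsub>PSigmaAut3\<^esub>"
    by (intro bexI[of _ ?y]) (auto simp: carrier_aut_pair)
next
  fix x y z assume "x \<in> carrier PSigmaAut3" "y \<in> carrier PSigmaAut3" "z \<in> carrier PSigmaAut3"
  then show "x \<otimes>\<^bsub>PSigmaAut3\<^esub> y \<otimes>\<^bsub>PSigmaAut3\<^esub> z = x \<otimes>\<^bsub>PSigmaAut3\<^esub> (y \<otimes>\<^bsub>PSigmaAut3\<^esub> z)"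
    by (auto simp: carrier_PSigmaAut3 mult_PSigmaAut3 add.assoc)
next
  fix x y assume "x \<in> carrier PSigmaAut3" "y \<in> carrier PSigmaAut3"
  then show "x \<otimes>\<^bsub>PSigmaAut3\<^esub> y \<in> carrier PSigmaAut3"
    by (elim carrier_aut_pairE) (simp add: mult_aut_pair aut_pair_carrier)
next
  show "\<one>\<^bsub>PSigmaAut3\<^esub> \<in> carrier PSigmaAut3"
    by (auto simp: carrier_aut_pair one_aut_pair)
next
  fix x assume "x \<in> carrier PSigmaAut3"
  then show "\<one>\<^bsub>PSigmaAut3\<^esub> \<otimes>\<^bsub>PSigmaAut3\<^esub> x = x"
    by (auto simp: carrier_PSigmaAut3 mult_PSigmaAut3 one_PSigmaAut3)
qed

section \<open>A half space of words and powers of the commutator\<close>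

definition starts :: "f3 \<Rightarrow> bool" where
  "starts x \<longleftrightarrow> x \<noteq> 0 \<and> hd (word_of x) = (1, True)"

text \<open>Under right multiplication by a fixed \<open>y\<close> the half space can change only at
  words no longer than \<open>y\<close>, so its wall is finite.\<close>

lemma starts_plus:
  assumes "length (word_of y) < length (word_of x)"
  shows "starts (x + y) \<longleftrightarrow> starts x"
proof -
  have "word_of (x + y) \<noteq> []" "hd (word_of (x + y)) = hd (word_of x)"
    using hd_word_mult[OF reduced_word_of reduced_word_of assms] by (simp_all add: plus_f3.rep_eq)
  moreover have "x \<noteq> 0" using assms by auto
  ultimately show ?thesis by (auto simp: starts_def)
qed

lemma finite_length_word_of: "finite {x. length (word_of x) \<le> n}"
proof -
  have "word_of ` {x. length (word_of x) \<le> n} \<subseteq> {w. set w \<subseteq> {1, 2, 3} \<times> UNIV \<and> length w \<le> n}"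
    using letter_in by (auto simp: mem_Times_iff) fastforce
  moreover have "finite {w. set w \<subseteq> {1, 2, 3 :: nat} \<times> (UNIV :: bool set) \<and> length w \<le> n}"
    by (rule finite_lists_length_le) simp
  ultimately have "finite (word_of ` {x. length (word_of x) \<le> n})"
    by (rule finite_subset)
  then show ?thesis
    by (rule finite_imageD) (simp add: inj_on_def word_of_inject)
qed

definition gen_comm :: f3 where
  "gen_comm = gen 1 + gen 2 - gen 1 - gen 2"

definition comm_power :: "nat \<Rightarrow> f3" where
  "comm_power n = ((+) gen_comm ^^ n) 0"

text \<open>The commutator word is cyclically reduced, so its powers are written out without
  cancellation.\<close>

lemma word_of_comm_power:
  "word_of (comm_power n) = concat (replicate n [(1, True), (2, True), (1, False), (2, False)])"
proof (induction n)
  case 0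
  then show ?case by (simp add: comm_power_def)
next
  case (Suc n)
  have eq: "comm_power (Suc n) = letter (1, True) + (letter (2, True) + (letter (1, False) + (letter (2, False) + comm_power n)))"
    using letter_cases[of "(1, False)"] letter_cases[of "(2, False)"]
    by (simp add: comm_power_def gen_comm_def add.assoc diff_conv_add_uminus del: add_uminus_conv_diff)
  show ?case
    unfolding eq plus_f3.rep_eq using Suc.IH by (cases n) (simp_all add: word_of_letter)
qed

text \<open>Positive powers begin with \<open>gen 1\<close>. Their inverses begin with
  \<open>gen 2\<close>, since the commutator word ends in its inverse. A power longer than
  \<open>x\<close> keeps its first letter when \<open>x\<close> is added.\<close>

lemma starts_comm_power:
  shows "\<exists>n0. \<forall>n\<ge>n0. starts (comm_power n + x) \<and> \<not> starts (- comm_power n + x)"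
proof (intro exI allI impI)
  fix n assume n: "length (word_of x) + 1 \<le> n"
  have len: "length (word_of (comm_power n)) = 4 * n"
    by (simp add: word_of_comm_power length_concat sum_list_replicate)
  then have ne: "word_of (comm_power n) \<noteq> []" using n by auto
  obtain m where m: "n = Suc m" using n by (cases n) auto
  have "hd (word_of (comm_power n)) = (1, True)" "last (word_of (comm_power n)) = (2, False)"
    unfolding word_of_comm_power m 
    by (simp, simp only: replicate_append_same[symmetric] replicate_Suc concat_append) simp
  then have "starts (comm_power n)" "\<not> starts (- comm_power n)"
    using ne by (auto simp: starts_def uminus_f3.rep_eq hd_word_inv)
  then show "starts (comm_power n + x) \<and> \<not> starts (- comm_power n + x)"
    using starts_plus[of x "comm_power n"] starts_plus[of x "- comm_power n"] len n
    by (simp add: uminus_f3.rep_eq)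
qed


text \<open>The outer basis has \<open>target 1 = target 2 = 3\<close>, so the lifts of its first
  two elements fix \<open>gen 1\<close> and \<open>gen 2\<close>, hence their commutator. This is
  why the two directions of the plane commute.\<close>

lemma lift_out_gen_comm: "app (lift_out gen_comm) gen_comm = gen_comm"
proof -
  have L: "lift_out (letter (j, True)) = twist (j, True) 3" if "j \<in> {1, 2}" for j
    using that by (auto simp: lift_out_letter target_def)
  have t: "app (twist (j, True) 3) (gen i) = gen i" if "i \<in> {1, 2}" "j \<in> {1, 2}" for i j
    using that by (auto simp: app_twist_gen)
  have t': "app (- twist (j, True) 3) (gen i) = gen i" if "i \<in> {1, 2}" "j \<in> {1, 2}" for i j
    using t[OF that] by (metis app_plus_aut app_zero_aut left_minus)
  have "app (lift_out gen_comm) (gen i) = gen i" if "i \<in> {1, 2}" for i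
    using that unfolding gen_comm_def
    by (simp add: lift_out_plus lift_out_minus L t t' diff_conv_add_uminus del: add_uminus_conv_diff)
  then show ?thesis
    by (simp add: gen_comm_def app_plus app_diff)
qed

lemma pow_aut_pair:
  "aut_pair gen_comm 0 [^]\<^bsub>PSigmaAut3\<^esub> n = aut_pair (comm_power n) 0"
  "aut_pair 0 gen_comm [^]\<^bsub>PSigmaAut3\<^esub> n = aut_pair 0 (comm_power n)"
proof -
  have comm: "gen_comm + comm_power n = comm_power n + gen_comm" for n
    by (induction n) (simp_all add: comm_power_def, metis add.assoc)
  show "aut_pair gen_comm 0 [^]\<^bsub>PSigmaAut3\<^esub> n = aut_pair (comm_power n) 0"
    by (induction n) (simp_all add: one_aut_pair mult_aut_pair comm[symmetric], simp_all add: comm_power_def)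
  show "aut_pair 0 gen_comm [^]\<^bsub>PSigmaAut3\<^esub> n = aut_pair 0 (comm_power n)"
    by (induction n) (simp_all add: one_aut_pair mult_aut_pair comm[symmetric], simp_all add: comm_power_def)
qed

lemma inv_aut_pair: "inv\<^bsub>PSigmaAut3\<^esub> (aut_pair w q) = aut_pair (app (lift_out (- q)) (- w)) (- q)"
  by (rule group.inv_equality[OF group_PSigmaAut3])
    (auto simp: mult_aut_pair one_aut_pair carrier_aut_pair simp flip: app_plus)

text \<open>The relation \<open>c\<close> is read once among pairs with zero outer part and once
  among pairs with zero inner part; within either family the product is untwisted.\<close>

lemma character_gen_comm:
  assumes "\<psi> \<in> hom PSigmaAut3 real_add_group"
  shows "\<psi> (aut_pair gen_comm 0) = 0" "\<psi> (aut_pair 0 gen_comm) = 0"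
proof -
  have \<psi>: "\<psi> (aut_pair w q \<otimes>\<^bsub>PSigmaAut3\<^esub> aut_pair w' q') = \<psi> (aut_pair w q) + \<psi> (aut_pair w' q')"
    for w q w' q'
  proof -
    show ?thesis
      using hom_mult[OF assms aut_pair_carrier aut_pair_carrier] by (simp add: real_add_group_def)
  qed
  have c: "gen_comm + (gen 2 + gen 1) = gen 1 + gen 2"
    unfolding gen_comm_def by (simp only: group_normalize)
  show "\<psi> (aut_pair gen_comm 0) = 0"
    using \<psi>[of gen_comm 0 "gen 2 + gen 1" 0] \<psi>[of "gen 2" 0 "gen 1" 0] \<psi>[of "gen 1" 0 "gen 2" 0] c
    by (simp add: mult_aut_pair)
  show "\<psi> (aut_pair 0 gen_comm) = 0"
    using \<psi>[of 0 gen_comm 0 "gen 2 + gen 1"] \<psi>[of 0 "gen 2" 0 "gen 1"] \<psi>[of 0 "gen 1" 0 "gen 2"] c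
    by (simp add: mult_aut_pair)
qed

section \<open>The two half spaces of group elements\<close>

definition inner_starts :: "((nat \<times> bool) list \<Rightarrow> (nat \<times> bool) list) \<Rightarrow> bool" where
  "inner_starts g \<longleftrightarrow> (\<exists>w q. g = aut_pair w q \<and> starts w)"

definition outer_starts :: "((nat \<times> bool) list \<Rightarrow> (nat \<times> bool) list) \<Rightarrow> bool" where
  "outer_starts g \<longleftrightarrow> (\<exists>w q. g = aut_pair w q \<and> starts q)"

lemma starts_aut_pair:
  "inner_starts (aut_pair w q) \<longleftrightarrow> starts w" "outer_starts (aut_pair w q) \<longleftrightarrow> starts q"
  unfolding inner_starts_def outer_starts_def aut_pair_inject by blast+

text \<open>The outer condition bounds the length of \<open>q\<close> by that of \<open>qs'\<close>.
  The inner one bounds \<open>w\<close> only in terms of \<open>q\<close>, through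
  \<open>app (lift_out q) ws\<close>, so finiteness is that of a union of finite fibres over a
  finite base.\<close>

lemma finite_starts_change:
  assumes "s \<in> carrier PSigmaAut3" "s' \<in> carrier PSigmaAut3"
  shows "finite {g \<in> carrier PSigmaAut3.
    inner_starts (g \<otimes>\<^bsub>PSigmaAut3\<^esub> s) \<noteq> inner_starts g \<and>
    outer_starts (g \<otimes>\<^bsub>PSigmaAut3\<^esub> s') \<noteq> outer_starts g}"
proof -
  obtain ws qs where s: "s = aut_pair ws qs"
    by (rule carrier_aut_pairE[OF assms(1)])
  obtain ws' qs' where s': "s' = aut_pair ws' qs'"
    by (rule carrier_aut_pairE[OF assms(2)])
  let ?B = "SIGMA q:{q. length (word_of q) \<le> length (word_of qs')}.
    {w. length (word_of w) \<le> length (word_of (app (lift_out q) ws))}"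
  have fin: "finite ((\<lambda>(q, w). aut_pair w q) ` ?B)"
    by (intro finite_imageI finite_SigmaI finite_length_word_of)
  have mem: "g \<in> (\<lambda>(q, w). aut_pair w q) ` ?B"
    if gs: "g \<in> carrier PSigmaAut3" "inner_starts (g \<otimes>\<^bsub>PSigmaAut3\<^esub> s) \<noteq> inner_starts g"
      "outer_starts (g \<otimes>\<^bsub>PSigmaAut3\<^esub> s') \<noteq> outer_starts g" for g
  proof -
    obtain w q where g: "g = aut_pair w q"
      by (rule carrier_aut_pairE[OF gs(1)])
    have "starts (w + app (lift_out q) ws) \<noteq> starts w" "starts (q + qs') \<noteq> starts q"
      using gs(2,3) by (simp_all add: g s s' mult_aut_pair starts_aut_pair)
    then have "(q, w) \<in> ?B"
      using starts_plus[of "app (lift_out q) ws" w] starts_plus[of qs' q]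
      by (auto simp: not_less[symmetric])
    then show ?thesis by (rule image_eqI[rotated]) (simp add: g)
  qed
  show ?thesis
    by (rule finite_subset[OF _ fin]) (use mem in blast)
qed

section \<open>The second invariant\<close>

text \<open>The kernel hypotheses range over all characters, so the same plane contradicts every
  witness \<open>Y\<close>, \<open>h\<close> and every representative that membership in the
  invariant may supply.\<close>

lemma BNSR_2_empty:
  fixes G :: "('g, 'c) monoid_scheme" (structure)
    and A B :: "int \<Rightarrow> 'g" and P P' :: "'g \<Rightarrow> bool"
  assumes "group G"
    and A: "\<And>i. A i \<in> carrier G" "\<And>i j. A (i + j) = A i \<otimes> A j"
    and B: "\<And>i. B i \<in> carrier G" "\<And>i j. B (i + j) = B i \<otimes> B j"
    and comm: "\<And>i j. A i \<otimes> B j = B j \<otimes> A i"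
    and kernel: "\<And>\<psi> i. \<psi> \<in> hom G real_add_group \<Longrightarrow> \<psi> (A i) = 0"
      "\<And>\<psi> i. \<psi> \<in> hom G real_add_group \<Longrightarrow> \<psi> (B i) = 0"
    and fin: "\<And>s s'. s \<in> carrier G \<Longrightarrow> s' \<in> carrier G \<Longrightarrow>
      finite {g \<in> carrier G. P (g \<otimes> s) \<noteq> P g \<and> P' (g \<otimes> s') \<noteq> P' g}"
    and P_A: "\<And>g. g \<in> carrier G \<Longrightarrow> \<exists>n0. \<forall>n\<ge>n0. P (A n \<otimes> g) \<and> \<not> P (A (- n) \<otimes> g)"
    and P'_A: "\<And>g i. g \<in> carrier G \<Longrightarrow> P' (A i \<otimes> g) = P' g"
    and P'_B: "\<And>g. g \<in> carrier G \<Longrightarrow> \<exists>n0. \<forall>n\<ge>n0. P' (B n \<otimes> g) \<and> \<not> P' (B (- n) \<otimes> g)"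
  shows "BNSR 2 G = {}"
proof (rule equals0I)
  fix c assume "c \<in> BNSR 2 G"
  then obtain \<psi> and Y :: "('g \<times> real) topology" and E act N h where
    c: "c \<in> character_sphere G" "\<psi> \<in> c" and
    Y: "CW_complex Y E" "k_connected N Y" "proper_cocompact_cellular_action G Y E act"
      "height_map G Y act \<psi> h" "essentially_connected 2 Y (superlevel Y E h)"
    unfolding BNSR_def by blast
  have "\<psi> \<in> nontrivial_characters G"
    using c unfolding character_sphere_def quotient_def pos_scaling_def by blast
  then have \<psi>: "\<psi> \<in> hom G real_add_group" "\<exists>g\<in>carrier G. \<psi> g \<noteq> 0"
    by (simp_all add: nontrivial_characters_def)
  interpret group G by fact
  interpret height_action G Y E act \<psi> h
    by unfold_locales (fact Y \<psi>)+
  have "topspace Y \<noteq> {}" using Y(2) by (simp add: k_connected_def)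
  then have "\<not> essentially_connected 2 Y (superlevel Y E h)"
    by (rule not_essentially_simply_connected[where A = A and B = B and P = P and P' = P',
          OF \<psi>(2) _ A kernel(1)[OF \<psi>(1)] B kernel(2)[OF \<psi>(1)] comm fin P_A P'_A P'_B])
  then show False using Y(5) by blast
qed

section \<open>Integer powers\<close>

lemma (in group) commutes_int_pow:
  fixes i :: int
  assumes xy: "x \<in> carrier G" "y \<in> carrier G" and comm: "x \<otimes> y = y \<otimes> x"
  shows "x [^] i \<otimes> y = y \<otimes> x [^] i"
proof (cases i rule: int_cases2)
  case (nonneg n)
  then show ?thesis by (simp add: int_pow_int group_commutes_pow xy comm)
next
  case (nonpos n)
  let ?z = "x [^] n"
  have z: "?z \<in> carrier G" "?z \<otimes> y = y \<otimes> ?z" by (simp_all add: group_commutes_pow xy comm)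
  have "inv ?z \<otimes> y = inv ?z \<otimes> (y \<otimes> ?z) \<otimes> inv ?z" using z(1) xy by (simp add: m_assoc)
  also have "\<dots> = inv ?z \<otimes> (?z \<otimes> y) \<otimes> inv ?z" by (simp only: z(2))
  also have "\<dots> = y \<otimes> inv ?z" using z(1) xy by (simp add: m_assoc[symmetric])
  finally show ?thesis using nonpos xy by (simp add: int_pow_neg int_pow_int)
qed

lemma (in group) character_int_pow:
  fixes i :: int
  assumes "\<psi> \<in> hom G real_add_group" "x \<in> carrier G" "\<psi> x = 0"
  shows "\<psi> (x [^] i) = 0"
proof -
  have mult: "\<psi> (g \<otimes> g') = \<psi> g + \<psi> g'" if "g \<in> carrier G" "g' \<in> carrier G" for g g'
    using hom_mult[OF assms(1) that] by (simp add: real_add_group_def)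
  have one: "\<psi> \<one> = 0" using mult[of \<one> \<one>] by simp
  have nat: "\<psi> (x [^] n) = 0" for n :: nat
    by (induction n) (simp_all add: one mult assms)
  have "\<psi> (inv g) = - \<psi> g" if "g \<in> carrier G" for g
    using mult[of g "inv g"] one that by simp
  then show ?thesis
    by (cases i rule: int_cases2) (simp_all add: int_pow_neg int_pow_int nat assms(2))
qed

text \<open>The plane is indexed by integers but \<open>comm_power\<close> by natural numbers;
  statements about large indices pass from the latter to the former.\<close>

lemma eventually_int_of_nat:
  assumes "\<exists>m0. \<forall>m\<ge>m0. R (int m)"
  shows "\<exists>n0. \<forall>n\<ge>n0. R n"
proof -
  obtain m0 where m0: "\<forall>m\<ge>m0. R (int m)" using assms by blast
  have "R n" if n: "n \<ge> int m0" for n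
  proof -
    have "m0 \<le> nat n" "int (nat n) = n" using n by simp_all
    then show ?thesis using m0 by metis
  qed
  then show ?thesis by blast
qed

theorem theorem4p23:
  shows "BNSR 2 PSigmaAut3 = {}"
proof -
  interpret group PSigmaAut3 by (rule group_PSigmaAut3)
  define a where "a = aut_pair gen_comm 0"
  define b where "b = aut_pair 0 gen_comm"
  have carrier: "a \<in> carrier PSigmaAut3" "b \<in> carrier PSigmaAut3"
    by (simp_all add: a_def b_def aut_pair_carrier)
  have pow_a: "a [^]\<^bsub>PSigmaAut3\<^esub> int n = aut_pair (comm_power n) 0"
    "a [^]\<^bsub>PSigmaAut3\<^esub> (- int n) = aut_pair (- comm_power n) 0" for n
    using carrier by (simp_all add: int_pow_neg int_pow_int a_def pow_aut_pair inv_aut_pair)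
  have pow_b: "b [^]\<^bsub>PSigmaAut3\<^esub> int n = aut_pair 0 (comm_power n)"
    "b [^]\<^bsub>PSigmaAut3\<^esub> (- int n) = aut_pair 0 (- comm_power n)" for n
    using carrier by (simp_all add: int_pow_neg int_pow_int b_def pow_aut_pair inv_aut_pair)
  \<comment> \<open>For the invariance of \<open>outer_starts\<close> it matters only that powers of
    \<open>a\<close> have trivial outer part.\<close>
  have form_a: "\<exists>x. a [^]\<^bsub>PSigmaAut3\<^esub> i = aut_pair x 0" for i :: int
    by (cases i rule: int_cases2) (use pow_a in auto)
  have ab: "a \<otimes>\<^bsub>PSigmaAut3\<^esub> b = b \<otimes>\<^bsub>PSigmaAut3\<^esub> a"
    by (simp add: a_def b_def mult_aut_pair lift_out_gen_comm)
  show ?thesis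
  proof (rule BNSR_2_empty[where A = "\<lambda>i. a [^]\<^bsub>PSigmaAut3\<^esub> i" and B = "\<lambda>i. b [^]\<^bsub>PSigmaAut3\<^esub> i"
        and P = inner_starts and P' = outer_starts])
    show "group PSigmaAut3" by (rule group_PSigmaAut3)
    fix i j :: int
    show "a [^]\<^bsub>PSigmaAut3\<^esub> i \<in> carrier PSigmaAut3" "b [^]\<^bsub>PSigmaAut3\<^esub> i \<in> carrier PSigmaAut3"
      using carrier by simp_all
    show "a [^]\<^bsub>PSigmaAut3\<^esub> (i + j) = a [^]\<^bsub>PSigmaAut3\<^esub> i \<otimes>\<^bsub>PSigmaAut3\<^esub> a [^]\<^bsub>PSigmaAut3\<^esub> j"
      "b [^]\<^bsub>PSigmaAut3\<^esub> (i + j) = b [^]\<^bsub>PSigmaAut3\<^esub> i \<otimes>\<^bsub>PSigmaAut3\<^esub> b [^]\<^bsub>PSigmaAut3\<^esub> j"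
      using carrier by (simp_all add: int_pow_mult)
    show "a [^]\<^bsub>PSigmaAut3\<^esub> i \<otimes>\<^bsub>PSigmaAut3\<^esub> b [^]\<^bsub>PSigmaAut3\<^esub> j =
        b [^]\<^bsub>PSigmaAut3\<^esub> j \<otimes>\<^bsub>PSigmaAut3\<^esub> a [^]\<^bsub>PSigmaAut3\<^esub> i"
      by (intro commutes_int_pow commutes_int_pow[symmetric] carrier int_pow_closed ab ab[symmetric])
  next
    fix \<psi> and i :: int assume \<psi>: "\<psi> \<in> hom PSigmaAut3 real_add_group"
    show "\<psi> (a [^]\<^bsub>PSigmaAut3\<^esub> i) = 0" "\<psi> (b [^]\<^bsub>PSigmaAut3\<^esub> i) = 0"
      using character_int_pow[OF \<psi> carrier(1)] character_int_pow[OF \<psi> carrier(2)] character_gen_comm[OF \<psi>]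
      by (simp_all add: a_def b_def)
  next
    fix s s' assume "s \<in> carrier PSigmaAut3" "s' \<in> carrier PSigmaAut3"
    then show "finite {g \<in> carrier PSigmaAut3.
        inner_starts (g \<otimes>\<^bsub>PSigmaAut3\<^esub> s) \<noteq> inner_starts g \<and>
        outer_starts (g \<otimes>\<^bsub>PSigmaAut3\<^esub> s') \<noteq> outer_starts g}"
      by (rule finite_starts_change)
  next
    fix g and i :: int assume "g \<in> carrier PSigmaAut3"
    then obtain w q where g: "g = aut_pair w q" by (rule carrier_aut_pairE)
    show "\<exists>n0 :: int. \<forall>n\<ge>n0. inner_starts (a [^]\<^bsub>PSigmaAut3\<^esub> n \<otimes>\<^bsub>PSigmaAut3\<^esub> g) \<and>
        \<not> inner_starts (a [^]\<^bsub>PSigmaAut3\<^esub> (- n) \<otimes>\<^bsub>PSigmaAut3\<^esub> g)"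
      using starts_comm_power[of w]
      by (intro eventually_int_of_nat) (simp add: g pow_a mult_aut_pair starts_aut_pair)
    obtain x where "a [^]\<^bsub>PSigmaAut3\<^esub> i = aut_pair x 0" using form_a by blast
    then show "outer_starts (a [^]\<^bsub>PSigmaAut3\<^esub> i \<otimes>\<^bsub>PSigmaAut3\<^esub> g) = outer_starts g"
      by (simp add: g mult_aut_pair starts_aut_pair)
    show "\<exists>n0 :: int. \<forall>n\<ge>n0. outer_starts (b [^]\<^bsub>PSigmaAut3\<^esub> n \<otimes>\<^bsub>PSigmaAut3\<^esub> g) \<and>
        \<not> outer_starts (b [^]\<^bsub>PSigmaAut3\<^esub> (- n) \<otimes>\<^bsub>PSigmaAut3\<^esub> g)"
      using starts_comm_power[of q]
      by (intro eventually_int_of_nat) (simp add: g pow_b mult_aut_pair starts_aut_pair)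
  qed
qed

end
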